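(* Let $\lambda_B\approx 2.35698$ be the unique positive root of $x^8-2x^7-x^5-x^4-2x^3-2x^2-x-1$. For every real number $\gamma\geq\lambda_B$ there exists a permutation class whose growth rate is $\gamma$.
   Context: A permutation of length $n$ is a sequence containing each element of $\{1,\dots,n\}$ exactly once. A permutation $\tau$ of length $k$ is a subpermutation of $\sigma$ if $\sigma$ has a subsequence of length $k$ whose terms are in the same relative order as those of $\tau$. A permutation class is a set of permutations closed downward under the subpermutation order. For a class $\mathcal{C}$, $\mathcal{C}_n$ denotes its members of length $n$, and "$\gamma$ is the growth rate of $\mathcal{C}$" means that $\lim_{n\to\infty}|\mathcal{C}_n|^{1/n}$ exists and equals $\gamma$. *)

theory Defs
  imports Complex_Main "HOL-Library.Sublist"
begin

definition is_perm :: "nat list \<Rightarrow> bool" where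
  "is_perm xs \<longleftrightarrow> distinct xs \<and> set xs = {1..length xs}"

definition subperm :: "nat list \<Rightarrow> nat list \<Rightarrow> bool" where
  "subperm tau sigma \<longleftrightarrow>
     (\<exists>ys. subseq ys sigma \<and> length ys = length tau \<and>
        (\<forall>i<length tau. \<forall>j<length tau. tau ! i < tau ! j \<longleftrightarrow> ys ! i < ys ! j))"

definition perm_class :: "nat list set \<Rightarrow> bool" where
  "perm_class C \<longleftrightarrow> (\<forall>s\<in>C. is_perm s) \<and>
     (\<forall>s\<in>C. \<forall>t. is_perm t \<and> subperm t s \<longrightarrow> t \<in> C)"

definition has_growth_rate :: "nat list set \<Rightarrow> real \<Rightarrow> bool" where
  "has_growth_rate C g \<longleftrightarrow>
     (\<lambda>n. root n (real (card {s\<in>C. length s = n}))) \<longlonglongrightarrow> g"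

end

theory Submission
  imports Defs "HOL-Analysis.Analysis" "HOL-Combinatorics.Multiset_Permutations"
begin

text \<open>A sum closed class whose sum indecomposable members have generating function \<open>f\<close> grows like
  \<open>(1/z)^n\<close> for the positive solution \<open>z\<close> of \<open>f z = 1\<close>, and appending an increasing sequence to the members of
  a class raises its growth rate by one.  Hence it suffices to solve \<open>f (1/\<gamma>) = 1\<close> exactly, for every \<open>\<gamma>\<close> in
  an interval of length one, by choosing the indecomposables.

  Most of them are permutations whose inversion graph is a path with pendant vertices at no more than two
  centres.  For two centres at distance parameter \<open>d\<close>, the pendant and leg lengths may range over an arbitrary
  prefix of a fixed list, independently for each \<open>d\<close>.  The contribution of these permutations is
  \<open>\<Sum>d. z^(2d+7) v(m d)\<close> with freely chosen digits \<open>m d\<close>, and if the gaps between the digit values \<open>v m\<close> are small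
  it takes all values of an interval.  Paths, permutations with one centre and finitely many further small
  permutations bring the remaining part of \<open>1 - f z\<close> into that interval; the latter are removed greedily, one
  at a time, no weight exceeding the length of the interval.  The root \<open>\<lambda>\<^sub>B\<close> enters as the place where the
  smallest admissible choice of paths and one-centre permutations leaves exactly \<open>z^8/(1-z)\<close>.\<close>

subsection \<open>Deletion of entries and direct sums\<close>

text \<open>A deletion from a two-centre permutation shortens a leg, removes a pendant or cuts the
  tree, and a component that still has two centres keeps its \<open>d\<close>. All else that is
  needed are paths and one-centre permutations with legs of any length, a requirement that does not
  mention \<open>d\<close>; this is why the digits at different \<open>d\<close> do not interact.
  Raising \<open>d\<close> by one adds two entries, so the expansion has base \<open>z^2\<close>. As
  rates can be raised by one, only \<open>z\<close> between \<open>1 / (lamB + 1)\<close>, just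
  above 0.2978, and \<open>1 / lamB\<close>, about 0.4243, matter. At the upper end there is hardly
  room for the one-centre permutations that are forced. Towards the lower end the trees are too few,
  and general indecomposables of length up to six have to supply weight. These extras must be closed
  under deletion wherever the greedy removal stops. This dictates their order: all of one length
  before the next, except for a few selected ones of the next length that serve as small
  change.\<close>

definition rm :: "nat list \<Rightarrow> nat \<Rightarrow> nat list" where
  "rm s i = map (\<lambda>x. if x > s ! i then x - 1 else x) (take i s @ drop (Suc i) s)"

definition dsum :: "nat list \<Rightarrow> nat list \<Rightarrow> nat list" where
  "dsum s t = s @ map (\<lambda>v. v + length s) t"

definition indec :: "nat list \<Rightarrow> bool" where
  "indec s \<longleftrightarrow> is_perm s \<and> s \<noteq> [] \<and> (\<forall>k. 0 < k \<and> k < length s \<longrightarrow> \<not> is_perm (take k s))"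

inductive_set sumcl :: "nat list set \<Rightarrow> nat list set" for D where
  Nil: "[] \<in> sumcl D"
| Cons: "x \<in> D \<Longrightarrow> t \<in> sumcl D \<Longrightarrow> dsum x t \<in> sumcl D"

lemma is_perm_Nil [simp]: "is_perm []"
  by (simp add: is_perm_def)

lemma is_perm_nth_bounds: "is_perm s \<Longrightarrow> i < length s \<Longrightarrow> 1 \<le> s ! i \<and> s ! i \<le> length s"
  unfolding is_perm_def by (metis atLeastAtMost_iff nth_mem)

lemma length_rm [simp]: "i < length s \<Longrightarrow> length (rm s i) = length s - 1"
  by (simp add: rm_def)

lemma is_permI_subset:
  assumes "distinct s" "set s \<subseteq> {1..length s}"
  shows "is_perm s"
  using assms card_subset_eq[of "{1..length s}" "set s"] by (simp add: is_perm_def distinct_card)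

lemma distinct_take_drop:
  assumes "distinct s" "i < length s"
  shows "distinct (take i s @ drop (Suc i) s)" "s ! i \<notin> set (take i s @ drop (Suc i) s)"
  using assms id_take_nth_drop[OF assms(2)]
  by (metis distinct.simps(2) distinct_append not_distinct_conv_prefix append_Cons distinct_append
        disjoint_insert(1) list.set(2) disjoint_iff Un_iff set_append)+

lemma is_perm_rm:
  assumes s: "is_perm s" and i: "i < length s"
  shows "is_perm (rm s i)"
proof (rule is_permI_subset)
  let ?r = "take i s @ drop (Suc i) s"
  define v where "v = s ! i"
  have d: "distinct ?r" "v \<notin> set ?r"
    using distinct_take_drop[of s i] s i by (auto simp: is_perm_def v_def)
  have "inj_on (\<lambda>x. if x > v then x - 1 else x) (- {v})"
    by (intro inj_onI) (auto split: if_splits)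
  then have "inj_on (\<lambda>x. if x > v then x - 1 else x) (set ?r)"
    using d(2) by (elim inj_on_subset) blast
  then show "distinct (rm s i)"
    using d(1) by (simp only: rm_def distinct_map v_def[symmetric] simp_thms)
  have r: "set ?r \<subseteq> {1..length s}"
    using s set_take_subset[of i s] set_drop_subset[of "Suc i" s] by (auto simp: is_perm_def)
  have v: "1 \<le> v" "v \<le> length s"
    using is_perm_nth_bounds[OF s i] by (auto simp: v_def)
  have "(if x > v then x - 1 else x) \<in> {1..length s - 1}" if "x \<in> set ?r" for x
  proof -
    have "1 \<le> x" "x \<le> length s" "x \<noteq> v"
      using that r d(2) by (auto simp: subset_iff)
    then show ?thesis
      using v by auto
  qed
  then have "(\<lambda>x. if x > v then x - 1 else x) ` set ?r \<subseteq> {1..length s - 1}"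
    by blast
  moreover have "set (rm s i) = (\<lambda>x. if x > v then x - 1 else x) ` set ?r"
    by (simp only: rm_def v_def set_map)
  ultimately show "set (rm s i) \<subseteq> {1..length (rm s i)}"
    using i by simp
qed

section \<open>Order isomorphism of lists\<close>

definition oi :: "nat list \<Rightarrow> nat list \<Rightarrow> bool" where
  "oi xs ys \<longleftrightarrow> length xs = length ys \<and> (\<forall>i<length ys. \<forall>j<length ys. xs ! i < xs ! j \<longleftrightarrow> ys ! i < ys ! j)"

lemma oi_length: "oi xs ys \<Longrightarrow> length xs = length ys"
  by (simp only: oi_def)

lemma oiD: "oi xs ys \<Longrightarrow> i < length ys \<Longrightarrow> j < length ys \<Longrightarrow> xs ! i < xs ! j \<longleftrightarrow> ys ! i < ys ! j"
  by (simp only: oi_def)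

lemma oiI: "length xs = length ys \<Longrightarrow>
    (\<And>i j. i < length ys \<Longrightarrow> j < length ys \<Longrightarrow> xs ! i < xs ! j \<longleftrightarrow> ys ! i < ys ! j) \<Longrightarrow> oi xs ys"
  by (simp only: oi_def) blast

lemma oi_sym: "oi xs ys \<Longrightarrow> oi ys xs"
  by (rule oiI) (simp_all add: oi_length oiD)

lemma oi_trans: "oi xs ys \<Longrightarrow> oi ys zs \<Longrightarrow> oi xs zs"
  by (rule oiI) (simp_all add: oi_length oiD)

text \<open>In a list of distinct entries the order pattern determines the rank of each entry among
  the values, and within a fixed finite set the rank determines the value.\<close>

lemma oi_same_set_eq:
  assumes "oi xs ys" "distinct xs" "distinct ys" "set xs = set ys"
  shows "xs = ys"
proof -
  have rank: "card {y \<in> set zs. y \<le> zs ! i} = card {j. j < length zs \<and> zs ! j \<le> zs ! i}"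
    if "distinct zs" "i < length zs" for zs :: "nat list" and i
  proof -
    have "bij_betw (\<lambda>j. zs ! j) {j. j < length zs \<and> zs ! j \<le> zs ! i} {y \<in> set zs. y \<le> zs ! i}"
    proof (rule bij_betwI')
      fix j k assume "j \<in> {j. j < length zs \<and> zs ! j \<le> zs ! i}" "k \<in> {j. j < length zs \<and> zs ! j \<le> zs ! i}"
      then show "(zs ! j = zs ! k) = (j = k)" using that by (simp add: nth_eq_iff_index_eq)
    next
      fix y assume "y \<in> {y \<in> set zs. y \<le> zs ! i}"
      then show "\<exists>j\<in>{j. j < length zs \<and> zs ! j \<le> zs ! i}. y = zs ! j"
        by (auto simp: in_set_conv_nth)
    qed simp
    then show ?thesis by (simp add: bij_betw_same_card)
  qed
  have inj: "x = y" if "x \<in> B" "y \<in> B" "finite B" "card {w \<in> B. w \<le> x} = card {w \<in> B. w \<le> y}" for x y :: nat and B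
  proof (rule ccontr)
    assume "x \<noteq> y"
    then consider "x < y" | "y < x" by linarith
    then show False
    proof cases
      case 1
      then have "{w \<in> B. w \<le> x} \<subseteq> {w \<in> B. w \<le> y}" "y \<in> {w \<in> B. w \<le> y}" "y \<notin> {w \<in> B. w \<le> x}"
        using that(2) by auto
      then have "{w \<in> B. w \<le> x} \<subset> {w \<in> B. w \<le> y}" by blast
      then have "card {w \<in> B. w \<le> x} < card {w \<in> B. w \<le> y}"
        using that(3) by (intro psubset_card_mono) simp_all
      then show False using that(4) by simp
    next
      case 2
      then have "{w \<in> B. w \<le> y} \<subseteq> {w \<in> B. w \<le> x}" "x \<in> {w \<in> B. w \<le> x}" "x \<notin> {w \<in> B. w \<le> y}"
        using that(1) by auto
      then have "{w \<in> B. w \<le> y} \<subset> {w \<in> B. w \<le> x}" by blast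
      then have "card {w \<in> B. w \<le> y} < card {w \<in> B. w \<le> x}"
        using that(3) by (intro psubset_card_mono) simp_all
      then show False using that(4) by simp
    qed
  qed
  show ?thesis
  proof (rule nth_equalityI)
    show l: "length xs = length ys" using assms(1) by (rule oi_length)
    fix i assume i: "i < length xs"
    have "xs ! j \<le> xs ! i \<longleftrightarrow> ys ! j \<le> ys ! i" if "j < length xs" for j
      using oiD[OF assms(1), of i j] i l that by (metis not_less)
    then have "{j. j < length xs \<and> xs ! j \<le> xs ! i} = {j. j < length ys \<and> ys ! j \<le> ys ! i}"
      using l by auto
    then have "card {y \<in> set xs. y \<le> xs ! i} = card {y \<in> set xs. y \<le> ys ! i}"
      using rank[OF assms(2) i] rank[OF assms(3), of i] i l assms(4) by simp
    then show "xs ! i = ys ! i"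
      using inj[of "xs ! i" "set xs" "ys ! i"] i l assms(4) nth_mem[of i xs] nth_mem[of i ys] by simp
  qed
qed

lemma oi_perm_eq:
  assumes "oi s t" "is_perm s" "is_perm t"
  shows "s = t"
  using assms oi_length[OF assms(1)] by (intro oi_same_set_eq) (simp_all add: is_perm_def)

lemma subseq_skip:
  assumes "subseq ys s" "length ys < length s"
  shows "\<exists>i<length s. subseq ys (take i s @ drop (Suc i) s)"
  using assms
proof (induction rule: list_emb.induct)
  case (list_emb_Nil s)
  then show ?case by (intro exI[of _ 0]) auto
next
  case (list_emb_Cons xs ys y)
  then show ?case by (intro exI[of _ 0]) auto
next
  case (list_emb_Cons2 x y xs ys)
  then obtain i where "i < length ys" "subseq xs (take i ys @ drop (Suc i) ys)" by auto
  then show ?case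
    using list_emb_Cons2 by (intro exI[of _ "Suc i"]) auto
qed

text \<open>An occurrence of a shorter pattern misses some entry. Deleting that entry gives a
  shorter member that still contains the pattern, so induction on the length reduces downward
  closure to single deletions.\<close>

lemma perm_classI_rm:
  assumes P: "\<And>s. s \<in> C \<Longrightarrow> is_perm s"
    and R: "\<And>s i. s \<in> C \<Longrightarrow> i < length s \<Longrightarrow> rm s i \<in> C"
  shows "perm_class C"
proof -
  have "t \<in> C" if "s \<in> C" "is_perm t" "subperm t s" for s t
    using that
  proof (induction "length s" arbitrary: s rule: less_induct)
    case less
    then obtain ys where ys: "subseq ys s" "length ys = length t"
        "\<forall>i<length t. \<forall>j<length t. t ! i < t ! j \<longleftrightarrow> ys ! i < ys ! j"
      by (auto simp: subperm_def)
    have le: "length ys \<le> length s"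
      using ys(1) by (rule list_emb_length)
    show ?case
    proof (cases "length ys = length s")
      case True
      then have "ys = s"
        using ys(1) subseq_same_length by blast
      then have "s = t"
        using oi_perm_eq[OF _ P[OF less.prems(1)] less.prems(2)] ys(2,3) by (simp add: oi_def)
      then show ?thesis using less.prems(1) by simp
    next
      case False
      then obtain i where i: "i < length s" "subseq ys (take i s @ drop (Suc i) s)"
        using subseq_skip[OF ys(1)] le by auto
      define f where "f = (\<lambda>x. if x > s ! i then x - 1 else x)"
      have sub: "subseq (map f ys) (rm s i)"
        using subseq_map[OF i(2), of f] by (simp add: rm_def f_def)
      have "set ys \<subseteq> set (take i s @ drop (Suc i) s)"
        using list_emb_set[OF i(2)] by blast
      moreover have "s ! i \<notin> set (take i s @ drop (Suc i) s)"
        using distinct_take_drop(2)[OF _ i(1)] P[OF less.prems(1)] by (simp add: is_perm_def)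
      ultimately have ne: "y \<noteq> s ! i" if "y \<in> set ys" for y
        using that by blast
      have f: "f x < f y \<longleftrightarrow> x < y" if "x \<noteq> s ! i" "y \<noteq> s ! i" for x y
        using that by (auto simp: f_def)
      have "t ! j < t ! k \<longleftrightarrow> map f ys ! j < map f ys ! k" if "j < length t" "k < length t" for j k
      proof -
        have "j < length ys" "k < length ys"
          using that ys(2) by simp_all
        then show ?thesis
          using f[of "ys ! j" "ys ! k"] ne[of "ys ! j"] ne[of "ys ! k"] ys(3) that by simp
      qed
      then have "subperm t (rm s i)"
        unfolding subperm_def using sub ys(2) by (intro exI[of _ "map f ys"]) simp
      then show ?thesis
        using less.hyps[of "rm s i"] R[OF less.prems(1) i(1)] i(1) less.prems(2) by simp
    qed
  qed
  then show ?thesis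
    using P unfolding perm_class_def by blast
qed

section \<open>Direct sums, sum closures and indecomposable components\<close>

lemma length_dsum [simp]: "length (dsum s t) = length s + length t"
  by (simp add: dsum_def)

lemma dsum_Nil [simp]: "dsum [] t = t" "dsum s [] = s"
  by (simp_all add: dsum_def)

lemma dsum_assoc: "dsum (dsum r s) t = dsum r (dsum s t)"
  by (simp add: dsum_def add.assoc add.commute add.left_commute)

lemma is_perm_dsum:
  assumes "is_perm s" "is_perm t"
  shows "is_perm (dsum s t)"
proof (rule is_permI_subset)
  show "distinct (dsum s t)"
    using assms by (auto simp: dsum_def is_perm_def distinct_map)
  show "set (dsum s t) \<subseteq> {1..length (dsum s t)}"
    using assms by (auto simp: dsum_def is_perm_def)
qed

lemma is_perm_dsumD:
  assumes "is_perm s" "is_perm (dsum s t)"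
  shows "is_perm t"
proof (rule is_permI_subset)
  show "distinct t"
    using assms by (auto simp: dsum_def is_perm_def distinct_map)
  show "set t \<subseteq> {1..length t}"
  proof
    fix x assume x: "x \<in> set t"
    have "x + length s \<in> (\<lambda>v. v + length s) ` set t"
      using x by blast
    then have "x + length s \<notin> set s" "x + length s \<in> set (dsum s t)"
      using assms(2) unfolding dsum_def is_perm_def distinct_append set_append set_map by blast+
    moreover have "set s = {1..length s}" "set (dsum s t) = {1..length s + length t}"
      using assms by (simp_all add: is_perm_def)
    ultimately have "x + length s \<notin> {1..length s}" "x + length s \<in> {1..length s + length t}"
      by blast+
    then show "x \<in> {1..length t}"
      by auto
  qed
qed

lemma is_perm_take_dsum:
  assumes s: "is_perm s" and k: "k \<le> length s" "is_perm (take k s)"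
  shows "\<exists>t. is_perm t \<and> s = dsum (take k s) t"
proof -
  define t where "t = map (\<lambda>x. x - k) (drop k s)"
  have "x > k" if "x \<in> set (drop k s)" for x
  proof -
    have "x \<in> set s" "x \<notin> set (take k s)"
      using that s set_drop_subset[of k s] set_take_disj_set_drop_if_distinct[of s k k]
      by (auto simp: is_perm_def)
    then show ?thesis
      using s k by (auto simp: is_perm_def)
  qed
  then have "map (\<lambda>v. v + k) t = drop k s"
    unfolding t_def map_map by (intro map_idI) fastforce
  then have "s = dsum (take k s) t"
    using k(1) by (simp add: dsum_def)
  then show ?thesis
    using is_perm_dsumD[OF k(2)] s by metis
qed

lemma rm_dsum_left:
  assumes "is_perm s" "is_perm t" "i < length s"
  shows "rm (dsum s t) i = dsum (rm s i) t"
proof -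
  have "1 \<le> x" if "x \<in> set t" for x
    using that assms by (auto simp: is_perm_def)
  moreover have "s ! i \<le> length s"
    using is_perm_nth_bounds assms by blast
  ultimately have "map (\<lambda>x. if x > s ! i then x - 1 else x) (map (\<lambda>v. v + length s) t)
      = map (\<lambda>v. v + (length s - 1)) t"
    using assms(3) by fastforce
  then show ?thesis
    using assms(3) by (simp add: rm_def dsum_def nth_append)
qed

lemma rm_dsum_right:
  assumes "is_perm s" "is_perm t" "i < length t"
  shows "rm (dsum s t) (length s + i) = dsum s (rm t i)"
proof -
  have "x \<le> length s" if "x \<in> set s" for x
    using that assms by (auto simp: is_perm_def)
  then have "map (\<lambda>x. if x > t ! i + length s then x - 1 else x) s = s"
    by (intro map_idI) fastforce
  then show ?thesis
    using assms(3) by (auto simp: rm_def dsum_def nth_append take_map drop_map)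
qed

lemma sumcl_is_perm:
  assumes "\<And>x. x \<in> D \<Longrightarrow> is_perm x" "s \<in> sumcl D"
  shows "is_perm s"
  using assms(2) by induction (auto intro: is_perm_dsum assms(1))

lemma sumcl_dsum: "s \<in> sumcl D \<Longrightarrow> t \<in> sumcl D \<Longrightarrow> dsum s t \<in> sumcl D"
  by (induction rule: sumcl.induct) (auto simp: dsum_assoc intro: sumcl.intros)

lemma sumcl_base: "x \<in> D \<Longrightarrow> x \<in> sumcl D"
  using sumcl.Cons[of x D "[]"] sumcl.Nil by auto

lemma sumcl_mono: "D \<subseteq> E \<Longrightarrow> sumcl D \<subseteq> sumcl E"
proof
  fix s assume "D \<subseteq> E" "s \<in> sumcl D"
  from this(2,1) show "s \<in> sumcl E"
    by induction (auto intro: sumcl.intros)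
qed

text \<open>A deletion touches only one summand, so only deletions from members of \<open>D\<close>
  have to be inspected; their results may be sums themselves.\<close>

lemma perm_class_sumcl:
  assumes P: "\<And>x. x \<in> D \<Longrightarrow> is_perm x"
    and R: "\<And>x i. x \<in> D \<Longrightarrow> i < length x \<Longrightarrow> rm x i \<in> sumcl D"
  shows "perm_class (sumcl D)"
proof (rule perm_classI_rm)
  fix s i assume "s \<in> sumcl D" "i < length s"
  then show "rm s i \<in> sumcl D"
  proof (induction arbitrary: i)
    case (Cons x t)
    note pt = P[OF Cons.hyps(1)] sumcl_is_perm[OF P Cons.hyps(2)]
    show ?case
    proof (cases "i < length x")
      case True
      then show ?thesis
        using Cons pt R by (simp add: rm_dsum_left sumcl_dsum)
    next
      case False
      then show ?thesis
        using Cons pt rm_dsum_right[OF pt, of "i - length x"]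
        by (auto intro: sumcl.Cons)
    qed
  qed simp
qed (use sumcl_is_perm[OF P] in auto)

text \<open>If one first summand were shorter, it would be a proper nonempty prefix of the other and
  a permutation, contrary to indecomposability. This uniqueness makes the counting recursion
  exact.\<close>

lemma indec_dsum_unique:
  assumes "indec x" "indec y" "dsum x t = dsum y u"
  shows "x = y \<and> t = u"
proof -
  have *: "length x \<ge> length y" if "indec x" "indec y" "dsum x t = dsum y u" for x y t u
  proof (rule ccontr)
    assume "\<not> ?thesis"
    then have l: "length x < length y" by simp
    have "take (length x) (dsum x t) = x" by (simp add: dsum_def)
    then have "take (length x) (dsum y u) = x"
      using that(3) by simp
    then have "take (length x) y = x"
      using l by (simp add: dsum_def)
    then show False
      using l that by (auto simp: indec_def)
  qed
  have "length x = length y"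
    using *[OF assms] *[OF assms(2,1) assms(3)[symmetric]] by simp
  then show ?thesis
    using assms(3) by (auto simp: dsum_def inj_map_eq_map inj_def)
qed

lemma perm_in_sumcl_indec:
  assumes "is_perm s"
  shows "s \<in> sumcl {x. indec x \<and> length x \<le> length s}"
  using assms
proof (induction "length s" arbitrary: s rule: less_induct)
  case less
  show ?case
  proof (cases "s = []")
    case False
    \<comment> \<open>The shortest nonempty prefix that is a permutation is the first indecomposable
      component.\<close>
    define k where "k = (LEAST k. 0 < k \<and> is_perm (take k s))"
    have ex: "0 < length s \<and> is_perm (take (length s) s)"
      using less False by simp
    have k: "0 < k" "is_perm (take k s)" "k \<le> length s"
      using LeastI[of "\<lambda>k. 0 < k \<and> is_perm (take k s)", OF ex]
        Least_le[of "\<lambda>k. 0 < k \<and> is_perm (take k s)", OF ex] by (auto simp: k_def)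
    have "indec (take k s)"
      using k False not_less_Least[of _ "\<lambda>k. 0 < k \<and> is_perm (take k s)", folded k_def]
      by (auto simp: indec_def)
    moreover obtain t where t: "is_perm t" "s = dsum (take k s) t"
      using is_perm_take_dsum less.prems k by blast
    have lt: "length s = k + length t"
      using arg_cong[OF t(2), of length] k by simp
    then have "t \<in> sumcl {x. indec x \<and> length x \<le> length t}"
      using less.hyps t k by simp
    then have "t \<in> sumcl {x. indec x \<and> length x \<le> length s}"
      using sumcl_mono[of "{x. indec x \<and> length x \<le> length t}" "{x. indec x \<and> length x \<le> length s}"] lt
      by fastforce
    ultimately show ?thesis
      using sumcl.Cons[of "take k s" "{x. indec x \<and> length x \<le> length s}" t] t(2) by auto
  qed (auto intro: sumcl.intros)
qed

subsection \<open>Growth rates\<close>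

definition cnt :: "nat list set \<Rightarrow> nat \<Rightarrow> real" where
  "cnt C n = real (card {s \<in> C. length s = n})"

text \<open>Exponential bounds for all \<open>n\<close>, with bases arbitrarily close to
  \<open>g\<close>, pass easily through binomial convolutions, unlike the limit of the roots;
  \<open>growth_bounds_root\<close> recovers the limit.\<close>

definition growth_bounds :: "(nat \<Rightarrow> real) \<Rightarrow> real \<Rightarrow> bool" where
  "growth_bounds f g \<longleftrightarrow>
     (\<forall>b. 0 < b \<and> b < g \<longrightarrow> (\<exists>K>0. \<forall>n. K * b ^ n \<le> f n)) \<and>
     (\<forall>b>g. \<exists>K>0. \<forall>n. f n \<le> K * b ^ n)"

lemma growth_bounds_root:
  assumes g: "0 < g" and f: "growth_bounds f g"
  shows "(\<lambda>n. root n (f n)) \<longlonglongrightarrow> g"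
proof -
  have lim: "(\<lambda>n. root n K * b) \<longlonglongrightarrow> b" if "K > 0" for K b :: real
    using tendsto_mult_right[OF LIMSEQ_root_const[OF that], of b] by simp
  have rt: "root n (K * b ^ n) = root n K * b" if "n > 0" "b > 0" for n and K b :: real
    using that by (simp add: real_root_mult real_root_power_cancel)
  show ?thesis
  proof (rule order_tendstoI)
    fix a assume "a < g"
    define b where "b = (max a 0 + g) / 2"
    have b: "0 < b" "b < g" "a < b"
      using g \<open>a < g\<close> by (auto simp: b_def)
    then obtain K where K: "K > 0" "\<And>n. K * b ^ n \<le> f n"
      using f by (auto simp: growth_bounds_def)
    have "eventually (\<lambda>n. root n K * b > a) sequentially"
      using order_tendstoD(1)[OF lim[OF K(1)] b(3)] .
    then show "eventually (\<lambda>n. a < root n (f n)) sequentially"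
      using eventually_gt_at_top[of 0]
    proof eventually_elim
      case (elim n)
      have "root n (K * b ^ n) \<le> root n (f n)"
        using elim K(2) by (intro real_root_le_mono) auto
      then show ?case
        using elim rt b by simp
    qed
  next
    fix a assume "g < a"
    define b where "b = (a + g) / 2"
    have b: "0 < b" "g < b" "b < a"
      using g \<open>g < a\<close> by (auto simp: b_def)
    then obtain K where K: "K > 0" "\<And>n. f n \<le> K * b ^ n"
      using f by (auto simp: growth_bounds_def)
    have "eventually (\<lambda>n. root n K * b < a) sequentially"
      using order_tendstoD(2)[OF lim[OF K(1)] b(3)] .
    then show "eventually (\<lambda>n. root n (f n) < a) sequentially"
      using eventually_gt_at_top[of 0]
    proof eventually_elim
      case (elim n)
      have "root n (f n) \<le> root n (K * b ^ n)"
        using elim K(2) by (intro real_root_le_mono) auto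
      then show ?case
        using elim rt b by simp
    qed
  qed
qed

text \<open>For positive \<open>n\<close>, \<open>u n\<close> is a combination of earlier values in
  the unit interval, with nonnegative weights of total at most one.\<close>

lemma renewal_bounded:
  fixes f u :: "nat \<Rightarrow> real"
  assumes f: "\<And>k. f k \<ge> 0" "f 0 = 0" "f sums 1"
    and u: "u 0 = 1" "\<And>n. n > 0 \<Longrightarrow> u n = (\<Sum>k\<le>n. f k * u (n - k))"
  shows "0 \<le> u n \<and> u n \<le> 1"
proof (induction n rule: less_induct)
  case (less n)
  show ?case
  proof (cases "n = 0")
    case False
    have *: "0 \<le> f k * u (n - k) \<and> f k * u (n - k) \<le> f k" if "k \<le> n" for k
      using less[of "n - k"] f False that
      by (cases "k = 0") (auto intro: mult_left_le)
    have "(\<Sum>k\<le>n. f k * u (n - k)) \<le> (\<Sum>k\<le>n. f k)"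
      using * by (intro sum_mono) auto
    also have "\<dots> \<le> suminf f"
      using f by (intro sum_le_suminf) (auto simp: sums_iff)
    finally have "u n \<le> 1"
      using f(3) u(2) False by (simp add: sums_iff)
    moreover have "u n \<ge> 0"
      using * u(2) False by (auto intro: sum_nonneg)
    ultimately show ?thesis by simp
  qed (simp add: u)
qed

text \<open>If \<open>U\<close> were the finite sum of \<open>u\<close>, the Cauchy product with
  \<open>f\<close>, whose sum is one, would turn the renewal equation into
  \<open>U - 1 = U\<close>.\<close>

lemma renewal_not_summable:
  fixes f u :: "nat \<Rightarrow> real"
  assumes f: "\<And>k. f k \<ge> 0" "f 0 = 0" "f sums 1"
    and u: "u 0 = 1" "\<And>n. n > 0 \<Longrightarrow> u n = (\<Sum>k\<le>n. f k * u (n - k))"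
  shows "\<not> summable u"
proof
  assume s: "summable u"
  have u0: "u n \<ge> 0" for n
    using renewal_bounded[of f u, OF f u] by simp
  have "(\<lambda>n. \<Sum>k\<le>n. f k * u (n - k)) sums (suminf f * suminf u)"
    using f u0 s by (intro Cauchy_product_sums) (auto simp: sums_iff)
  then have 1: "(\<lambda>n. \<Sum>k\<le>n. f k * u (n - k)) sums suminf u"
    using f by (simp add: sums_iff)
  have "(\<lambda>n. u n - (if n = 0 then 1 else 0)) sums (suminf u - 1)"
    using s sums_single[of 0 "\<lambda>_. 1"] by (intro sums_diff summable_sums) auto
  also have "(\<lambda>n. u n - (if n = 0 then 1 else 0)) = (\<lambda>n. \<Sum>k\<le>n. f k * u (n - k))"
  proof
    show "u n - (if n = 0 then 1 else 0) = (\<Sum>k\<le>n. f k * u (n - k))" for n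
      using u f by (cases "n = 0") simp_all
  qed
  finally show False
    using sums_unique2[OF 1, of "suminf u - 1"] by simp
qed

section \<open>Counting sum closures by length\<close>

lemma finite_perms: "finite {s \<in> C. P s \<and> length s = n}" if "\<And>s. s \<in> C \<Longrightarrow> is_perm s"
proof (rule finite_subset)
  show "{s \<in> C. P s \<and> length s = n} \<subseteq> {s. set s \<subseteq> {1..n} \<and> length s = n}"
    using that by (auto simp: is_perm_def)
qed (rule finite_lists_length_eq, simp)

lemma finite_perms_length: "finite {s \<in> C. length s = n}" if "\<And>s. s \<in> C \<Longrightarrow> is_perm s"
  using finite_perms[OF that, of C "\<lambda>_. True"] by simp

lemma cnt_sumcl_rec:
  assumes D: "\<And>x. x \<in> D \<Longrightarrow> indec x" and n: "n > 0"
  shows "cnt (sumcl D) n = (\<Sum>k\<le>n. cnt D k * cnt (sumcl D) (n - k))"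
proof -
  have DP: "is_perm x" if "x \<in> D" for x
    using D[OF that] by (simp add: indec_def)
  define A where "A = (\<lambda>k. {x \<in> D. length x = k})"
  define B where "B = (\<lambda>k. {t \<in> sumcl D. length t = k})"
  have fin: "finite (A k)" "finite (B k)" for k
    unfolding A_def B_def using finite_perms_length[of D, OF DP] finite_perms_length[of "sumcl D"]
      sumcl_is_perm[OF DP] by auto
  have "bij_betw (\<lambda>(x, t). dsum x t) (\<Union>k\<le>n. A k \<times> B (n - k)) (B n)"
    unfolding bij_betw_def
  proof
    show "inj_on (\<lambda>(x, t). dsum x t) (\<Union>k\<le>n. A k \<times> B (n - k))"
    proof (rule inj_onI)
      fix p q assume p: "p \<in> (\<Union>k\<le>n. A k \<times> B (n - k))" and q: "q \<in> (\<Union>k\<le>n. A k \<times> B (n - k))"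
        and eq: "(\<lambda>(x, t). dsum x t) p = (\<lambda>(x, t). dsum x t) q"
      have "indec (fst p)" "indec (fst q)"
        using p q D by (auto simp: A_def)
      then show "p = q"
        using indec_dsum_unique[of "fst p" "fst q" "snd p" "snd q"] eq
        by (simp add: case_prod_unfold prod_eq_iff)
    qed
    show "(\<lambda>(x, t). dsum x t) ` (\<Union>k\<le>n. A k \<times> B (n - k)) = B n"
    proof (intro equalityI subsetI)
      fix s assume "s \<in> B n"
      then have "s \<in> sumcl D" "length s = n" by (auto simp: B_def)
      from this(1) show "s \<in> (\<lambda>(x, t). dsum x t) ` (\<Union>k\<le>n. A k \<times> B (n - k))"
      proof cases
        case (Cons x t)
        then have "(x, t) \<in> A (length x) \<times> B (n - length x)" "length x \<le> n"
          using \<open>length s = n\<close> by (auto simp: A_def B_def)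
        then have "(x, t) \<in> (\<Union>k\<le>n. A k \<times> B (n - k))"
          by blast
        moreover have "s = (\<lambda>(x, t). dsum x t) (x, t)"
          using Cons by simp
        ultimately show ?thesis
          by (rule rev_image_eqI)
      next
        case Nil
        then show ?thesis using n \<open>length s = n\<close> by simp
      qed
    next
      fix s assume "s \<in> (\<lambda>(x, t). dsum x t) ` (\<Union>k\<le>n. A k \<times> B (n - k))"
      then obtain k x t where "k \<le> n" "x \<in> A k" "t \<in> B (n - k)" "s = dsum x t"
        by auto
      then show "s \<in> B n"
        by (simp add: A_def B_def sumcl.Cons)
    qed
  qed
  then have "card (B n) = card (\<Union>k\<le>n. A k \<times> B (n - k))"
    by (simp add: bij_betw_same_card)
  also have "\<dots> = (\<Sum>k\<le>n. card (A k \<times> B (n - k)))"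
    using fin by (intro card_UN_disjoint ballI impI finite_cartesian_product)
      (simp_all add: A_def disjoint_iff)
  finally have "card (B n) = (\<Sum>k\<le>n. card (A k) * card (B (n - k)))"
    by (simp only: card_cartesian_product)
  then show ?thesis
    by (simp only: cnt_def A_def B_def of_nat_sum of_nat_mult)
qed

lemma cnt_sumcl_0 [simp]: "(\<And>x. x \<in> D \<Longrightarrow> indec x) \<Longrightarrow> cnt (sumcl D) 0 = 1"
proof -
  have "{s \<in> sumcl D. length s = 0} = {[]}"
    by (auto intro: sumcl.intros)
  then show ?thesis by (simp add: cnt_def)
qed

lemma cnt_sumcl_mult:
  assumes D: "\<And>x. x \<in> D \<Longrightarrow> indec x"
  shows "cnt (sumcl D) m * cnt (sumcl D) n \<le> cnt (sumcl D) (m + n)"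
proof -
  define B where "B = (\<lambda>k. {t \<in> sumcl D. length t = k})"
  have "inj_on (\<lambda>(x, t). dsum x t) (B m \<times> B n)"
  proof (rule inj_onI, clarify)
    fix x t y v assume "x \<in> B m" "y \<in> B m" "dsum x t = dsum y v"
    then show "x = y \<and> t = v"
      by (simp add: B_def dsum_def inj_map_eq_map inj_def)
  qed
  moreover have "(\<lambda>(x, t). dsum x t) ` (B m \<times> B n) \<subseteq> B (m + n)"
    by (auto simp: B_def sumcl_dsum)
  moreover have "finite (B (m + n))"
    unfolding B_def by (rule finite_perms_length, rule sumcl_is_perm[of D]) (use D in \<open>auto simp: indec_def\<close>)
  ultimately have "card (B m \<times> B n) \<le> card (B (m + n))"
    by (rule card_inj_on_le)
  then have "real (card (B m) * card (B n)) \<le> real (card (B (m + n)))"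
    by (simp only: card_cartesian_product of_nat_le_iff)
  then show ?thesis
    by (simp only: cnt_def B_def of_nat_mult)
qed

lemma cnt_sums_of_has_sum:
  assumes D: "\<And>x. x \<in> D \<Longrightarrow> is_perm x"
    and S: "((\<lambda>x. z ^ length x) has_sum (w::real)) D"
  shows "(\<lambda>k. cnt D k * z ^ k) sums w"
proof -
  define A where "A = (\<lambda>k. {x \<in> D. length x = k})"
  have "bij_betw snd (Sigma UNIV A) D"
    by (rule bij_betwI[where g = "\<lambda>x. (length x, x)"]) (auto simp: A_def)
  then have S': "((\<lambda>p. z ^ length (snd p)) has_sum w) (Sigma UNIV A)"
    using S has_sum_reindex_bij_betw[of snd "Sigma UNIV A" D "\<lambda>x. z ^ length x" w] by simp
  have "((\<lambda>k. cnt D k * z ^ k) has_sum w) UNIV"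
  proof (rule has_sum_Sigma'[OF S'])
    fix k :: nat
    have "finite (A k)"
      unfolding A_def using finite_perms_length D by blast
    then have "((\<lambda>y. z ^ length y) has_sum (\<Sum>y\<in>A k. z ^ length y)) (A k)"
      by (rule has_sum_finite)
    also have "(\<Sum>y\<in>A k. z ^ length y) = (\<Sum>y\<in>A k. z ^ k)"
      by (rule sum.cong) (auto simp: A_def)
    also have "\<dots> = cnt D k * z ^ k"
      by (simp add: cnt_def A_def)
    finally show "((\<lambda>y. z ^ length (snd (k, y))) has_sum cnt D k * z ^ k) (A k)"
      by simp
  qed
  then show ?thesis
    by (rule has_sum_imp_sums)
qed

text \<open>Scaling the counts by \<open>z ^ n\<close> turns the component recursion into a renewal
  equation. Boundedness of the solution gives the upper bound; divergence of its sum, amplified by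
  supermultiplicativity of the counts, gives the lower one.\<close>

lemma growth_bounds_sumcl:
  fixes z :: real
  assumes D: "\<And>x. x \<in> D \<Longrightarrow> indec x" and D1: "[1] \<in> D" and z: "0 < z"
    and S: "((\<lambda>x. z ^ length x) has_sum 1) D"
  shows "growth_bounds (cnt (sumcl D)) (1 / z)"
proof -
  define c where "c = cnt (sumcl D)"
  define u where "u = (\<lambda>n. c n * z ^ n)"
  define f where "f = (\<lambda>k. cnt D k * z ^ k)"
  have c1: "c (Suc 0) \<ge> 1"
  proof -
    have "[1] \<in> {s \<in> sumcl D. length s = Suc 0}"
      using sumcl_base[OF D1] by simp
    moreover have "finite {s \<in> sumcl D. length s = Suc 0}"
      by (rule finite_perms_length, rule sumcl_is_perm[of D]) (use D in \<open>auto simp: indec_def\<close>)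
    ultimately have "card {s \<in> sumcl D. length s = Suc 0} \<ge> 1"
      by (metis One_nat_def Suc_leI card_gt_0_iff empty_iff)
    then show ?thesis by (simp add: c_def cnt_def)
  qed
  have f: "f k \<ge> 0" "f 0 = 0" "f sums 1" for k
  proof -
    have "{x \<in> D. x = []} = {}" using D by (auto simp: indec_def)
    then show "f 0 = 0" by (simp add: f_def cnt_def)
    show "f sums 1"
      unfolding f_def using D S by (intro cnt_sums_of_has_sum) (auto simp: indec_def)
    show "f k \<ge> 0" using z by (simp add: f_def cnt_def)
  qed
  have u': "u 0 = 1"
    using D by (simp add: u_def c_def)
  have u: "u n = (\<Sum>k\<le>n. f k * u (n - k))" if "n > 0" for n
  proof -
    have "u n = (\<Sum>k\<le>n. cnt D k * c (n - k) * z ^ n)"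
      using cnt_sumcl_rec[OF D that] by (simp add: u_def c_def sum_distrib_right)
    also have "\<dots> = (\<Sum>k\<le>n. f k * u (n - k))"
    proof (intro sum.cong refl)
      fix k assume "k \<in> {..n}"
      then have "z ^ n = z ^ k * z ^ (n - k)"
        by (simp add: power_add[symmetric])
      then show "cnt D k * c (n - k) * z ^ n = f k * u (n - k)"
        by (simp add: f_def u_def)
    qed
    finally show "u n = (\<Sum>k\<le>n. f k * u (n - k))" .
  qed
  have ub: "u n \<le> 1" for n
    using renewal_bounded[of f u, OF f u' u] by blast
  have ns: "\<not> summable u"
    using renewal_not_summable[of f u, OF f u' u] by blast
  have mult: "c m * c n \<le> c (m + n)" for m n
    unfolding c_def by (rule cnt_sumcl_mult[OF D])
  have c0: "c n \<ge> 0" for n by (simp add: c_def cnt_def)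
  \<comment> \<open>Summands \<open>[1]\<close> provide members of every length. This later absorbs
    the remainder of \<open>n\<close> modulo \<open>m\<close>.\<close>
  have cge1: "c n \<ge> 1" for n
  proof (induction n)
    case (Suc n)
    have "1 * 1 \<le> c n * c (Suc 0)" using Suc c1 by (intro mult_mono) auto
    then show ?case using mult[of n "Suc 0"] by simp
  qed (use D in \<open>simp add: c_def\<close>)
  have pow: "c m ^ q \<le> c (q * m)" for m q
  proof (induction q)
    case (Suc q)
    have "c m ^ Suc q \<le> c m * c (q * m)"
      using Suc c0 by (simp add: mult_left_mono)
    then show ?case using mult[of m "q * m"] by simp
  qed (use cge1[of 0] in auto)
  have lower: "\<exists>K>0. \<forall>n. K * b ^ n \<le> c n" if b: "0 < b" "b < 1 / z" for b
  proof -
    \<comment> \<open>Otherwise \<open>u\<close> would be dominated by a geometric series of ratio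
      \<open>b * z < 1\<close>.\<close>
    have "\<exists>m>0. b ^ m \<le> c m"
    proof (rule ccontr)
      assume "\<not> ?thesis"
      then have *: "c m < b ^ m" if "m > 0" for m using that by (meson not_le)
      have "u m \<le> (b * z) ^ m" for m
        using *[of m] z u' by (cases "m = 0") (auto simp: u_def power_mult_distrib)
      moreover have "summable (\<lambda>m. (b * z) ^ m)"
        using b z by (intro summable_geometric) (simp add: field_simps)
      ultimately have "summable u"
        using c0 z by (intro summable_comparison_test'[of "\<lambda>m. (b * z) ^ m" 0 u])
          (auto simp: u_def)
      then show False using ns by simp
    qed
    then obtain m where m: "m > 0" "b ^ m \<le> c m" by blast
    \<comment> \<open>\<open>M ^ m\<close> bounds \<open>b ^ r\<close> for every remainder
      \<open>r < m\<close>, whether or not \<open>b\<close> exceeds one.\<close>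
    define M where "M = max 1 b"
    have M: "M \<ge> 1" "b \<le> M" by (auto simp: M_def)
    have "b ^ n \<le> M ^ m * c n" for n
    proof -
      define q r where "q = n div m" and "r = n mod m"
      have n: "n = q * m + r" "r < m" using m(1) by (auto simp: q_def r_def)
      have "b ^ n = (b ^ m) ^ q * b ^ r"
        unfolding power_mult[symmetric] power_add[symmetric] mult.commute[of m q] n(1)[symmetric] ..
      also have "\<dots> \<le> c m ^ q * M ^ r"
        using m b M c0 by (intro mult_mono power_mono) auto
      also have "\<dots> \<le> c (q * m) * M ^ m"
        using pow M n c0 by (intro mult_mono power_increasing) auto
      also have "\<dots> \<le> c n * M ^ m"
      proof (intro mult_right_mono)
        have "c (q * m) * 1 \<le> c (q * m) * c r"
          using cge1 c0 by (intro mult_left_mono) auto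
        then show "c (q * m) \<le> c n"
          using mult[of "q * m" r, folded n(1)] by linarith
      qed (use M in auto)
      finally show ?thesis by (simp add: mult.commute)
    qed
    then have "\<forall>n. 1 / M ^ m * b ^ n \<le> c n"
      using M by (simp add: field_simps)
    then show ?thesis
      using M by (intro exI[of _ "1 / M ^ m"]) auto
  qed
  have upper: "\<exists>K>0. \<forall>n. c n \<le> K * b ^ n" if b: "1 / z < b" for b
  proof (intro exI[of _ 1] conjI allI)
    fix n
    have "c n \<le> (1 / z) ^ n"
      using ub[of n] z by (simp add: u_def field_simps)
    also have "\<dots> \<le> b ^ n"
      using b z by (intro power_mono) auto
    finally show "c n \<le> 1 * b ^ n" by simp
  qed simp
  show ?thesis
    using lower upper unfolding growth_bounds_def c_def by blast
qed

subsection \<open>Permutations encoded by words\<close>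

definition run :: "nat \<Rightarrow> nat \<Rightarrow> nat list" where
  "run a k = [a..<a + k]"

lemma length_run [simp]: "length (run a k) = k"
  by (simp add: run_def)

lemma set_run [simp]: "set (run a k) = {a..<a + k}"
  by (simp add: run_def)

lemma distinct_run [simp]: "distinct (run a k)"
  by (simp add: run_def)

lemma run_0 [simp]: "run a 0 = []"
  by (simp add: run_def)

lemma run_Suc: "run a (Suc k) = a # run (Suc a) k"
  by (simp add: run_def upt_rec[of a])

lemma run_add: "run a (j + k) = run a j @ run (a + j) k"
  using upt_add_eq_append[of a "a + j" k] by (simp add: run_def add.assoc)

lemma map_add_run: "map (\<lambda>v. v + c) (run a k) = run (a + c) k"
  by (induction k arbitrary: a) (simp_all add: run_Suc)

lemma map_dec_run: "c < a \<Longrightarrow> map (\<lambda>x. if c < x then x - 1 else x) (run a k) = run (a - 1) k"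
  by (induction k arbitrary: a) (simp_all add: run_Suc)

lemma map_dec_id: "\<forall>x\<in>set s. x \<le> (c::nat) \<Longrightarrow> map (\<lambda>x. if c < x then x - 1 else x) s = s"
  by (rule map_idI) auto

text \<open>The permutation of a word has a tree as its inversion graph.  The letters count the pendant vertices of the
  centres, and neighbouring centres are joined through one further vertex.  In \<open>ext s k\<close> the last entry is the
  new centre, the run consists of its pendants, and the entry \<open>length s + 2\<close> joins it to the last entry of \<open>s\<close>,
  which is the previous centre; thus words grow at the head.\<close>

definition stem :: "nat \<Rightarrow> nat list" where
  "stem k = run 2 k @ [1]"

definition ext :: "nat list \<Rightarrow> nat \<Rightarrow> nat list" where
  "ext s k = butlast s @ [length s + 2, last s] @ run (length s + 3) k @ [length s + 1]"

fun wp :: "nat list \<Rightarrow> nat list" where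
  "wp [] = []"
| "wp [k] = stem k"
| "wp (k # j # u) = ext (wp (j # u)) k"

text \<open>A letter stands for a centre together with its pendants, and each two neighbouring
  centres share one joining entry, hence \<open>2 * length w - 1\<close>.\<close>

definition wsize :: "nat list \<Rightarrow> nat" where
  "wsize w = sum_list w + 2 * length w - 1"

lemma length_stem [simp]: "length (stem k) = k + 1"
  by (simp add: stem_def)

lemma length_ext [simp]: "s \<noteq> [] \<Longrightarrow> length (ext s k) = length s + k + 2"
  by (cases s rule: rev_cases) (auto simp: ext_def)

lemma wp_eq_Nil_iff [simp]: "wp w = [] \<longleftrightarrow> w = []"
  by (cases w rule: wp.cases) (auto simp: stem_def ext_def)

lemma wp_Cons: "u \<noteq> [] \<Longrightarrow> wp (k # u) = ext (wp u) k"
  by (cases u) auto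

lemma length_wp: "length (wp w) = wsize w"
proof (induction w rule: wp.induct)
  case (3 k j u)
  then show ?case by (simp add: wsize_def)
qed (auto simp: wsize_def)

lemma is_perm_stem: "is_perm (stem k)"
proof (rule is_permI_subset)
  show "distinct (stem k)" by (simp add: stem_def)
  show "set (stem k) \<subseteq> {1..length (stem k)}" by (auto simp: stem_def)
qed

lemma is_perm_ext:
  assumes "is_perm s" "s \<noteq> []"
  shows "is_perm (ext s k)"
proof -
  obtain r x where s: "s = r @ [x]"
    using assms(2) by (cases s rule: rev_cases) auto
  define n where "n = length s"
  have d: "distinct (r @ [x])" "set (r @ [x]) = {1..n}"
    using assms(1) s by (auto simp: is_perm_def n_def)
  have ub: "\<And>y. y \<in> set (r @ [x]) \<Longrightarrow> 1 \<le> y \<and> y \<le> n"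
    unfolding d by simp
  have e: "ext s k = r @ [n + 2, x] @ run (n + 3) k @ [n + 1]"
    using s by (simp add: ext_def n_def)
  show ?thesis
  proof (rule is_permI_subset)
    show "distinct (ext s k)"
      using d(1) ub unfolding e by fastforce
    have "length (ext s k) = n + k + 2"
      using assms(2) by (simp add: n_def)
    then show "set (ext s k) \<subseteq> {1..length (ext s k)}"
      using ub unfolding e by fastforce
  qed
qed

text \<open>A proper prefix of length at least \<open>last s\<close> that is a permutation would
  contain the value \<open>last s\<close>, which occurs only at the end; so just the shorter
  prefixes need a check.\<close>

lemma indecI_last:
  assumes "is_perm s" "s \<noteq> []" "\<And>m. 0 < m \<Longrightarrow> m < length s \<Longrightarrow> m < last s \<Longrightarrow> \<not> is_perm (take m s)"
  shows "indec s"
proof -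
  have "m < last s" if m: "0 < m" "m < length s" "is_perm (take m s)" for m
  proof (rule ccontr)
    assume "\<not> m < last s"
    moreover have "last s \<ge> 1"
      using is_perm_nth_bounds[OF assms(1), of "length s - 1"] assms(2) by (simp add: last_conv_nth)
    ultimately have "last s \<in> set (take m s)"
      using m by (simp add: is_perm_def)
    moreover have "last s \<in> set (drop m s)"
      using m last_in_set[of "drop m s"] by simp
    ultimately show False
      using set_take_disj_set_drop_if_distinct[of s m m] assms(1) by (auto simp: is_perm_def)
  qed
  then show ?thesis
    using assms by (auto simp: indec_def)
qed

lemma indec_stem: "indec (stem k)"
  by (rule indecI_last) (auto simp: is_perm_stem, simp_all add: stem_def)

lemma indec_ext:
  assumes s: "indec s"
  shows "indec (ext s k)"
proof (rule indecI_last)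
  have ne: "s \<noteq> []" and p: "is_perm s"
    using s by (auto simp: indec_def)
  show "is_perm (ext s k)" "ext s k \<noteq> []"
    using is_perm_ext[OF p ne] by (simp_all add: ext_def)
  fix m assume m: "0 < m" "m < last (ext s k)"
  then have "m \<le> length s" by (simp add: ext_def)
  show "\<not> is_perm (take m (ext s k))"
  proof (cases "m < length s")
    case True
    then have "take m (ext s k) = take m s"
      by (simp add: ext_def take_butlast)
    then show ?thesis
      using s m True by (simp add: indec_def)
  next
    case False
    then have "m = length s" using \<open>m \<le> length s\<close> by simp
    then have "take m (ext s k) = butlast s @ [m + 2]"
      using ne by (cases s rule: rev_cases) (simp_all add: ext_def)
    then have "m + 2 \<in> set (take m (ext s k))" by simp
    then show ?thesis
      using \<open>m = length s\<close> by (auto simp: is_perm_def)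
  qed
qed

lemma indec_wp: "w \<noteq> [] \<Longrightarrow> indec (wp w)"
  by (induction w rule: wp.induct) (auto intro: indec_stem indec_ext)

lemma is_perm_wp: "is_perm (wp w)"
  using indec_wp[of w] by (cases "w = []") (auto simp: indec_def)

text \<open>A left inverse of \<open>wp\<close> on nonempty words: in \<open>ext s k\<close> the
  entries below the last one are exactly those of \<open>s\<close>, and \<open>k + 1\<close> entries
  lie above it. Besides injectivity it yields an executable test for not being of the form
  \<open>wp w\<close>.\<close>

function decode :: "nat list \<Rightarrow> nat list" where
  "decode s = (if s = [] then [] else if last s \<le> 1 then [length s - 1]
     else (length s - last s - 1) # decode (filter (\<lambda>x. x < last s) s))"
  by auto
termination
proof (relation "Wellfounded.measure length")
  fix s :: "nat list" assume "s \<noteq> []"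
  then show "(filter (\<lambda>x. x < last s) s, s) \<in> Wellfounded.measure length"
    using length_filter_less[of "last s" s "\<lambda>x. x < last s"] by simp
qed simp

declare decode.simps [simp del]

lemma decode_wp: "w \<noteq> [] \<Longrightarrow> decode (wp w) = w"
proof (induction w rule: wp.induct)
  case (2 k)
  then show ?case by (subst decode.simps) (simp add: stem_def)
next
  case (3 k j u)
  define s where "s = wp (j # u)"
  have s: "is_perm s" "s \<noteq> []"
    by (simp_all add: s_def is_perm_wp)
  then obtain r x where rx: "s = r @ [x]"
    by (cases s rule: rev_cases) auto
  have "\<forall>y\<in>set (r @ [x]). y \<le> length s"
    using s rx by (auto simp: is_perm_def)
  then have "filter (\<lambda>y. y < length s + 1) (ext s k) = s"
    unfolding ext_def rx by (auto simp: filter_empty_conv filter_id_conv)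
  moreover have "last (ext s k) = length s + 1" "ext s k \<noteq> []"
    by (simp_all add: ext_def)
  ultimately have "decode (ext s k) = k # decode s"
    using s(2) by (subst decode.simps) simp
  then show ?case
    using 3 by (simp add: s_def)
qed simp

lemma inj_on_wp: "inj_on wp {w. w \<noteq> []}"
  by (rule inj_on_inverseI[of _ decode]) (simp add: decode_wp)

text \<open>The clauses describe single deletions. A lost pendant lowers a letter. A lost end centre
  leaves its joining entry behind as a further pendant of the neighbouring centre, whence
  \<open>Suc\<close>; its own pendants split off as trivial summands.\<close>

definition word_closed :: "nat list set \<Rightarrow> bool" where
  "word_closed W \<longleftrightarrow> [0] \<in> W \<and> [] \<notin> W \<and>
     (\<forall>v c u. v @ Suc c # u \<in> W \<longrightarrow> v @ c # u \<in> W) \<and>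
     (\<forall>v x c. v @ [x, c] \<in> W \<longrightarrow> v @ [Suc x] \<in> W) \<and>
     (\<forall>c y u. c # y # u \<in> W \<longrightarrow> Suc y # u \<in> W)"

lemma word_closed_dec: "word_closed W \<Longrightarrow> v @ Suc c # u \<in> W \<Longrightarrow> v @ c # u \<in> W"
  by (auto simp: word_closed_def)

text \<open>The last centre is removed repeatedly. Each removal raises the letter before it, and
  this is undone until \<open>x\<close> is reached, where the raised letter is kept.\<close>

lemma word_closed_prefix:
  assumes "word_closed W" "u \<noteq> []" "v @ x # u \<in> W"
  shows "v @ [Suc x] \<in> W"
  using assms(2,3)
proof (induction u arbitrary: v x rule: rev_induct)
  case (snoc c u)
  show ?case
  proof (cases u rule: rev_cases)
    case Nil
    then have "v @ [x, c] \<in> W" using snoc.prems by simp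
    then show ?thesis using assms(1) unfolding word_closed_def by blast
  next
    case (snoc u' y)
    then have "(v @ x # u') @ [y, c] \<in> W" using snoc.prems by simp
    then have "(v @ x # u') @ [Suc y] \<in> W"
      using assms(1) unfolding word_closed_def by blast
    then have "v @ x # u \<in> W"
      using word_closed_dec[OF assms(1), of "v @ x # u'" y "[]"] snoc by simp
    then show ?thesis using snoc.IH snoc by simp
  qed
qed simp

lemma word_closed_prefix':
  assumes "word_closed W" "u \<noteq> []" "v @ x # u \<in> W"
  shows "v @ [x] \<in> W"
  using word_closed_prefix[OF assms] word_closed_dec[OF assms(1), of v x "[]"] by simp

lemma word_closed_suffix:
  assumes "word_closed W" "v @ y # u \<in> W"
  shows "y # u \<in> W"
  using assms(2)
proof (induction v)
  case (Cons c v)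
  have "v @ y # u \<in> W"
  proof (cases v)
    case Nil
    then have "Suc y # u \<in> W"
      using Cons.prems assms(1) unfolding word_closed_def by auto
    then show ?thesis
      using word_closed_dec[OF assms(1), of "[]" y u] Nil by simp
  next
    case (Cons x v')
    then have "Suc x # v' @ y # u \<in> W"
      using Cons.prems assms(1) unfolding word_closed_def by auto
    then show ?thesis
      using word_closed_dec[OF assms(1), of "[]" x "v' @ y # u"] Cons by simp
  qed
  then show ?case by (rule Cons.IH)
qed simp

lemma run_in_sumcl: "[1] \<in> D \<Longrightarrow> run 1 k \<in> sumcl D"
proof (induction k)
  case (Suc k)
  have "dsum (run 1 k) [1] = run 1 (Suc k)"
    using run_add[of 1 k 1] by (simp add: dsum_def run_Suc)
  then show ?case
    using sumcl_dsum[OF Suc.IH[OF Suc.prems] sumcl_base[OF Suc.prems]] by metis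
qed (simp add: sumcl.Nil)

text \<open>One more pendant of the head centre is a new maximum directly before the last entry,
  which is the form in which \<open>rm_ext_last\<close> produces it.\<close>

lemma wp_Suc: "wp (Suc j # u) = butlast (wp (j # u)) @ [length (wp (j # u)) + 1, last (wp (j # u))]"
proof (cases u)
  case Nil
  then show ?thesis using run_add[of 2 j 1] by (simp add: stem_def run_Suc)
next
  case (Cons i v)
  then have "wp (i # v) \<noteq> []" by simp
  then show ?thesis
    using Cons run_add[of "length (wp (i # v)) + 3" j 1] by (simp add: ext_def butlast_append run_Suc)
qed

text \<open>Without the head centre its \<open>k\<close> pendants have no inversions left, and the
  joining entry becomes a pendant of the previous centre.\<close>

lemma rm_ext_last:
  assumes s: "is_perm s" "s \<noteq> []"
  shows "rm (ext s k) (length (ext s k) - 1) = dsum (butlast s @ [length s + 1, last s]) (run 1 k)"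
proof -
  obtain r x where rx: "s = r @ [x]"
    using s(2) by (cases s rule: rev_cases) auto
  define n where "n = length s"
  have ub: "y \<le> n" if "y \<in> set (r @ [x])" for y
    using s that rx by (auto simp: is_perm_def n_def)
  have e: "ext s k = (r @ [n + 2, x] @ run (n + 3) k) @ [n + 1]"
    by (simp add: ext_def n_def rx)
  have r: "map (\<lambda>y. if n + 1 < y then y - 1 else y) r = r"
    using ub by (intro map_dec_id) fastforce
  have "x \<le> n" using ub by simp
  have "rm (ext s k) (length (ext s k) - 1)
      = map (\<lambda>y. if n + 1 < y then y - 1 else y) (r @ [n + 2, x] @ run (n + 3) k)"
    unfolding rm_def e by (simp add: nth_append)
  also have "\<dots> = r @ [n + 1, x] @ run (n + 2) k"
    using r \<open>x \<le> n\<close> map_dec_run[of "n + 1" "n + 3" k] by simp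
  also have "\<dots> = dsum (butlast s @ [length s + 1, last s]) (run 1 k)"
    using map_add_run[of "length r + 2" 1 k] by (simp add: dsum_def rx n_def)
  finally show ?thesis .
qed

lemma rm_wp_last:
  assumes W: "word_closed W" and u: "u \<in> W"
  shows "rm (wp u) (length (wp u) - 1) \<in> sumcl (wp ` W)"
proof -
  have one: "[1] \<in> wp ` W"
    using W by (auto simp: word_closed_def stem_def intro!: image_eqI[of _ _ "[0]"])
  consider "u = []" | k where "u = [k]" | k j v where "u = k # j # v"
    by (cases u rule: wp.cases) auto
  then show ?thesis
  proof cases
    case 1
    then show ?thesis using u W by (simp add: word_closed_def)
  next
    case (2 k)
    have "rm (stem k) k = run 1 k"
      using map_dec_run[of 1 2 k] by (simp add: rm_def stem_def nth_append)
    then show ?thesis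
      using 2 run_in_sumcl[OF one] by simp
  next
    case (3 k j v)
    then have "Suc j # v \<in> W"
      using u W unfolding word_closed_def by auto
    then have "wp (Suc j # v) \<in> sumcl (wp ` W)"
      by (intro sumcl_base imageI)
    then have "dsum (wp (Suc j # v)) (run 1 k) \<in> sumcl (wp ` W)"
      using run_in_sumcl[OF one] sumcl_dsum by blast
    then show ?thesis
      using 3 rm_ext_last[of "wp (j # v)" k] is_perm_wp[of "j # v"] by (simp add: wp_Suc)
  qed
qed

lemma rm_append_left: "i < length s \<Longrightarrow> rm (s @ t) i = rm s i @ map (\<lambda>x. if s ! i < x then x - 1 else x) t"
  by (simp add: rm_def nth_append)

lemma rm_append_right: "rm (s @ t) (length s + i) = map (\<lambda>x. if t ! i < x then x - 1 else x) s @ rm t i"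
  by (simp add: rm_def nth_append)

lemma rm_ext_inner:
  assumes s: "is_perm s" and i: "i < length s - 1"
  shows "rm (ext s k) i = ext (rm s i) k"
proof -
  obtain r x where rx: "s = r @ [x]"
    using i by (cases s rule: rev_cases) auto
  have ir: "i < length r" using i rx by simp
  have v: "r ! i \<le> length s"
    using is_perm_nth_bounds[OF s, of i] ir by (simp add: rx nth_append)
  let ?f = "\<lambda>x. if r ! i < x then x - 1 else x"
  have rs: "rm s i = rm r i @ [?f x]"
    using ir by (simp add: rx rm_append_left)
  have l: "length (rm s i) = length r"
    using ir by (simp add: rs)
  have ls: "length s = length r + 1" by (simp add: rx)
  have "rm (ext s k) i = rm (r @ ([length s + 2, x] @ run (length s + 3) k @ [length s + 1])) i"
    by (simp add: ext_def rx)
  also have "\<dots> = rm r i @ map ?f ([length s + 2, x] @ run (length s + 3) k @ [length s + 1])"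
    using ir by (rule rm_append_left)
  also have "\<dots> = rm r i @ [length s + 1, ?f x] @ run (length s + 2) k @ [length s]"
    using v map_dec_run[of "r ! i" "length s + 3" k] by (simp add: numeral_eq_Suc)
  also have "\<dots> = ext (rm s i) k"
    unfolding ext_def l unfolding rs by (simp add: ls numeral_eq_Suc)
  finally show ?thesis .
qed

text \<open>The joining entry is a cut vertex of the tree: without it the two sides become direct
  summands.\<close>

lemma rm_ext_link:
  assumes s: "is_perm s" "s \<noteq> []"
  shows "rm (ext s k) (length s - 1) = dsum s (stem k)"
proof -
  obtain r x where rx: "s = r @ [x]"
    using s by (cases s rule: rev_cases) auto
  have ub: "\<forall>y\<in>set (r @ [x]). y \<le> length s"
    using s by (auto simp: is_perm_def rx)
  let ?f = "\<lambda>y. if length s + 2 < y then y - 1 else y"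
  have r: "map ?f r = r" using ub by (intro map_dec_id) fastforce
  have "rm (ext s k) (length s - 1)
      = rm (r @ ([length s + 2, x] @ run (length s + 3) k @ [length s + 1])) (length r + 0)"
    by (simp add: ext_def rx)
  also have "\<dots> = map ?f r @ rm ([length s + 2, x] @ run (length s + 3) k @ [length s + 1]) 0"
    by (simp only: rm_append_right) simp
  also have "\<dots> = r @ [x] @ run (length s + 2) k @ [length s + 1]"
    using r ub map_dec_run[of "length s + 2" "length s + 3" k] by (simp add: rm_def)
  also have "\<dots> = dsum s (stem k)"
    using map_add_run[of "length s" 2 k] by (simp add: dsum_def stem_def rx add.commute)
  finally show ?thesis .
qed

text \<open>The deleted entry is the previous centre. The joining entry loses its left neighbour and
  becomes a pendant of the head centre, hence \<open>Suc k\<close>; the rest is \<open>s\<close>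
  without its centre.\<close>

lemma rm_ext_center:
  assumes s: "is_perm s" "s \<noteq> []"
  shows "rm (ext s k) (length s) = dsum (rm s (length s - 1)) (stem (Suc k))"
proof -
  obtain r x where rx: "s = r @ [x]"
    using s by (cases s rule: rev_cases) auto
  have x: "x \<le> length s" "1 \<le> x"
    using s by (auto simp: is_perm_def rx)
  let ?f = "\<lambda>y. if x < y then y - 1 else y"
  have "rm (ext s k) (length s)
      = rm (r @ ([length s + 2, x] @ run (length s + 3) k @ [length s + 1])) (length r + 1)"
    by (simp add: ext_def rx)
  also have "\<dots> = map ?f r @ rm ([length s + 2, x] @ run (length s + 3) k @ [length s + 1]) 1"
    by (simp only: rm_append_right) simp
  also have "\<dots> = map ?f r @ [length s + 1] @ run (length s + 2) k @ [length s]"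
    using x map_dec_run[of x "length s + 3" k] by (simp add: rm_def)
  also have "map ?f r = rm s (length s - 1)"
    by (simp add: rm_def rx)
  also have "rm s (length s - 1) @ [length s + 1] @ run (length s + 2) k @ [length s]
      = dsum (rm s (length s - 1)) (stem (Suc k))"
    using map_add_run[of "length s - 1" 2 "Suc k"] by (simp add: dsum_def stem_def rx add.commute run_Suc)
  finally show ?thesis .
qed

lemma rm_run: "i < k \<Longrightarrow> rm (run a k @ t) i = run a (k - 1) @ map (\<lambda>x. if a + i < x then x - 1 else x) t"
proof -
  assume i: "i < k"
  then obtain j where k: "k = i + Suc j" by (metis add_Suc_right less_iff_Suc_add)
  have "run a k = run a i @ (a + i) # run (a + i + 1) j"
    unfolding k run_add run_Suc by simp
  moreover have "map (\<lambda>x. if a + i < x then x - 1 else x) (run a i) = run a i"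
    by (intro map_dec_id) simp
  moreover have "run a i @ run (a + i) j = run a (k - 1)"
    by (simp add: k run_add)
  ultimately show ?thesis
    using map_dec_run[of "a + i" "a + i + 1" j] by (simp add: rm_def nth_append)
qed

lemma rm_ext_pendant:
  assumes s: "is_perm s" "s \<noteq> []" and i: "i < k"
  shows "rm (ext s k) (length s + 1 + i) = ext s (k - 1)"
proof -
  have ub: "\<forall>y\<in>set s. y \<le> length s"
    using s by (auto simp: is_perm_def)
  let ?p = "butlast s @ [length s + 2, last s]"
  let ?f = "\<lambda>y. if length s + 3 + i < y then y - 1 else y"
  have "length ?p = length s + 1"
    using s by simp
  then have "rm (ext s k) (length s + 1 + i) = rm (?p @ run (length s + 3) k @ [length s + 1]) (length ?p + i)"
    by (simp add: ext_def)
  also have "\<dots> = map ?f ?p @ rm (run (length s + 3) k @ [length s + 1]) i"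
    using i by (simp only: rm_append_right) (simp add: nth_append run_def)
  also have "map ?f ?p = ?p"
  proof (rule map_dec_id, rule ballI)
    fix y assume "y \<in> set ?p"
    then have "y \<in> set s \<or> y = length s + 2"
      using s by (auto dest: in_set_butlastD)
    then show "y \<le> length s + 3 + i" using ub by auto
  qed
  also have "rm (run (length s + 3) k @ [length s + 1]) i = run (length s + 3) (k - 1) @ [length s + 1]"
    using i by (simp add: rm_run)
  finally show ?thesis by (simp add: ext_def)
qed

lemma rm_stem: "i < k \<Longrightarrow> rm (stem k) i = stem (k - 1)"
  by (simp add: stem_def rm_run)

lemma ext_dsum:
  assumes "s \<noteq> []"
  shows "ext (dsum t s) k = dsum t (ext s k)"
  using assms map_add_run[of "length t" "length s + 3" k]
  by (cases s rule: rev_cases) (auto simp: ext_def dsum_def add_ac butlast_append)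

text \<open>Deleting an entry that is not the last one splits the word into a part that is summed off and
  a word that can still be extended to the left of the deleted entry.\<close>

lemma rm_wp_not_last:
  assumes "u \<noteq> []" "i < length (wp u) - 1"
  shows "\<exists>t u'. u' \<noteq> [] \<and> rm (wp u) i = dsum t (wp u') \<and>
    (\<forall>W v. word_closed W \<and> v @ u \<in> W \<longrightarrow> t \<in> sumcl (wp ` W) \<and> v @ u' \<in> W)"
  using assms
proof (induction u arbitrary: i rule: wp.induct)
  case (2 k)
  then have "rm (wp [k]) i = dsum [] (wp [k - 1])"
    by (simp add: rm_stem)
  moreover have "v @ [k - 1] \<in> W" if "word_closed W" "v @ [k] \<in> W" for W v
    using word_closed_dec[OF that(1), of v "k - 1" "[]"] that(2) 2 by simp
  ultimately show ?case
    using sumcl.Nil by blast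
next
  case (3 k j u)
  define s where "s = wp (j # u)"
  have s: "is_perm s" "s \<noteq> []"
    by (simp_all add: s_def is_perm_wp)
  have e: "wp (k # j # u) = ext s k" by (simp add: s_def)
  have tail: "j # u \<in> W \<and> v @ [k] \<in> W \<and> v @ [Suc k] \<in> W" if "word_closed W" "v @ k # j # u \<in> W" for W v
    using word_closed_prefix[OF that(1), of "j # u" v k] word_closed_prefix'[OF that(1), of "j # u" v k]
      word_closed_suffix[OF that(1), of "v @ [k]" j u] that(2) by simp
  have "i < length s + k + 1"
    using 3(3) s(2) unfolding e by simp
  then consider "i < length s - 1" | "i = length s - 1" | "i = length s" | l where "l < k" "i = length s + 1 + l"
  proof -
    have "i < length s - 1 \<or> i = length s - 1 \<or> i = length s \<or>
        (i - (length s + 1) < k \<and> i = length s + 1 + (i - (length s + 1)))"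
      using \<open>i < length s + k + 1\<close> by linarith
    then show thesis using that by blast
  qed
  then show ?case
  proof cases
    case 1
    then obtain t u' where IH: "u' \<noteq> []" "rm s i = dsum t (wp u')"
      "\<And>W v. word_closed W \<Longrightarrow> v @ j # u \<in> W \<Longrightarrow> t \<in> sumcl (wp ` W) \<and> v @ u' \<in> W"
      using "3.IH"[of i] by (auto simp: s_def)
    have "rm (wp (k # j # u)) i = dsum t (wp (k # u'))"
      unfolding e using IH(1,2) 1 s by (simp add: rm_ext_inner ext_dsum wp_Cons)
    \<comment> \<open>The induction hypothesis is used with \<open>k\<close> appended to the prefix
      \<open>v\<close>, which is why the claim quantifies over \<open>v\<close>.\<close>
    moreover have "t \<in> sumcl (wp ` W) \<and> v @ k # u' \<in> W" if "word_closed W" "v @ k # j # u \<in> W" for W v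
      using IH(3)[of W "v @ [k]"] that by simp
    ultimately show ?thesis by blast
  next
    case 2
    have "rm (wp (k # j # u)) i = dsum s (wp [k])"
      unfolding e 2 using rm_ext_link[OF s] by simp
    moreover have "s \<in> sumcl (wp ` W) \<and> v @ [k] \<in> W" if "word_closed W" "v @ k # j # u \<in> W" for W v
      using tail[OF that] by (auto simp: s_def intro: sumcl_base)
    ultimately show ?thesis by blast
  next
    case 3
    have "rm (wp (k # j # u)) i = dsum (rm s (length s - 1)) (wp [Suc k])"
      unfolding e 3 using rm_ext_center[OF s] by simp
    moreover have "rm s (length s - 1) \<in> sumcl (wp ` W) \<and> v @ [Suc k] \<in> W"
      if "word_closed W" "v @ k # j # u \<in> W" for W v
      using tail[OF that] rm_wp_last[OF that(1), of "j # u"] by (simp add: s_def)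
    ultimately show ?thesis by blast
  next
    case (4 l)
    have "rm (wp (k # j # u)) i = dsum [] (wp ((k - 1) # j # u))"
      unfolding e 4 using rm_ext_pendant[OF s 4(1)] by (simp flip: s_def)
    moreover have "v @ (k - 1) # j # u \<in> W" if "word_closed W" "v @ k # j # u \<in> W" for W v
      using word_closed_dec[OF that(1), of v "k - 1" "j # u"] that(2) 4 by simp
    ultimately show ?thesis
      using sumcl.Nil by blast
  qed
qed simp

lemma rm_wp_in_sumcl:
  assumes W: "word_closed W" and w: "w \<in> W" and i: "i < length (wp w)"
  shows "rm (wp w) i \<in> sumcl (wp ` W)"
proof (cases "i = length (wp w) - 1")
  case True
  then show ?thesis using rm_wp_last[OF W w] by simp
next
  case False
  have "w \<noteq> []" using W w by (auto simp: word_closed_def)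
  then obtain t u' where u': "rm (wp w) i = dsum t (wp u')"
    "\<And>W v. word_closed W \<Longrightarrow> v @ w \<in> W \<Longrightarrow> t \<in> sumcl (wp ` W) \<and> v @ u' \<in> W"
    using rm_wp_not_last[of w i] i False by fastforce
  have "t \<in> sumcl (wp ` W)" "u' \<in> W"
    using u'(2)[OF W, of "[]"] w by auto
  then show ?thesis
    unfolding u'(1) by (intro sumcl_dsum[OF _ sumcl_base[OF imageI]])
qed

subsection \<open>Words with at most two branching centres\<close>

text \<open>\<open>leg a\<close> spells a path of \<open>a + 1\<close> vertices hanging off a centre, two vertices per letter zero, the outermost
  letter being one if \<open>a\<close> is even.  A path of one vertex is just another pendant of the centre, which is what
  \<open>dl\<close> accounts for.\<close>

definition leg :: "nat \<Rightarrow> nat list" where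
  "leg a = (if a = 0 then [] else (a + 1) mod 2 # replicate ((a - 1) div 2) 0)"

definition dl :: "nat \<Rightarrow> nat" where
  "dl a = (if a = 0 then 1 else 0)"

definition sgl :: "nat \<Rightarrow> nat \<Rightarrow> nat \<Rightarrow> nat list" where
  "sgl a k b = leg a @ [Suc k + dl a + dl b] @ rev (leg b)"

definition dbl :: "nat \<Rightarrow> nat \<Rightarrow> nat \<Rightarrow> nat \<Rightarrow> nat \<Rightarrow> nat list" where
  "dbl a k d k' b = leg a @ [Suc k + dl a] @ replicate d 0 @ [Suc k' + dl b] @ rev (leg b)"

text \<open>These words give the permutations whose inversion graph is a path, the increasing
  oscillations: one each of lengths one and two, and two of every length from three on.\<close>

definition paths :: "nat list set" where
  "paths = {[0], [1], [2]} \<union> {x # replicate i 0 @ [y] | x i y. x \<le> 1 \<and> y \<le> 1}"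

definition words :: "(nat \<times> nat \<times> nat) set \<Rightarrow> (nat \<times> nat \<times> nat \<times> nat \<times> nat) set \<Rightarrow> nat list set" where
  "words S T = paths \<union> (\<lambda>(a, k, b). sgl a k b) ` S \<union> (\<lambda>(a, k, d, k', b). dbl a k d k' b) ` T"

text \<open>In the last clause one centre of a two-centre word has become part of a leg. Asking for
  every leg length \<open>c\<close> keeps the clause independent of \<open>d\<close>, so that
  \<open>T\<close> can be chosen freely for each \<open>d\<close>.\<close>

definition down_closed where
  "down_closed S T \<longleftrightarrow>
     (\<forall>a k b a' k' b'. (a, k, b) \<in> S \<and> a' \<le> a \<and> k' \<le> k \<and> b' \<le> b \<longrightarrow> (a', k', b') \<in> S) \<and>
     (\<forall>a k d l b a' k' l' b'. (a, k, d, l, b) \<in> T \<and> a' \<le> a \<and> k' \<le> k \<and> l' \<le> l \<and> b' \<le> b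
        \<longrightarrow> (a', k', d, l', b') \<in> T) \<and>
     (\<forall>a k d l b c. (a, k, d, l, b) \<in> T \<longrightarrow> (a, k, c) \<in> S \<and> (c, l, b) \<in> S)"

lemma leg_0 [simp]: "leg 0 = []" and dl_0 [simp]: "dl 0 = 1" and dl_Suc [simp]: "dl (Suc a) = 0"
  by (simp_all add: leg_def dl_def)

lemma down_closed_S:
  assumes "down_closed S T" "(a, k, b) \<in> S" "a' \<le> a" "k' \<le> k" "b' \<le> b"
  shows "(a', k', b') \<in> S"
  using assms(1)[unfolded down_closed_def, THEN conjunct1, rule_format, of a k b a' k' b'] assms(2-) by simp

lemma down_closed_T:
  assumes "down_closed S T" "(a, k, d, l, b) \<in> T" "a' \<le> a" "k' \<le> k" "l' \<le> l" "b' \<le> b"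
  shows "(a', k', d, l', b') \<in> T"
  using assms(1)[unfolded down_closed_def, THEN conjunct2, THEN conjunct1, rule_format, of a k d l b a' k' l' b']
    assms(2-) by simp

lemma down_closed_TS:
  assumes "down_closed S T" "(a, k, d, l, b) \<in> T"
  shows "(a, k, c) \<in> S \<and> (c, l, b) \<in> S"
  using assms(1)[unfolded down_closed_def, THEN conjunct2, THEN conjunct2, rule_format, OF assms(2)] .

lemma leg_odd: "leg (Suc (2 * i)) = 0 # replicate i 0"
  by (simp add: leg_def)

lemma leg_even: "leg (Suc (Suc (2 * i))) = 1 # replicate i 0"
  by (simp add: leg_def)

lemma leg_cases:
  fixes a :: nat
  obtains "a = 0" | i where "a = Suc (2 * i)" | i where "a = Suc (Suc (2 * i))"
proof -
  consider "a = 0" | "odd a" | "a \<noteq> 0" "even a" by blast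
  then show thesis
  proof cases
    case 3
    then obtain m where "a = 2 * m" "m > 0" by (auto elim: evenE)
    then show ?thesis using that(3)[of "m - 1"] by simp
  next
    case 2
    then obtain i where "a = 2 * i + 1" by (rule oddE)
    then show ?thesis using that(2)[of i] by simp
  next
    case 1
    then show ?thesis by (rule that(1))
  qed
qed

lemma leg_eq_Cons: "a \<noteq> 0 \<Longrightarrow> \<exists>x i. x \<le> 1 \<and> leg a = x # replicate i 0"
proof (cases a rule: leg_cases)
  case (2 i)
  then show ?thesis unfolding 2 leg_odd by (intro exI[of _ 0] exI[of _ i]) simp
next
  case (3 i)
  then show ?thesis unfolding 3 leg_even by (intro exI[of _ 1] exI[of _ i]) simp
qed simp

lemma leg_add: "a \<noteq> 0 \<Longrightarrow> leg a @ replicate i 0 = leg (a + 2 * i)"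
proof -
  assume "a \<noteq> 0"
  then obtain c where a: "a = Suc c" by (cases a) auto
  have "(a + 2 * i - 1) div 2 = (a - 1) div 2 + i" by (simp add: a)
  then have "replicate ((a + 2 * i - 1) div 2) (0::nat) = replicate ((a - 1) div 2) 0 @ replicate i 0"
    by (simp only: replicate_add)
  moreover have "(a + 2 * i + 1) mod 2 = (a + 1) mod 2" by presburger
  ultimately show ?thesis
    using \<open>a \<noteq> 0\<close> by (simp only: leg_def) simp
qed

lemma sum_list_leg: "sum_list (leg a) + 2 * length (leg a) + dl a = a + 1"
proof (cases a rule: leg_cases)
  case (2 i)
  show ?thesis unfolding 2 leg_odd by (simp add: sum_list_replicate)
next
  case (3 i)
  show ?thesis unfolding 3 leg_even by (simp add: sum_list_replicate)
qed simp

lemma wsize_sgl: "wsize (sgl a k b) = a + k + b + 4"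
  using sum_list_leg[of a] sum_list_leg[of b] by (simp add: sgl_def wsize_def)

lemma wsize_dbl: "wsize (dbl a k d k' b) = a + k + k' + b + 2 * d + 7"
  using sum_list_leg[of a] sum_list_leg[of b] by (simp add: dbl_def wsize_def sum_list_replicate)

lemma rev_sgl: "rev (sgl a k b) = sgl b k a"
  by (simp add: sgl_def)

lemma rev_dbl: "rev (dbl a k d k' b) = dbl b k' d k a"
  by (simp add: dbl_def)

lemma rev_paths: "w \<in> paths \<Longrightarrow> rev w \<in> paths"
  by (auto simp: paths_def)

text \<open>A centre with no pendants besides its two legs is an ordinary inner vertex of a
  path.\<close>

lemma path_join:
  "leg a @ [dl a + dl b] @ rev (leg b) \<in> paths"
proof -
  have p: "x # replicate i 0 @ [y] \<in> paths" if "x \<le> 1" "y \<le> 1" for x i y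
    using that by (auto simp: paths_def)
  consider "a = 0" "b = 0" | "a = 0" "b \<noteq> 0" | "a \<noteq> 0" "b = 0" | "a \<noteq> 0" "b \<noteq> 0" by blast
  then show ?thesis
  proof cases
    case 2
    then obtain y i where "y \<le> 1" "leg b = y # replicate i 0" using leg_eq_Cons by blast
    then show ?thesis using 2 p[of 1 y i] by (simp add: dl_def)
  next
    case 3
    then obtain x i where "x \<le> 1" "leg a = x # replicate i 0" using leg_eq_Cons by blast
    then show ?thesis using 3 p[of x 1 i] by (simp add: dl_def)
  next
    case 4
    obtain x i where "x \<le> 1" "leg a = x # replicate i 0"
      using leg_eq_Cons[OF 4(1)] by blast
    moreover obtain y j where "y \<le> 1" "leg b = y # replicate j 0"
      using leg_eq_Cons[OF 4(2)] by blast
    moreover have "x # replicate i 0 @ [0] @ replicate j 0 @ [y] = x # replicate (i + Suc j) 0 @ [y]"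
      by (simp only: replicate_add replicate_Suc) simp
    ultimately have "leg a @ [dl a + dl b] @ rev (leg b) = x # replicate (i + Suc j) 0 @ [y]"
      using 4 by (simp add: dl_def)
    then show ?thesis
      using p[OF \<open>x \<le> 1\<close> \<open>y \<le> 1\<close>, of "i + Suc j"] by (simp only:)
  qed (auto simp: paths_def dl_def)
qed

section \<open>Lowering one letter, that is, deleting one pendant\<close>

definition lower :: "nat list \<Rightarrow> nat list \<Rightarrow> bool" where
  "lower w w' \<longleftrightarrow> (\<exists>v c u. w = v @ Suc c # u \<and> w' = v @ c # u)"

lemma lower_Nil [simp]: "\<not> lower [] w"
  by (simp add: lower_def)

lemma lower_Cons: "lower (x # w) w' \<longleftrightarrow> (\<exists>c. x = Suc c \<and> w' = c # w) \<or> (\<exists>v. lower w v \<and> w' = x # v)"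
proof
  assume "lower (x # w) w'"
  then obtain v c u where "x # w = v @ Suc c # u" "w' = v @ c # u" by (auto simp: lower_def)
  then show "(\<exists>c. x = Suc c \<and> w' = c # w) \<or> (\<exists>v. lower w v \<and> w' = x # v)"
    by (cases v) (auto simp: lower_def)
next
  assume "(\<exists>c. x = Suc c \<and> w' = c # w) \<or> (\<exists>v. lower w v \<and> w' = x # v)"
  then show "lower (x # w) w'"
    unfolding lower_def by (metis append_Cons append_Nil)
qed

lemma lower_append: "lower (u @ w) w' \<longleftrightarrow> (\<exists>v. lower u v \<and> w' = v @ w) \<or> (\<exists>v. lower w v \<and> w' = u @ v)"
  by (induction u arbitrary: w') (auto simp: lower_Cons)

lemma lower_replicate [simp]: "\<not> lower (replicate n 0) w"
  by (induction n arbitrary: w) (auto simp: lower_Cons)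

lemma lower_rev: "lower (rev w) w' \<longleftrightarrow> (\<exists>v. lower w v \<and> w' = rev v)"
  by (induction w arbitrary: w') (auto simp: lower_Cons lower_append)

text \<open>The only nonzero letter of a leg is the outermost 1 of an even leg; lowering it removes
  the end vertex of that path.\<close>

lemma lower_leg:
  assumes "lower (leg a) w"
  shows "a \<noteq> 0 \<and> a - 1 \<noteq> 0 \<and> w = leg (a - 1)"
proof (cases a rule: leg_cases)
  case (2 i)
  then show ?thesis using assms unfolding 2 leg_odd by (simp add: lower_Cons)
next
  case (3 i)
  then show ?thesis using assms unfolding 3 leg_even by (simp add: lower_Cons leg_odd)
qed (use assms in simp)

lemma dl_pred: "a \<noteq> 0 \<Longrightarrow> a - 1 \<noteq> 0 \<Longrightarrow> dl (a - 1) = dl a"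
  by (simp add: dl_def)

lemma lower_sgl:
  assumes "lower (sgl a k b) w"
  shows "w \<in> paths \<or> (\<exists>a' k' b'. a' \<le> a \<and> k' \<le> k \<and> b' \<le> b \<and> w = sgl a' k' b')"
proof -
  let ?c = "Suc k + dl a + dl b"
  consider v where "lower (leg a) v" "w = v @ [?c] @ rev (leg b)"
    | "w = leg a @ [k + dl a + dl b] @ rev (leg b)"
    | v where "lower (leg b) v" "w = leg a @ [?c] @ rev v"
    using assms unfolding sgl_def lower_append lower_Cons lower_rev by auto
  then show ?thesis
  proof cases
    case 1
    then have "w = sgl (a - 1) k b"
      using lower_leg[OF 1(1)] dl_pred[of a] by (simp add: sgl_def)
    then show ?thesis by (metis diff_le_self le_refl)
  next
    case 2
    show ?thesis
    proof (cases k)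
      case 0
      then show ?thesis using 2 path_join by simp
    next
      case (Suc l)
      then have "w = sgl a l b" using 2 by (simp add: sgl_def)
      then show ?thesis using Suc by (metis le_refl le_Suc_eq)
    qed
  next
    case 3
    then have "w = sgl a k (b - 1)"
      using lower_leg[OF 3(1)] dl_pred[of b] by (simp add: sgl_def)
    then show ?thesis by (metis diff_le_self le_refl)
  qed
qed

text \<open>The left centre, now without pendants of its own, and the \<open>d\<close> zero letters
  each add two vertices to the left leg of the other centre.\<close>

lemma dbl_no_left: "leg a @ [dl a] @ replicate d 0 @ [Suc k' + dl b] @ rev (leg b) = sgl (a + 2 * d + 2) k' b"
proof (cases "a = 0")
  case True
  then show ?thesis by (simp add: sgl_def dl_def leg_even)
next
  case False
  have "leg a @ [dl a] @ replicate d 0 = leg (a + 2 * d + 2)"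
    using leg_add[OF False, of "Suc d"] False by (simp add: dl_def)
  then show ?thesis
    by (simp add: sgl_def flip: append_assoc)
qed

lemma lower_dbl:
  assumes "lower (dbl a k d k' b) w"
  shows "(\<exists>c. w = sgl c k' b) \<or> (\<exists>c. w = sgl a k c) \<or>
    (\<exists>a' l l' b'. a' \<le> a \<and> l \<le> k \<and> l' \<le> k' \<and> b' \<le> b \<and> w = dbl a' l d l' b')"
proof -
  consider v where "lower (leg a) v" "w = v @ [Suc k + dl a] @ replicate d 0 @ [Suc k' + dl b] @ rev (leg b)"
    | "w = leg a @ [k + dl a] @ replicate d 0 @ [Suc k' + dl b] @ rev (leg b)"
    | "w = leg a @ [Suc k + dl a] @ replicate d 0 @ [k' + dl b] @ rev (leg b)"
    | v where "lower (leg b) v" "w = leg a @ [Suc k + dl a] @ replicate d 0 @ [Suc k' + dl b] @ rev v"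
    using assms unfolding dbl_def lower_append lower_Cons lower_rev by auto
  then show ?thesis
  proof cases
    case 1
    then have "w = dbl (a - 1) k d k' b"
      using lower_leg[OF 1(1)] dl_pred[of a] by (simp add: dbl_def)
    then show ?thesis by (metis diff_le_self le_refl)
  next
    case 2
    show ?thesis
    proof (cases k)
      case 0
      then show ?thesis using 2 dbl_no_left by simp blast
    next
      case (Suc l)
      then have "w = dbl a l d k' b" using 2 by (simp add: dbl_def)
      then show ?thesis using Suc by (metis le_refl le_Suc_eq)
    qed
  next
    case 3
    show ?thesis
    proof (cases k')
      case 0
      then have "rev w = sgl (b + 2 * d + 2) k a"
        using 3 dbl_no_left[of b d k a] by simp
      then have "w = sgl a k (b + 2 * d + 2)"
        by (metis rev_rev_ident rev_sgl)
      then show ?thesis by blast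
    next
      case (Suc l)
      then have "w = dbl a k d l b" using 3 by (simp add: dbl_def)
      then show ?thesis using Suc by (metis le_refl le_Suc_eq)
    qed
  next
    case 4
    then have "w = dbl a k d k' (b - 1)"
      using lower_leg[OF 4(1)] dl_pred[of b] by (simp add: dbl_def)
    then show ?thesis by (metis diff_le_self le_refl)
  qed
qed

lemma lower_path:
  assumes "lower w w'" "w \<in> paths"
  shows "w' \<in> paths"
proof -
  consider "w \<in> {[0], [1], [2]}" | x i y where "x \<le> 1" "y \<le> 1" "w = x # replicate i 0 @ [y]"
    using assms(2) by (auto simp: paths_def)
  then show ?thesis
  proof cases
    case 1
    then show ?thesis using assms(1) by (auto simp: lower_Cons paths_def)
  next
    case 2
    then consider c where "x = Suc c" "w' = c # replicate i 0 @ [y]" | c where "y = Suc c" "w' = x # replicate i 0 @ [c]"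
      using assms(1) by (auto simp: lower_Cons lower_append)
    then show ?thesis
      using 2 by cases (auto simp: paths_def)
  qed
qed

text \<open>Dropping the head letter cuts the leg at its outer end. If a single vertex is left
  (\<open>a' = 0\<close>), it is counted in the letter of the centre, which the term
  \<open>dl a' - dl a\<close> corrects for. If \<open>a = 0\<close>, the dropped letter is the
  centre itself.\<close>

lemma drop_leg:
  assumes "leg a @ Suc c # r = x # y # u"
  shows "\<exists>a'\<le>a. (a' = 0 \<or> dl a' = dl a) \<and> Suc y # u = leg a' @ (Suc c + dl a' - dl a) # r
      \<or> a = 0 \<and> r = y # u"
proof (cases a rule: leg_cases)
  case 1
  then show ?thesis using assms by simp
next
  case (2 i)
  then have e: "replicate i 0 @ Suc c # r = y # u" using assms unfolding 2 leg_odd by simp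
  show ?thesis
  proof (cases i)
    case 0
    then show ?thesis using e 2 by (intro exI[of _ 0]) (auto simp: dl_def)
  next
    case (Suc j)
    then show ?thesis using e 2 leg_even[of j] by (intro exI[of _ "Suc (Suc (2 * j))"]) (auto simp: dl_def)
  qed
next
  case (3 i)
  then have e: "replicate i 0 @ Suc c # r = y # u" using assms unfolding 3 leg_even by simp
  show ?thesis
  proof (cases i)
    case 0
    then show ?thesis using e 3 by (intro exI[of _ 0]) (auto simp: dl_def)
  next
    case (Suc j)
    then show ?thesis using e 3 leg_even[of j] by (intro exI[of _ "Suc (Suc (2 * j))"]) (auto simp: dl_def)
  qed
qed

lemma drop_path:
  assumes "x # y # u \<in> paths"
  shows "Suc y # u \<in> paths"
proof -
  obtain i z where iz: "z \<le> 1" "y # u = replicate i 0 @ [z]"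
    using assms by (auto simp: paths_def)
  show ?thesis
  proof (cases i)
    case 0
    then show ?thesis using iz by (auto simp: paths_def le_Suc_eq)
  next
    case (Suc j)
    then show ?thesis using iz by (auto simp: paths_def)
  qed
qed

lemma drop_rev_leg:
  assumes "rev (leg b) = y # u"
  shows "Suc y # u \<in> paths"
proof -
  have "b \<noteq> 0" using assms by (cases "b = 0") simp_all
  then obtain x i where "x \<le> 1" "leg b = x # replicate i 0" using leg_eq_Cons by blast
  then have "y # u = replicate i 0 @ [x]" using assms by simp
  then have "0 # y # u \<in> paths"
    using \<open>x \<le> 1\<close> by (auto simp: paths_def)
  then show ?thesis by (rule drop_path)
qed

lemma drop_sgl:
  assumes "sgl a k b = x # y # u"
  shows "Suc y # u \<in> paths \<or> (\<exists>a'\<le>a. Suc y # u = sgl a' k b)"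
proof -
  have "leg a @ Suc (k + dl a + dl b) # rev (leg b) = x # y # u"
    using assms by (simp add: sgl_def)
  from drop_leg[OF this] obtain a' where "a' \<le> a"
    "(a' = 0 \<or> dl a' = dl a) \<and> Suc y # u = leg a' @ (Suc (k + dl a + dl b) + dl a' - dl a) # rev (leg b)
      \<or> a = 0 \<and> rev (leg b) = y # u" by blast
  then show ?thesis
    using drop_rev_leg[of b y u] by (auto simp: sgl_def ac_simps intro!: exI[of _ a'])
qed

lemma drop_dbl:
  assumes "dbl a k d k' b = x # y # u"
  shows "(\<exists>c. Suc y # u = sgl c k' b) \<or> (\<exists>a'\<le>a. Suc y # u = dbl a' k d k' b)"
proof -
  let ?r = "replicate d 0 @ [Suc k' + dl b] @ rev (leg b)"
  have "leg a @ Suc (k + dl a) # ?r = x # y # u"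
    using assms by (simp add: dbl_def)
  from drop_leg[OF this] obtain a' where "a' \<le> a"
    "(a' = 0 \<or> dl a' = dl a) \<and> Suc y # u = leg a' @ (Suc (k + dl a) + dl a' - dl a) # ?r
      \<or> a = 0 \<and> ?r = y # u" by blast
  then consider "Suc y # u = leg a' @ (Suc k + dl a') # ?r" | "a = 0" "?r = y # u"
    by (auto simp: ac_simps)
  then show ?thesis
  proof cases
    case 1
    then show ?thesis using \<open>a' \<le> a\<close> by (auto simp: dbl_def)
  next
    case 2
    \<comment> \<open>Of the deleted centre only its joining entry remains; with the
      \<open>d\<close> zero letters it forms a path of \<open>2 * d + 1\<close> vertices, which is
      the leg with index \<open>2 * d\<close>.\<close>
    have "Suc y # u = sgl (2 * d) k' b"
    proof (cases d)
      case 0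
      then show ?thesis using 2 by (simp add: sgl_def)
    next
      case (Suc e)
      then show ?thesis using 2 leg_even[of e] by (simp add: sgl_def dl_def)
    qed
    then show ?thesis by blast
  qed
qed

section \<open>Closure of the word sets under deletion\<close>

lemma words_pathI: "w \<in> paths \<Longrightarrow> w \<in> words S T"
  by (simp add: words_def)

lemma words_sglI: "(a, k, b) \<in> S \<Longrightarrow> sgl a k b \<in> words S T"
  by (force simp: words_def)

lemma words_dblI: "(a, k, d, l, b) \<in> T \<Longrightarrow> dbl a k d l b \<in> words S T"
  by (force simp: words_def)

lemma words_cases:
  assumes "w \<in> words S T"
  obtains "w \<in> paths" | a k b where "(a, k, b) \<in> S" "w = sgl a k b"
    | a k d l b where "(a, k, d, l, b) \<in> T" "w = dbl a k d l b"
  using assms unfolding words_def by auto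

lemma words_drop:
  assumes "down_closed S T" "x # y # u \<in> words S T"
  shows "Suc y # u \<in> words S T"
  using assms(2)
proof (cases rule: words_cases)
  case 1
  then show ?thesis by (intro words_pathI drop_path)
next
  case (2 a k b)
  from drop_sgl[OF 2(2)[symmetric]] show ?thesis
  proof
    assume "\<exists>a'\<le>a. Suc y # u = sgl a' k b"
    then obtain a' where a': "a' \<le> a" "Suc y # u = sgl a' k b" by blast
    show ?thesis unfolding a'(2)
      by (rule words_sglI, rule down_closed_S[OF assms(1) 2(1) a'(1)]) simp_all
  qed (rule words_pathI)
next
  case (3 a k d l b)
  from drop_dbl[OF 3(2)[symmetric]] show ?thesis
  proof
    assume "\<exists>c. Suc y # u = sgl c l b"
    then obtain c where c: "Suc y # u = sgl c l b" by blast
    show ?thesis unfolding c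
      using down_closed_TS[OF assms(1) 3(1)] by (intro words_sglI) blast
  next
    assume "\<exists>a'\<le>a. Suc y # u = dbl a' k d l b"
    then obtain a' where a': "a' \<le> a" "Suc y # u = dbl a' k d l b" by blast
    show ?thesis unfolding a'(2)
      by (rule words_dblI, rule down_closed_T[OF assms(1) 3(1) a'(1)]) simp_all
  qed
qed

lemma words_lower:
  assumes "down_closed S T" "w \<in> words S T" "lower w w'"
  shows "w' \<in> words S T"
  using assms(2)
proof (cases rule: words_cases)
  case 1
  then show ?thesis using lower_path[OF assms(3)] by (intro words_pathI)
next
  case (2 a k b)
  from lower_sgl[OF assms(3)[unfolded 2(2)]] show ?thesis
  proof
    assume "\<exists>a' k' b'. a' \<le> a \<and> k' \<le> k \<and> b' \<le> b \<and> w' = sgl a' k' b'"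
    then obtain a' k' b' where e: "a' \<le> a" "k' \<le> k" "b' \<le> b" "w' = sgl a' k' b'" by blast
    show ?thesis unfolding e(4)
      by (rule words_sglI, rule down_closed_S[OF assms(1) 2(1) e(1-3)])
  qed (rule words_pathI)
next
  case (3 a k d l b)
  have S: "(a, k, c) \<in> S" "(c, l, b) \<in> S" for c
    using down_closed_TS[OF assms(1) 3(1)] by blast+
  from lower_dbl[OF assms(3)[unfolded 3(2)]]
  consider c where "w' = sgl c l b" | c where "w' = sgl a k c"
    | a' k' l' b' where "a' \<le> a" "k' \<le> k" "l' \<le> l" "b' \<le> b" "w' = dbl a' k' d l' b'" by blast
  then show ?thesis
  proof cases
    case (3 a' k' l' b')
    show ?thesis unfolding 3(5)
      by (rule words_dblI, rule down_closed_T[OF assms(1) \<open>(a, k, d, l, b) \<in> T\<close> 3(1-4)])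
  qed (use S words_sglI in auto)
qed

text \<open>This symmetry yields the condition on the right end of a word from
  \<open>words_drop\<close>, applied to reversed words.\<close>

lemma down_closed_rev:
  assumes "down_closed S T"
  shows "down_closed {(a, k, b). (b, k, a) \<in> S} {(a, k, d, l, b). (b, l, d, k, a) \<in> T}"
  unfolding down_closed_def
proof (intro conjI allI impI; (elim conjE)?)
  show "(a', k', b') \<in> {(a, k, b). (b, k, a) \<in> S}"
    if "(a, k, b) \<in> {(a, k, b). (b, k, a) \<in> S}" "a' \<le> a" "k' \<le> k" "b' \<le> b" for a k b a' k' b'
    using that down_closed_S[OF assms, of b k a b' k' a'] by simp
  show "(a', k', d, l', b') \<in> {(a, k, d, l, b). (b, l, d, k, a) \<in> T}"
    if "(a, k, d, l, b) \<in> {(a, k, d, l, b). (b, l, d, k, a) \<in> T}" "a' \<le> a" "k' \<le> k" "l' \<le> l" "b' \<le> b"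
    for a k d l b a' k' l' b'
    using that down_closed_T[OF assms, of b l d k a b' l' k' a'] by simp
  show "(a, k, c) \<in> {(a, k, b). (b, k, a) \<in> S}" "(c, l, b) \<in> {(a, k, b). (b, k, a) \<in> S}"
    if "(a, k, d, l, b) \<in> {(a, k, d, l, b). (b, l, d, k, a) \<in> T}" for a k d l b c
    using that down_closed_TS[OF assms, of b l d k a c] by simp_all
qed

lemma rev_words:
  assumes "w \<in> words S T"
  shows "rev w \<in> words {(a, k, b). (b, k, a) \<in> S} {(a, k, d, l, b). (b, l, d, k, a) \<in> T}"
  using assms
proof (cases rule: words_cases)
  case 1
  then show ?thesis by (intro words_pathI rev_paths)
next
  case (2 a k b)
  then show ?thesis unfolding 2(2) rev_sgl by (intro words_sglI) simp
next
  case (3 a k d l b)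
  then show ?thesis unfolding 3(2) rev_dbl by (intro words_dblI) simp
qed

lemma word_closed_words:
  assumes "down_closed S T"
  shows "word_closed (words S T)"
  unfolding word_closed_def
proof (intro conjI allI impI)
  show "[0] \<in> words S T" by (simp add: words_def paths_def)
  show "[] \<notin> words S T" by (auto simp: words_def paths_def sgl_def dbl_def)
  show "v @ c # u \<in> words S T" if "v @ Suc c # u \<in> words S T" for v c u
    using words_lower[OF assms that] by (auto simp: lower_def)
  show "Suc y # u \<in> words S T" if "c # y # u \<in> words S T" for c y u
    by (rule words_drop[OF assms that])
  show "v @ [Suc x] \<in> words S T" if "v @ [x, c] \<in> words S T" for v x c
  proof -
    have "c # x # rev v \<in> words {(a, k, b). (b, k, a) \<in> S} {(a, k, d, l, b). (b, l, d, k, a) \<in> T}"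
      using rev_words[OF that] by simp
    from rev_words[OF words_drop[OF down_closed_rev[OF assms] this]] show ?thesis
      by simp
  qed
qed

subsection \<open>Generating functions of the word families\<close>

lemma inj_leg: "leg a = leg b \<Longrightarrow> a = b"
  using sum_list_leg[of a] sum_list_leg[of b] by (cases "a = 0"; cases "b = 0") (auto simp: leg_def dl_def)

text \<open>Subtracting one from both end letters turns legs into zeros and undoes the shift by \<open>dl\<close>, so the letters
  that remain nonzero belong to the centres.\<close>

definition trim :: "nat list \<Rightarrow> nat list" where
  "trim w = (let v = w[0 := w ! 0 - 1] in v[length w - 1 := v ! (length w - 1) - 1])"

lemma trim_sgl: "trim (sgl a k b) = replicate (length (leg a)) 0 @ [Suc k] @ replicate (length (leg b)) 0"
proof -
  consider "a = 0" "b = 0" | "a = 0" "b \<noteq> 0" | "a \<noteq> 0" "b = 0" | "a \<noteq> 0" "b \<noteq> 0" by blast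
  then show ?thesis
  proof cases
    case 2
    then obtain y i where "y \<le> 1" "leg b = y # replicate i 0" using leg_eq_Cons by blast
    then show ?thesis using 2
      by (simp add: sgl_def trim_def dl_def list_update_append nth_append flip: replicate_append_same)
  next
    case 3
    then obtain x i where "x \<le> 1" "leg a = x # replicate i 0" using leg_eq_Cons by blast
    then show ?thesis using 3
      by (simp add: sgl_def trim_def dl_def list_update_append nth_append)
  next
    case 4
    obtain x i where "x \<le> 1" "leg a = x # replicate i 0" using leg_eq_Cons[OF 4(1)] by blast
    moreover obtain y j where "y \<le> 1" "leg b = y # replicate j 0" using leg_eq_Cons[OF 4(2)] by blast
    ultimately show ?thesis using 4
      by (simp add: sgl_def trim_def dl_def list_update_append nth_append flip: replicate_append_same)
  qed (simp add: sgl_def trim_def)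
qed

lemma trim_dbl: "trim (dbl a k d l b) =
  replicate (length (leg a)) 0 @ [Suc k] @ replicate d 0 @ [Suc l] @ replicate (length (leg b)) 0"
proof -
  consider "a = 0" "b = 0" | "a = 0" "b \<noteq> 0" | "a \<noteq> 0" "b = 0" | "a \<noteq> 0" "b \<noteq> 0" by blast
  then show ?thesis
  proof cases
    case 1
    then show ?thesis
      by (simp add: dbl_def trim_def dl_def list_update_append nth_append)
  next
    case 2
    then obtain y i where "y \<le> 1" "leg b = y # replicate i 0" using leg_eq_Cons by blast
    then show ?thesis using 2
      by (simp add: dbl_def trim_def dl_def list_update_append nth_append flip: replicate_append_same)
  next
    case 3
    then obtain x i where "x \<le> 1" "leg a = x # replicate i 0" using leg_eq_Cons by blast
    then show ?thesis using 3
      by (simp add: dbl_def trim_def dl_def list_update_append nth_append)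
  next
    case 4
    obtain x i where "x \<le> 1" "leg a = x # replicate i 0" using leg_eq_Cons[OF 4(1)] by blast
    moreover obtain y j where "y \<le> 1" "leg b = y # replicate j 0" using leg_eq_Cons[OF 4(2)] by blast
    ultimately show ?thesis using 4
      by (simp add: dbl_def trim_def dl_def list_update_append nth_append flip: replicate_append_same)
  qed
qed

lemma filter_trim_path: "w \<in> paths \<Longrightarrow> filter (\<lambda>x. x \<noteq> 0) (trim w) = []"
  by (auto simp: paths_def trim_def list_update_append nth_append)

lemma filter_trim_sgl: "filter (\<lambda>x. x \<noteq> 0) (trim (sgl a k b)) = [Suc k]"
  by (simp add: trim_sgl)

lemma filter_trim_dbl: "filter (\<lambda>x. x \<noteq> 0) (trim (dbl a k d l b)) = [Suc k, Suc l]"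
  by (simp add: trim_dbl)

lemma takeWhile_replicate_0: "takeWhile (\<lambda>x. x = 0) (replicate n (0::nat) @ Suc k # w) = replicate n 0"
  by (induction n) auto

text \<open>The nonzero letter of the trimmed word gives \<open>k\<close>; its position gives the
  length of the left leg, which is then a prefix of known length. Reversal does the same for the
  right leg.\<close>

lemma sgl_inj: 
  assumes "sgl a k b = sgl a' k' b'"
  shows "a = a' \<and> k = k' \<and> b = b'"
proof -
  have k: "k = k'"
    using filter_trim_sgl[of a k b] filter_trim_sgl[of a' k' b'] assms by simp
  have left: "a = a'" if e: "sgl a k b = sgl a' k' b'" for a k b a' k' b'
  proof -
    have "takeWhile (\<lambda>x. x = 0) (trim (sgl a k b)) = takeWhile (\<lambda>x. x = 0) (trim (sgl a' k' b'))"
      using e by simp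
    then have "length (leg a) = length (leg a')"
      unfolding trim_sgl by (simp add: takeWhile_replicate_0)
    then have "leg a = leg a'"
      using e by (simp add: sgl_def)
    then show ?thesis by (rule inj_leg)
  qed
  have "sgl b k a = sgl b' k' a'"
    using arg_cong[OF assms, of rev] by (simp add: rev_sgl)
  then show ?thesis
    using left[OF assms] left[of b k a b' k' a'] k by simp
qed

lemma dbl_inj: 
  assumes "dbl a k d l b = dbl a' k' d' l' b'"
  shows "a = a' \<and> k = k' \<and> d = d' \<and> l = l' \<and> b = b'"
proof -
  have k: "k = k'" "l = l'"
    using filter_trim_dbl[of a k d l b] filter_trim_dbl[of a' k' d' l' b'] assms by simp_all
  have left: "a = a'" if e: "dbl a k d l b = dbl a' k' d' l' b'" for a k d l b a' k' d' l' b'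
  proof -
    have "takeWhile (\<lambda>x. x = 0) (trim (dbl a k d l b)) = takeWhile (\<lambda>x. x = 0) (trim (dbl a' k' d' l' b'))"
      using e by simp
    then have "length (leg a) = length (leg a')"
      unfolding trim_dbl by (simp add: takeWhile_replicate_0)
    then have "leg a = leg a'"
      using e by (simp add: dbl_def)
    then show ?thesis by (rule inj_leg)
  qed
  have "dbl b l d k a = dbl b' l' d' k' a'"
    using arg_cong[OF assms, of rev] by (simp add: rev_dbl)
  then have ab: "a = a'" "b = b'"
    using left[OF assms] left[of b l d k a b' l' d' k' a'] by simp_all
  then have "d = d'"
    using arg_cong[OF assms, of length] by (simp add: dbl_def)
  then show ?thesis using k ab by simp
qed

lemma paths_neq_sgl: "w \<in> paths \<Longrightarrow> w \<noteq> sgl a k b"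
  using filter_trim_path[of w] filter_trim_sgl[of a k b] by auto

lemma paths_neq_dbl: "w \<in> paths \<Longrightarrow> w \<noteq> dbl a k d l b"
  using filter_trim_path[of w] filter_trim_dbl[of a k d l b] by auto

lemma sgl_neq_dbl: "sgl a k b \<noteq> dbl a' k' d l b'"
  using filter_trim_sgl[of a k b] filter_trim_dbl[of a' k' d l b'] by auto

section \<open>Summing the weights of the families\<close>

lemma has_sum_Sigma_nonneg:
  fixes f :: "'a \<Rightarrow> 'b \<Rightarrow> real"
  assumes "\<And>x. x \<in> A \<Longrightarrow> (f x has_sum g x) (B x)" "(g has_sum s) A" "\<And>x y. f x y \<ge> 0"
  shows "((\<lambda>(x, y). f x y) has_sum s) (Sigma A B)"
proof (rule has_sum_SigmaI)
  show "((\<lambda>y. case (x, y) of (x, y) \<Rightarrow> f x y) has_sum g x) (B x)" if "x \<in> A" for x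
    using assms(1)[OF that] by simp
  show "(\<lambda>(x, y). f x y) summable_on Sigma A B"
    using assms by (intro summable_on_SigmaI[where g = g]) (auto simp: has_sum_imp_summable)
qed (rule assms(2))

lemma has_sum_geometric_step:
  fixes z :: real
  assumes "0 < z" "z < 1" "m > 0"
  shows "((\<lambda>i. z ^ (c + m * i)) has_sum z ^ c / (1 - z ^ m)) UNIV"
proof -
  have "z ^ m < 1" using assms by (simp add: power_less_one_iff)
  then have "(\<lambda>i. (z ^ m) ^ i) sums (1 / (1 - z ^ m))"
    using assms by (intro geometric_sums) simp
  then have "(\<lambda>i. z ^ c * (z ^ m) ^ i) sums (z ^ c * (1 / (1 - z ^ m)))"
    by (rule sums_mult)
  then have "(\<lambda>i. z ^ (c + m * i)) sums (z ^ c / (1 - z ^ m))"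
    by (simp add: power_add power_mult)
  then show ?thesis
    using assms by (intro sums_nonneg_imp_has_sum) auto
qed

lemma has_sum_paths:
  fixes z :: real
  assumes z: "0 < z" "z < 1"
  shows "((\<lambda>w. z ^ wsize w) has_sum (z + z^2 + 2 * z^3 / (1 - z))) paths"
proof -
  define h :: "(nat \<times> nat) \<times> nat \<Rightarrow> nat list" where "h = (\<lambda>((x, y), i). x # replicate i 0 @ [y])"
  define I :: "((nat \<times> nat) \<times> nat) set" where "I = ({0, 1} \<times> {0, 1}) \<times> UNIV"
  have wh: "wsize (h ((x, y), i)) = 3 + x + y + 2 * i" for x y i
    by (simp add: h_def wsize_def sum_list_replicate)
  have "((\<lambda>(p, i). z ^ ((3 + fst p + snd p) + 2 * i)) has_sum
      (\<Sum>p\<in>{0, 1} \<times> {0, 1}. z ^ (3 + fst p + snd p) / (1 - z ^ 2))) I"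
    unfolding I_def
  proof (rule has_sum_Sigma_nonneg)
    show "((\<lambda>i. z ^ (3 + fst p + snd p + 2 * i)) has_sum z ^ (3 + fst p + snd p) / (1 - z ^ 2)) UNIV" for p :: "nat \<times> nat"
      using z by (intro has_sum_geometric_step) auto
  next
    show "((\<lambda>p. z ^ (3 + fst p + snd p) / (1 - z ^ 2)) has_sum
      (\<Sum>p\<in>{0, 1} \<times> {0, 1}. z ^ (3 + fst p + snd p) / (1 - z ^ 2))) ({0, 1} \<times> {0, 1})"
      by (rule has_sum_finite) simp
  qed (use z in simp)
  also have "(\<lambda>(p, i). z ^ ((3 + fst p + snd p) + 2 * i)) = (\<lambda>w. z ^ wsize w) \<circ> h"
    using wh by (auto simp: fun_eq_iff)
  finally have *: "((\<lambda>w. z ^ wsize w) \<circ> h has_sum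
      (\<Sum>p\<in>{0, 1} \<times> {0, 1}. z ^ (3 + fst p + snd p) / (1 - z ^ 2))) I" .
  have "inj h"
  proof (rule injI)
    fix p q assume e: "h p = h q"
    obtain x y i x' y' i' where pq: "p = ((x, y), i)" "q = ((x', y'), i')"
      by (metis surj_pair)
    have "x = x'" "replicate i 0 @ [y] = replicate i' 0 @ [y']"
      using e by (auto simp: h_def pq)
    then show "p = q"
      using arg_cong[of "replicate i 0 @ [y]" "replicate i' 0 @ [y']" length] by (simp add: pq)
  qed
  then have "inj_on h I"
    by (rule inj_on_subset) simp
  with * have 1: "((\<lambda>w. z ^ wsize w) has_sum
      (\<Sum>p\<in>{0, 1} \<times> {0, 1}. z ^ (3 + fst p + snd p) / (1 - z ^ 2))) (h ` I)"
    by (simp add: has_sum_reindex)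
  have 2: "((\<lambda>w. z ^ wsize w) has_sum (\<Sum>w\<in>{[0], [1], [2]}. z ^ wsize w)) {[0], [1], [2]}"
    by (intro has_sum_finite) simp
  have "length w \<ge> 2" if "w \<in> h ` I" for w
    using that by (auto simp: h_def I_def)
  then have disj: "{[0], [1], [2]} \<inter> h ` I = {}"
    by fastforce
  have "(\<Sum>w\<in>{[0], [1], [2]}. z ^ wsize w) = z + z^2 + z^3"
    by (simp add: wsize_def numeral_eq_Suc)
  \<comment> \<open>The choices of the two end letters contribute
    \<open>z^3 * (1 + z)^2 / (1 - z^2)\<close>, in which one factor \<open>1 + z\<close>
    cancels.\<close>
  moreover have "(\<Sum>p\<in>{0::nat, 1} \<times> {0::nat, 1}. z ^ (3 + fst p + snd p) / (1 - z ^ 2)) = z^3 * (1 + z) / (1 - z)"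
  proof -
    have "(\<Sum>p\<in>{0::nat, 1} \<times> {0::nat, 1}. z ^ (3 + fst p + snd p) / (1 - z ^ 2))
        = (z^3 + 2 * z^4 + z^5) / (1 - z^2)"
      by (simp add: sum.cartesian_product' numeral_eq_Suc add_divide_distrib)
    also have "z^3 + 2 * z^4 + z^5 = (z^3 * (1 + z)) * (1 + z)"
      by (simp add: algebra_simps power_numeral_reduce)
    also have "z^3 * (1 + z) * (1 + z) / (1 - z^2) = z^3 * (1 + z) * (1 + z) / ((1 - z) * (1 + z))"
      by (simp add: algebra_simps power2_eq_square)
    also have "\<dots> = z^3 * (1 + z) / (1 - z)"
      using z by simp
    finally show ?thesis .
  qed
  ultimately have "((\<lambda>w. z ^ wsize w) has_sum (z + z^2 + z^3 + z^3 * (1 + z) / (1 - z))) ({[0], [1], [2]} \<union> h ` I)"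
    using has_sum_Un_disjoint[OF 2 1 disj] by (simp only:)
  moreover have "{[0], [1], [2]} \<union> h ` I = paths"
  proof -
    have "h ` I = {x # replicate i 0 @ [y] | x i y. x \<le> 1 \<and> y \<le> 1}"
    proof (intro equalityI subsetI)
      fix w assume "w \<in> {x # replicate i 0 @ [y] | x i y. x \<le> 1 \<and> y \<le> (1::nat)}"
      then obtain x i y where w: "w = x # replicate i 0 @ [y]" "x \<le> 1" "y \<le> 1" by blast
      then have "w = h ((x, y), i)" "((x, y), i) \<in> I" by (auto simp: h_def I_def)
      then show "w \<in> h ` I" by blast
    qed (auto simp: h_def I_def)
    then show ?thesis by (simp add: paths_def)
  qed
  moreover have "z + z^2 + z^3 + z^3 * (1 + z) / (1 - z) = z + z^2 + 2 * z^3 / (1 - z)"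
    using z by (simp add: field_simps)
  ultimately show ?thesis by simp
qed

lemma has_sum_sgl:
  fixes z :: real
  assumes "((\<lambda>(a, k, b). z ^ (a + k + b + 4)) has_sum s) S"
  shows "((\<lambda>w. z ^ wsize w) has_sum s) ((\<lambda>(a, k, b). sgl a k b) ` S)"
proof -
  have "inj_on (\<lambda>(a, k, b). sgl a k b) S"
    by (rule inj_onI) (auto dest: sgl_inj)
  moreover have "(\<lambda>w. z ^ wsize w) \<circ> (\<lambda>(a, k, b). sgl a k b) = (\<lambda>(a, k, b). z ^ (a + k + b + 4))"
    by (auto simp: fun_eq_iff wsize_sgl)
  ultimately show ?thesis
    using assms by (simp add: has_sum_reindex)
qed

lemma has_sum_dbl:
  fixes z :: real
  assumes z: "z \<ge> 0" and F: "\<And>d. finite (F d)"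
    and v: "((\<lambda>d. z ^ (2 * d + 7) * (\<Sum>(a, k, l, b)\<in>F d. z ^ (a + k + l + b))) has_sum s) UNIV"
  shows "((\<lambda>w. z ^ wsize w) has_sum s) ((\<lambda>(a, k, d, l, b). dbl a k d l b) ` {(a, k, d, l, b). (a, k, l, b) \<in> F d})"
proof -
  define h where "h = (\<lambda>(d, a, k, l, b). dbl a k d l b)"
  have "((\<lambda>(d, q). case q of (a, k, l, b) \<Rightarrow> z ^ (2 * d + 7) * z ^ (a + k + l + b)) has_sum s) (Sigma UNIV F)"
  proof (rule has_sum_Sigma_nonneg[OF _ v])
    show "((\<lambda>(a, k, l, b). z ^ (2 * d + 7) * z ^ (a + k + l + b)) has_sum
        z ^ (2 * d + 7) * (\<Sum>(a, k, l, b)\<in>F d. z ^ (a + k + l + b))) (F d)" for d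
      using has_sum_finite[of "F d" "\<lambda>(a, k, l, b). z ^ (2 * d + 7) * z ^ (a + k + l + b)", OF F]
      by (simp add: sum_distrib_left case_prod_unfold)
  qed (use z in \<open>auto split: prod.splits\<close>)
  moreover have "inj_on h (Sigma UNIV F)"
    by (rule inj_onI) (auto simp: h_def dest: dbl_inj)
  moreover have "(\<lambda>w. z ^ wsize w) \<circ> h = (\<lambda>(d, q). case q of (a, k, l, b) \<Rightarrow> z ^ (2 * d + 7) * z ^ (a + k + l + b))"
    by (auto simp: fun_eq_iff h_def wsize_dbl power_add mult_ac)
  ultimately have "((\<lambda>w. z ^ wsize w) has_sum s) (h ` Sigma UNIV F)"
    by (simp add: has_sum_reindex)
  also have "h ` Sigma UNIV F = (\<lambda>(a, k, d, l, b). dbl a k d l b) ` {(a, k, d, l, b). (a, k, l, b) \<in> F d}"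
    by (force simp: h_def)
  finally show ?thesis .
qed

lemma has_sum_words:
  fixes z :: real
  assumes z: "0 < z" "z < 1" and F: "\<And>d. finite (F d)"
    and S: "((\<lambda>(a, k, b). z ^ (a + k + b + 4)) has_sum s) S"
    and v: "((\<lambda>d. z ^ (2 * d + 7) * (\<Sum>(a, k, l, b)\<in>F d. z ^ (a + k + l + b))) has_sum t) UNIV"
  shows "((\<lambda>x. z ^ length x) has_sum (z + z^2 + 2 * z^3 / (1 - z) + s + t))
    (wp ` words S {(a, k, d, l, b). (a, k, l, b) \<in> F d})"
proof -
  let ?T = "{(a, k, d, l, b). (a, k, l, b) \<in> F d}"
  have "((\<lambda>w. z ^ wsize w) has_sum (z + z^2 + 2 * z^3 / (1 - z) + s + t)) (words S ?T)"
    unfolding words_def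
    by (intro has_sum_Un_disjoint has_sum_paths[OF z] has_sum_sgl[OF S] has_sum_dbl F v)
      (use z in \<open>auto simp: sgl_neq_dbl sgl_neq_dbl[symmetric] dest: paths_neq_sgl paths_neq_dbl\<close>)
  moreover have "inj_on wp (words S ?T)"
    by (rule inj_on_subset[OF inj_on_wp]) (auto simp: words_def paths_def sgl_def dbl_def)
  ultimately show ?thesis
    by (simp add: has_sum_reindex o_def length_wp)
qed

lemma has_sum_all_triples:
  fixes z :: real
  assumes z: "0 < z" "z < 1"
  shows "((\<lambda>(a, k, b). z ^ (a + k + b + 4)) has_sum z^4 / (1 - z)^3) UNIV"
proof -
  have 1: "((\<lambda>b. z ^ (c + b)) has_sum z ^ c / (1 - z)) UNIV" for c
    using has_sum_geometric_step[OF z, of 1 c] by simp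
  have 2: "((\<lambda>(k, b). z ^ (c + k + b)) has_sum z ^ c / (1 - z)^2) UNIV" for c
  proof -
    have "((\<lambda>(k, b). z ^ (c + k + b)) has_sum z ^ c / (1 - z)^2) (UNIV \<times> UNIV)"
    proof (rule has_sum_Sigma_nonneg[where f = "\<lambda>k b. z ^ (c + k + b)" and g = "\<lambda>k. z ^ (c + k) / (1 - z)", OF 1])
      show "((\<lambda>k. z ^ (c + k) / (1 - z)) has_sum z ^ c / (1 - z)^2) UNIV"
        using has_sum_cmult_left[OF 1, of c "1 / (1 - z)"] by (simp add: power2_eq_square)
    qed (use z in auto)
    then show ?thesis by simp
  qed
  have "((\<lambda>(a, q). case q of (k, b) \<Rightarrow> z ^ ((4 + a) + k + b)) has_sum z ^ 4 / (1 - z)^3) (UNIV \<times> UNIV)"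
  proof (rule has_sum_Sigma_nonneg[where f = "\<lambda>a q. case q of (k, b) \<Rightarrow> z ^ ((4 + a) + k + b)"
        and g = "\<lambda>a. z ^ (4 + a) / (1 - z)^2", OF 2])
    show "((\<lambda>a. z ^ (4 + a) / (1 - z)^2) has_sum z ^ 4 / (1 - z)^3) UNIV"
      using has_sum_cmult_left[OF 1, of 4 "1 / (1 - z)^2"] by (simp add: power2_eq_square power3_eq_cube mult.assoc)
  qed (use z in \<open>auto split: prod.splits\<close>)
  also have "(\<lambda>(a, q). case q of (k, b) \<Rightarrow> z ^ ((4 + a) + k + b)) = (\<lambda>(a, k, b). z ^ (a + k + b + 4))"
    by (auto simp: fun_eq_iff ac_simps)
  finally show ?thesis by simp
qed

definition S0 :: "(nat \<times> nat \<times> nat) set" where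
  "S0 = {(a, k, b). a + k \<le> 1 \<or> k + b \<le> 1}"

lemma has_sum_S0:
  fixes z :: real
  assumes z: "0 < z" "z < 1"
  shows "((\<lambda>(a, k, b). z ^ (a + k + b + 4)) has_sum (z^4 + 2 * z^5 + 2 * z^6 + z^7) / (1 - z)) S0"
proof -
  let ?f = "\<lambda>(a, k, b). z ^ (a + k + b + 4)"
  have L: "(?f has_sum z ^ (a + k + 4) / (1 - z)) (range (\<lambda>b. (a, k, b)))" for a k
  proof -
    have "?f \<circ> (\<lambda>b. (a, k, b)) = (\<lambda>b. z ^ ((a + k + 4) + 1 * b))"
      by (auto simp: fun_eq_iff ac_simps)
    then show ?thesis
      using has_sum_geometric_step[OF z, of 1 "a + k + 4"] by (simp add: has_sum_reindex inj_def)
  qed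
  have R: "(?f has_sum z ^ (k + b + c + 4) / (1 - z)) (range (\<lambda>a. (a + c, k, b)))" for k b c
  proof -
    have "?f \<circ> (\<lambda>a. (a + c, k, b)) = (\<lambda>a. z ^ ((k + b + c + 4) + 1 * a))"
      by (auto simp: fun_eq_iff ac_simps)
    then show ?thesis
      using has_sum_geometric_step[OF z, of 1 "k + b + c + 4"] by (simp add: has_sum_reindex inj_def)
  qed
  \<comment> \<open>\<open>S0\<close> is split into six disjoint rays: three with \<open>b\<close>
    free, then three with \<open>a\<close> free, which start at 2, 2 and 1 so as to skip triples
    already counted.\<close>
  have "(?f has_sum (z ^ (0 + 0 + 4) / (1 - z) + z ^ (1 + 0 + 4) / (1 - z) + z ^ (0 + 1 + 4) / (1 - z)
      + z ^ (0 + 0 + 2 + 4) / (1 - z) + z ^ (0 + 1 + 2 + 4) / (1 - z) + z ^ (1 + 0 + 1 + 4) / (1 - z)))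
     (range (\<lambda>b. (0, 0, b)) \<union> range (\<lambda>b. (1, 0, b)) \<union> range (\<lambda>b. (0, 1, b))
      \<union> range (\<lambda>a. (a + 2, 0, 0)) \<union> range (\<lambda>a. (a + 2, 0, 1)) \<union> range (\<lambda>a. (a + 1, 1, 0)))"
    by (intro has_sum_Un_disjoint L R) auto
  also have "range (\<lambda>b. (0, 0, b)) \<union> range (\<lambda>b. (1, 0, b)) \<union> range (\<lambda>b. (0, 1, b))
      \<union> range (\<lambda>a. (a + 2, 0, 0)) \<union> range (\<lambda>a. (a + 2, 0, 1)) \<union> range (\<lambda>a. (a + 1, 1, 0)) = S0"
    (is "?U = _")
  proof (intro equalityI subsetI)
    fix p assume "p \<in> S0"
    then obtain a k b where p: "p = (a, k, b)" "a + k \<le> 1 \<or> k + b \<le> 1"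
      by (auto simp: S0_def)
    consider "a = 0" "k = 0" | "a = 1" "k = 0" | "a = 0" "k = 1" | "a \<ge> 2" "k = 0" "b = 0"
      | "a \<ge> 2" "k = 0" "b = 1" | "a \<ge> 1" "k = 1" "b = 0"
      using p(2) by (cases "a = 0"; cases "a = 1"; cases "b = 0"; cases "k = 0") auto
    then show "p \<in> ?U"
    proof cases
      case 4
      then have "p = ((a - 2) + 2, 0, 0)" using p by simp
      then have "p \<in> range (\<lambda>a. (a + 2, 0, 0))" by (rule range_eqI)
      then show ?thesis by blast
    next
      case 5
      then have "p = ((a - 2) + 2, 0, 1)" using p by simp
      then have "p \<in> range (\<lambda>a. (a + 2, 0, 1))" by (rule range_eqI)
      then show ?thesis by blast
    next
      case 6
      then have "p = ((a - 1) + 1, 1, 0)" using p by simp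
      then have "p \<in> range (\<lambda>a. (a + 1, 1, 0))" by (rule range_eqI)
      then show ?thesis by blast
    qed (use p in auto)
  qed (auto simp: S0_def)
  also have "z ^ (0 + 0 + 4) / (1 - z) + z ^ (1 + 0 + 4) / (1 - z) + z ^ (0 + 1 + 4) / (1 - z)
      + z ^ (0 + 0 + 2 + 4) / (1 - z) + z ^ (0 + 1 + 2 + 4) / (1 - z) + z ^ (1 + 0 + 1 + 4) / (1 - z)
      = (z^4 + 2 * z^5 + 2 * z^6 + z^7) / (1 - z)"
    by (simp add: add_divide_distrib)
  finally show ?thesis .
qed

subsection \<open>Appending an increasing sequence raises the growth rate by one\<close>

lemma oi_map:
  assumes "\<And>x y. x \<in> set xs \<Longrightarrow> y \<in> set xs \<Longrightarrow> f x < f y \<longleftrightarrow> x < y"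
  shows "oi (map f xs) xs"
  using assms by (simp add: oi_def)

definition del :: "nat \<Rightarrow> nat list \<Rightarrow> nat list" where
  "del i xs = take i xs @ drop (Suc i) xs"

lemma subseq_del: "subseq (del i xs) xs"
proof -
  have "subseq (drop (Suc i) xs) (drop i xs)"
  proof (cases "i < length xs")
    case True
    then have "drop i xs = xs ! i # drop (Suc i) xs"
      by (rule Cons_nth_drop_Suc[symmetric])
    then show ?thesis by (metis list_emb_Cons subseq_order.refl)
  qed simp
  then have "subseq (take i xs @ drop (Suc i) xs) (take i xs @ drop i xs)"
    by (intro list_emb_append_mono) auto
  then show ?thesis by (simp add: del_def)
qed

lemma del_map: "i < length xs \<Longrightarrow> del i xs = map (\<lambda>j. xs ! (if j < i then j else Suc j)) [0..<length xs - 1]"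
  by (rule nth_equalityI) (auto simp: del_def nth_append)

lemma sorted_del:
  assumes "sorted xs"
  shows "sorted (del i xs)"
proof (cases "i < length xs")
  case True
  then show ?thesis
    using assms by (auto simp: del_map sorted_iff_nth_mono)
next
  case False
  then show ?thesis using assms by (simp add: del_def)
qed

lemma oi_del: "oi xs ys \<Longrightarrow> i < length ys \<Longrightarrow> oi (del i xs) (del i ys)"
  by (rule oiI) (auto simp: del_map oi_length oiD)

lemma rm_eq_map_del: "rm s i = map (\<lambda>x. if s ! i < x then x - 1 else x) (del i s)"
  by (simp add: rm_def del_def)

lemma oi_map_dec: "v \<notin> set xs \<Longrightarrow> oi (map (\<lambda>x. if v < x then x - 1 else x) xs) xs"
proof (rule oi_map)
  fix x y assume "v \<notin> set xs" "x \<in> set xs" "y \<in> set xs"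
  then have "x \<noteq> v" "y \<noteq> v" by auto
  then show "((if v < x then x - 1 else x) < (if v < y then y - 1 else y)) = (x < y)"
    by auto
qed

lemma oi_rm:
  assumes "distinct s" "i < length s"
  shows "oi (rm s i) (del i s)"
  using distinct_take_drop(2)[OF assms] oi_map_dec unfolding rm_eq_map_del del_def by blast

lemma oi_distinct:
  assumes "oi xs ys" "distinct xs"
  shows "distinct ys"
  unfolding distinct_conv_nth
proof (intro allI impI)
  fix i j assume ij: "i < length ys" "j < length ys" "i \<noteq> j"
  then have "xs ! i \<noteq> xs ! j"
    using assms(2) oi_length[OF assms(1)] by (simp add: nth_eq_iff_index_eq)
  then have "xs ! i < xs ! j \<or> xs ! j < xs ! i" by linarith
  then have "ys ! i < ys ! j \<or> ys ! j < ys ! i"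
    using oiD[OF assms(1)] ij by blast
  then show "ys ! i \<noteq> ys ! j" by linarith
qed

lemma perm_class_perm: "perm_class C \<Longrightarrow> s \<in> C \<Longrightarrow> is_perm s"
  by (simp only: perm_class_def)

lemma rm_in_class:
  assumes C: "perm_class C" "s \<in> C" and i: "i < length s"
  shows "rm s i \<in> C"
proof -
  have s: "is_perm s" using C by (rule perm_class_perm)
  have "subseq (del i s) s"
    by (rule subseq_del)
  moreover have o: "oi (del i s) (rm s i)"
    using s i by (intro oi_sym[OF oi_rm]) (auto simp: is_perm_def)
  ultimately have "subperm (rm s i) s"
    unfolding subperm_def using oi_length[OF o] oiD[OF o] by (intro exI[of _ "del i s"]) simp
  then show ?thesis
    using C is_perm_rm[OF s i] unfolding perm_class_def by blast
qed

definition juxt :: "nat list set \<Rightarrow> nat list set" where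
  "juxt C = {s. is_perm s \<and> (\<exists>k\<le>length s. \<exists>t\<in>C. oi t (take k s) \<and> sorted (drop k s))}"

lemma perm_class_juxt:
  assumes C: "perm_class C"
  shows "perm_class (juxt C)"
proof (rule perm_classI_rm)
  fix s i assume s: "s \<in> juxt C" and i: "i < length s"
  then obtain k t where k: "is_perm s" "k \<le> length s" "t \<in> C" "oi t (take k s)" "sorted (drop k s)"
    by (auto simp: juxt_def)
  have ds: "distinct s" using k by (simp add: is_perm_def)
  have dt: "distinct t"
    using perm_class_perm[OF C k(3)] by (simp add: is_perm_def)
  let ?f = "\<lambda>x. if s ! i < x then x - 1 else x"
  have v: "s ! i \<notin> set (del i s)"
    unfolding del_def by (rule distinct_take_drop(2)[OF ds i])
  have mono: "?f x \<le> ?f y" if "x \<le> y" for x y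
    using that by auto
  have "\<exists>k\<le>length (rm s i). \<exists>t\<in>C. oi t (take k (rm s i)) \<and> sorted (drop k (rm s i))"
  proof (cases "i < k")
    case True
    have lt: "length t = k" using oi_length[OF k(4)] k(2) by simp
    have mi: "min (k - Suc 0) i = i" "min (length s) i = i" using True i by simp_all
    have e: "take (k - 1) (del i s) = del i (take k s)" "drop (k - 1) (del i s) = drop k s"
      using True k(2) by (simp_all add: del_def drop_take mi)
    have o1: "oi (rm t i) (del i t)"
      using True dt lt by (intro oi_rm) auto
    have o2: "oi (del i t) (del i (take k s))"
      using k(2,4) True by (intro oi_del) auto
    have "s ! i \<notin> set (del i (take k s))"
      using v unfolding e(1)[symmetric] by (blast dest: in_set_takeD)
    then have o3: "oi (map ?f (del i (take k s))) (del i (take k s))"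
      by (rule oi_map_dec)
    have "oi (rm t i) (take (k - 1) (rm s i))"
      unfolding rm_eq_map_del[of s] take_map e by (rule oi_trans[OF oi_trans[OF o1 o2] oi_sym[OF o3]])
    moreover have "sorted (drop (k - 1) (rm s i))"
      unfolding rm_eq_map_del[of s] drop_map e using k(5) mono
      by (simp add: sorted_map sorted_wrt_mono_rel[of _ "(\<le>)"])
    moreover have "rm t i \<in> C"
      using rm_in_class[OF C k(3)] True lt by simp
    ultimately show ?thesis
      using i k(2) by (intro exI[of _ "k - 1"]) auto
  next
    case False
    have e: "take k (del i s) = take k s" "drop k (del i s) = del (i - k) (drop k s)"
      using False k(2) i by (simp_all add: del_def min_def drop_take)
    have "s ! i \<notin> set (take k s)"
      using v unfolding e(1)[symmetric] by (blast dest: in_set_takeD)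
    then have o1: "oi (map ?f (take k s)) (take k s)"
      by (rule oi_map_dec)
    have "oi t (take k (rm s i))"
      unfolding rm_eq_map_del[of s] take_map e by (rule oi_trans[OF k(4) oi_sym[OF o1]])
    moreover have "sorted (del (i - k) (drop k s))"
      using k(5) by (rule sorted_del)
    then have "sorted (drop k (rm s i))"
      unfolding rm_eq_map_del drop_map e using mono
      by (simp add: sorted_map sorted_wrt_mono_rel[of _ "(\<le>)"])
    ultimately show ?thesis
      using i k(2,3) False by (intro exI[of _ k]) auto
  qed
  then show "rm s i \<in> juxt C"
    using is_perm_rm[OF k(1) i] by (simp add: juxt_def)
qed (simp add: juxt_def)

text \<open>\<open>A\<close> is the set of values of the increasing suffix, and the pattern
  \<open>t\<close> is spread over the remaining values. The shift \<open>i - 1\<close> is due to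
  list positions starting at zero.\<close>

definition glue :: "nat \<Rightarrow> nat list \<Rightarrow> nat set \<Rightarrow> nat list" where
  "glue n t A = map (\<lambda>i. sorted_list_of_set ({1..n} - A) ! (i - 1)) t @ sorted_list_of_set A"

context
  fixes n :: nat and t :: "nat list" and A :: "nat set"
  assumes A: "A \<subseteq> {1..n}" and t: "is_perm t" "length t = n - card A"
begin

lemma glue_card: "finite A" "card ({1..n} - A) = length t" "card A \<le> n"
  using A t finite_subset[OF A] card_mono[OF _ A] by (auto simp: card_Diff_subset)

lemma glue_left:
  "oi (map (\<lambda>i. sorted_list_of_set ({1..n} - A) ! (i - 1)) t) t"
  "set (map (\<lambda>i. sorted_list_of_set ({1..n} - A) ! (i - 1)) t) = {1..n} - A"
proof -
  let ?B = "{1..n} - A" and ?L = "sorted_list_of_set ({1..n} - A)"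
  have len: "length ?L = length t" using glue_card by simp
  have st: "set t = {1..length t}" using t by (simp add: is_perm_def)
  show "oi (map (\<lambda>i. ?L ! (i - 1)) t) t"
  proof (rule oi_map)
    fix x y assume xy: "x \<in> set t" "y \<in> set t"
    have mono: "?L ! (a - 1) < ?L ! (b - 1)" if "a < b" "a \<in> set t" "b \<in> set t" for a b
    proof -
      have "a - 1 < b - 1" "b - 1 < length ?L" using that st len by auto
      then show ?thesis
        using sorted_list_of_set.strict_sorted_key_list_of_set[of ?B] by (simp add: sorted_wrt_iff_nth_less)
    qed
    show "(?L ! (x - 1) < ?L ! (y - 1)) = (x < y)"
      using mono[of x y] mono[of y x] xy by (cases x y rule: linorder_cases) auto
  qed
  have "(\<lambda>i. ?L ! (i - 1)) ` {1..length t} = (\<lambda>i. ?L ! i) ` {0..<length ?L}"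
  proof -
    have "(\<lambda>i. i - 1) ` {1..length t} = {0..<length ?L}"
    proof (intro equalityI subsetI)
      fix x assume "x \<in> {0..<length ?L}"
      then have "Suc x \<in> {1..length t}" "x = Suc x - 1" using len by simp_all
      then show "x \<in> (\<lambda>i. i - 1) ` {1..length t}" by blast
    qed (use len in auto)
    then have "(\<lambda>i. ?L ! i) ` (\<lambda>i. i - 1) ` {1..length t} = (\<lambda>i. ?L ! i) ` {0..<length ?L}"
      by (rule arg_cong)
    then show ?thesis by (simp only: image_image)
  qed
  also have "\<dots> = set ?L" by (auto simp: set_conv_nth)
  finally show "set (map (\<lambda>i. ?L ! (i - 1)) t) = ?B"
    using st by simp
qed

lemma glue_perm: "is_perm (glue n t A)" "length (glue n t A) = n"
proof -
  show len: "length (glue n t A) = n"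
    using glue_card t by (simp add: glue_def)
  have "distinct (map (\<lambda>i. sorted_list_of_set ({1..n} - A) ! (i - 1)) t)"
    using oi_distinct[OF oi_sym[OF glue_left(1)]] t by (simp add: is_perm_def)
  then have "distinct (glue n t A)"
    using glue_left(2) glue_card(1) unfolding glue_def distinct_append by auto
  then show "is_perm (glue n t A)"
    using glue_left(2) glue_card(1) A len unfolding is_perm_def by (auto simp: glue_def)
qed

end

lemma glue_in_juxt:
  assumes "A \<subseteq> {1..n}" "t \<in> C" "length t = n - card A" "is_perm t"
  shows "glue n t A \<in> juxt C"
proof -
  have "oi t (take (length t) (glue n t A))" "sorted (drop (length t) (glue n t A))"
    using oi_sym[OF glue_left(1)[OF assms(1,4,3)]] by (simp_all add: glue_def)
  moreover have "length t \<le> length (glue n t A)" by (simp add: glue_def)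
  ultimately show ?thesis
    using assms glue_perm[OF assms(1,4,3)] unfolding juxt_def by blast
qed

lemma juxt_eq_glue:
  assumes C: "perm_class C" and s: "s \<in> juxt C" "length s = n"
  shows "\<exists>A t. A \<subseteq> {1..n} \<and> t \<in> C \<and> length t = n - card A \<and> s = glue n t A"
proof -
  obtain k t where k: "is_perm s" "k \<le> length s" "t \<in> C" "oi t (take k s)" "sorted (drop k s)"
    using s by (auto simp: juxt_def)
  define A where "A = set (drop k s)"
  have ds: "distinct s" "set s = {1..n}" using k s by (auto simp: is_perm_def)
  have A: "A \<subseteq> {1..n}" using set_drop_subset[of k s] ds by (simp add: A_def)
  have t: "is_perm t" by (rule perm_class_perm[OF C k(3)])
  have cA: "card A = n - k"
    unfolding A_def using ds s by (simp add: distinct_card)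
  have lt: "length t = n - card A" using oi_length[OF k(4)] k(2) s(2) cA by simp
  have B: "set (take k s) = {1..n} - A"
  proof -
    have "set (take k s) \<union> A = {1..n}"
      using set_append[of "take k s" "drop k s"] ds(2) by (simp add: A_def)
    moreover have "set (take k s) \<inter> A = {}"
      using set_take_disj_set_drop_if_distinct[OF ds(1), of k k] by (simp add: A_def)
    ultimately show ?thesis by blast
  qed
  have "take k s = map (\<lambda>i. sorted_list_of_set ({1..n} - A) ! (i - 1)) t"
  proof (rule oi_same_set_eq)
    show "oi (take k s) (map (\<lambda>i. sorted_list_of_set ({1..n} - A) ! (i - 1)) t)"
      using oi_trans[OF oi_sym[OF k(4)] oi_sym[OF glue_left(1)[OF A t lt]]] .
    show "distinct (map (\<lambda>i. sorted_list_of_set ({1..n} - A) ! (i - 1)) t)"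
      using oi_distinct[OF oi_sym[OF glue_left(1)[OF A t lt]]] t by (simp add: is_perm_def)
    show "set (take k s) = set (map (\<lambda>i. sorted_list_of_set ({1..n} - A) ! (i - 1)) t)"
      using B glue_left(2)[OF A t lt] by simp
  qed (use ds in simp)
  moreover have "drop k s = sorted_list_of_set A"
    using sorted_list_of_set.idem_if_sorted_distinct[of "drop k s"] k(5) ds(1) by (simp add: A_def)
  ultimately have "s = glue n t A"
    using append_take_drop_id[of k s] unfolding glue_def by simp
  then show ?thesis using A k(3) lt by blast
qed

lemma card_juxt_upper:
  assumes C: "perm_class C"
  shows "cnt (juxt C) n \<le> (\<Sum>m\<le>n. real (n choose m) * cnt C (n - m))"
proof -
  define B where "B = (\<lambda>k. {t \<in> C. length t = k})"
  have fin: "finite (B k)" for k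
    unfolding B_def by (rule finite_perms_length) (rule perm_class_perm[OF C])
  define P where "P = (\<lambda>m. {A. A \<subseteq> {1..n} \<and> card A = m})"
  have finP: "finite (P m)" for m unfolding P_def by (rule finite_subset[of _ "Pow {1..n}"]) auto
  have "{s \<in> juxt C. length s = n} \<subseteq> (\<Union>m\<le>n. (\<lambda>(A, t). glue n t A) ` (P m \<times> B (n - m)))"
  proof
    fix s assume "s \<in> {s \<in> juxt C. length s = n}"
    then obtain A t where "A \<subseteq> {1..n}" "t \<in> C" "length t = n - card A" "s = glue n t A"
      using juxt_eq_glue[OF C, of s n] by auto
    moreover from this have "card A \<le> n" using card_mono[of "{1..n}" A] by simp
    ultimately have "(A, t) \<in> P (card A) \<times> B (n - card A)" "s = (\<lambda>(A, t). glue n t A) (A, t)" "card A \<in> {..n}"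
      using \<open>length t = n - card A\<close> by (auto simp: P_def B_def)
    then show "s \<in> (\<Union>m\<le>n. (\<lambda>(A, t). glue n t A) ` (P m \<times> B (n - m)))" by blast
  qed
  then have "card {s \<in> juxt C. length s = n} \<le> card (\<Union>m\<le>n. (\<lambda>(A, t). glue n t A) ` (P m \<times> B (n - m)))"
    using fin finP by (intro card_mono) auto
  also have "\<dots> \<le> (\<Sum>m\<le>n. card ((\<lambda>(A, t). glue n t A) ` (P m \<times> B (n - m))))"
    by (rule card_UN_le) simp
  also have "\<dots> \<le> (\<Sum>m\<le>n. card (P m \<times> B (n - m)))"
    using fin finP by (intro sum_mono card_image_le) auto
  also have "\<dots> = (\<Sum>m\<le>n. (n choose m) * card (B (n - m)))"
    by (simp add: card_cartesian_product P_def n_subsets)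
  finally have "real (card {s \<in> juxt C. length s = n}) \<le> real (\<Sum>m\<le>n. (n choose m) * card (B (n - m)))"
    by (simp only: of_nat_le_iff)
  then show ?thesis by (simp add: cnt_def B_def)
qed

text \<open>For a fixed cut, \<open>A\<close> can be read off the suffix and \<open>t\<close> off
  the pattern of the prefix. Different cuts may give the same permutation, so only one term of the
  binomial sum is bounded at a time.\<close>

lemma card_juxt_lower:
  assumes C: "perm_class C" and m: "m \<le> n"
  shows "real (n choose m) * cnt C (n - m) \<le> cnt (juxt C) n"
proof -
  define B where "B = {t \<in> C. length t = n - m}"
  define P where "P = {A. A \<subseteq> {1..n} \<and> card A = m}"
  have perm: "is_perm t" if "t \<in> C" for t using C that by (rule perm_class_perm)
  have "inj_on (\<lambda>(A, t). glue n t A) (P \<times> B)"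
  proof (rule inj_onI)
    fix p q assume p: "p \<in> P \<times> B" and q: "q \<in> P \<times> B"
      and e: "(\<lambda>(A, t). glue n t A) p = (\<lambda>(A, t). glue n t A) q"
    obtain A t A' t' where pq: "p = (A, t)" "q = (A', t')" by (metis surj_pair)
    have A: "A \<subseteq> {1..n}" "A' \<subseteq> {1..n}" "card A = m" "card A' = m" and t: "is_perm t" "is_perm t'"
      "length t = n - card A" "length t' = n - card A'"
      using p q perm by (auto simp: pq P_def B_def)
    have e': "glue n t A = glue n t' A'" using e by (simp add: pq)
    have "length t = length t'" using t A by simp
    then have e1: "map (\<lambda>i. sorted_list_of_set ({1..n} - A) ! (i - 1)) t = map (\<lambda>i. sorted_list_of_set ({1..n} - A') ! (i - 1)) t'"
      and e2: "sorted_list_of_set A = sorted_list_of_set A'"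
      using e' unfolding glue_def by simp_all
    have fA: "finite A" "finite A'" using A finite_subset by blast+
    have "A = A'" using arg_cong[OF e2, of set] fA by simp
    moreover have "t = t'"
    proof (rule oi_perm_eq[OF _ t(1,2)])
      show "oi t t'"
        using oi_trans[OF oi_sym[OF glue_left(1)[OF A(1) t(1,3)]], of t'] glue_left(1)[OF A(2) t(2,4)] e1 by simp
    qed
    ultimately show "p = q" by (simp add: pq)
  qed
  moreover have "(\<lambda>(A, t). glue n t A) ` (P \<times> B) \<subseteq> {s \<in> juxt C. length s = n}"
  proof (clarify, intro conjI)
    fix A t assume "A \<in> P" "t \<in> B"
    then have *: "A \<subseteq> {1..n}" "t \<in> C" "length t = n - card A" "is_perm t"
      using perm by (auto simp: P_def B_def)
    show "glue n t A \<in> juxt C" by (rule glue_in_juxt[OF *])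
    show "length (glue n t A) = n" by (rule glue_perm[OF *(1,4,3)])
  qed
  moreover have "finite {s \<in> juxt C. length s = n}"
    by (rule finite_perms_length) (auto simp: juxt_def)
  ultimately have "card (P \<times> B) \<le> card {s \<in> juxt C. length s = n}"
    by (rule card_inj_on_le)
  then have "(n choose m) * card B \<le> card {s \<in> juxt C. length s = n}"
    by (simp add: card_cartesian_product P_def n_subsets)
  then have "real ((n choose m) * card B) \<le> real (card {s \<in> juxt C. length s = n})"
    by (simp only: of_nat_le_iff)
  then show ?thesis by (simp add: cnt_def B_def)
qed

text \<open>The count lies between \<open>F n / (n + 1)\<close> and \<open>F n\<close>, and by the
  binomial theorem the convolution \<open>F\<close> replaces a base \<open>b\<close> by
  \<open>b + 1\<close>.\<close>

lemma growth_bounds_juxt: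
  assumes C: "perm_class C" and g: "g > 0" and f: "growth_bounds (cnt C) g"
  shows "growth_bounds (cnt (juxt C)) (g + 1)"
proof -
  define F where "F = (\<lambda>n. \<Sum>m\<le>n. real (n choose m) * cnt C (n - m))"
  have bin: "(\<Sum>m\<le>n. real (n choose m) * b ^ (n - m)) = (b + 1) ^ n" for b :: real and n
    using binomial_ring[of 1 b n] by (simp add: add.commute)
  have low: "F n \<le> (real n + 1) * cnt (juxt C) n" for n
  proof -
    have "F n \<le> (\<Sum>m\<le>n. cnt (juxt C) n)"
      unfolding F_def using card_juxt_lower[OF C] by (intro sum_mono) auto
    then show ?thesis by (simp add: algebra_simps)
  qed
  have 1: "\<exists>K>0. \<forall>n. K * b ^ n \<le> cnt (juxt C) n" if b: "0 < b" "b < g + 1" for b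
  proof -
    \<comment> \<open>The room between \<open>b\<close> and \<open>b'\<close> absorbs the factor
      \<open>n + 1\<close>; the maximum keeps \<open>b' - 1\<close> positive.\<close>
    define b' where "b' = (max b 1 + (g + 1)) / 2"
    have b': "b < b'" "1 < b'" "b' < g + 1" using b g by (auto simp: b'_def)
    then obtain K where K: "K > 0" "\<And>n. K * (b' - 1) ^ n \<le> cnt C n"
      using f[unfolded growth_bounds_def, THEN conjunct1, rule_format, of "b' - 1"] by auto
    \<comment> \<open>Chosen so that \<open>c * (n + 1)\<close> is at most the linear term in the
      Bernoulli inequality for \<open>(b' / b) ^ n\<close>.\<close>
    define c where "c = min 1 (b' / b - 1)"
    have c: "c > 0" using b b' by (simp add: c_def)
    have "K * c * b ^ n \<le> cnt (juxt C) n" for n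
    proof -
      have "c * (real n + 1) \<le> 1 + real n * (b' / b - 1)"
      proof -
        have "c \<le> 1" "c \<le> b' / b - 1" by (simp_all add: c_def)
        moreover from this(2) have "real n * c \<le> real n * (b' / b - 1)"
          by (rule mult_left_mono) simp
        moreover have "c * (real n + 1) = real n * c + c"
          by (simp add: algebra_simps)
        ultimately show ?thesis by linarith
      qed
      also have "\<dots> \<le> (1 + (b' / b - 1)) ^ n"
        using b b' by (intro Bernoulli_inequality) simp
      also have "\<dots> = b' ^ n / b ^ n" by (simp add: power_divide)
      finally have 1: "c * (real n + 1) * b ^ n \<le> b' ^ n"
        using b by (simp add: field_simps)
      have "K * b' ^ n = (\<Sum>m\<le>n. real (n choose m) * (K * (b' - 1) ^ (n - m)))"
      proof -
        have "b' ^ n = (\<Sum>m\<le>n. real (n choose m) * (b' - 1) ^ (n - m))"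
          using bin[of n "b' - 1"] by simp
        then show ?thesis
          by (simp only: sum_distrib_left) (simp add: mult_ac)
      qed
      also have "\<dots> \<le> F n"
        unfolding F_def using K by (intro sum_mono mult_left_mono) auto
      finally have 2: "K * b' ^ n \<le> (real n + 1) * cnt (juxt C) n"
        using low[of n] by linarith
      have "(real n + 1) * (K * c * b ^ n) \<le> K * b' ^ n"
        using mult_left_mono[OF 1, of K] K(1) by (simp add: mult_ac)
      then have "(real n + 1) * (K * c * b ^ n) \<le> (real n + 1) * cnt (juxt C) n"
        using 2 by linarith
      then show ?thesis by (simp add: mult_le_cancel_left_pos)
    qed
    then show ?thesis using K c by (intro exI[of _ "K * c"]) auto
  qed
  have 2: "\<exists>K>0. \<forall>n. cnt (juxt C) n \<le> K * b ^ n" if b: "g + 1 < b" for b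
  proof -
    have "g < b - 1" using b by simp
    then obtain K where K: "K > 0" "\<And>n. cnt C n \<le> K * (b - 1) ^ n"
      using f[unfolded growth_bounds_def, THEN conjunct2, rule_format, of "b - 1"] by auto
    have "cnt (juxt C) n \<le> K * b ^ n" for n
    proof -
      have "cnt (juxt C) n \<le> F n" unfolding F_def by (rule card_juxt_upper[OF C])
      also have "\<dots> \<le> (\<Sum>m\<le>n. real (n choose m) * (K * (b - 1) ^ (n - m)))"
        unfolding F_def using K by (intro sum_mono mult_left_mono) auto
      also have "\<dots> = K * b ^ n"
      proof -
        have "b ^ n = (\<Sum>m\<le>n. real (n choose m) * (b - 1) ^ (n - m))"
          using bin[of n "b - 1"] by simp
        then show ?thesis
          by (simp only: sum_distrib_left) (simp add: mult_ac)
      qed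
      finally show ?thesis .
    qed
    then show ?thesis using K by blast
  qed
  show ?thesis
    using 1 2 unfolding growth_bounds_def by blast
qed

subsection \<open>Representing real numbers by digits and chains\<close>

text \<open>\<open>lo\<close> and \<open>hi\<close> are the sums with constant digit 0 or
  \<open>p\<close>. The images of their interval under \<open>s \<mapsto> v m + q * s\<close> start
  at \<open>lo\<close> for \<open>m = 0\<close>, end at \<open>hi\<close> for \<open>m = p\<close>,
  and each starts no later than the previous one ends because of the bound on \<open>g\<close>. So
  they cover the interval, and digits can be chosen one after another.\<close>

lemma digit_expansion:
  fixes v :: "nat \<Rightarrow> real"
  assumes q: "0 < q" "q < 1"
    and v: "\<And>m. m < p \<Longrightarrow> v (Suc m) - v m \<le> g"
    and g: "g \<le> q * (v p / (1 - q) - v 0 / (1 - q))"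
    and r: "v 0 / (1 - q) \<le> r" "r \<le> v p / (1 - q)"
  shows "\<exists>m. (\<forall>d. m d \<le> p) \<and> (\<lambda>d. q ^ d * v (m d)) sums r"
proof -
  define lo hi where "lo = v 0 / (1 - q)" and "hi = v p / (1 - q)"
  have lo: "v 0 + q * lo = lo" and hi: "v p + q * hi = hi"
    using q by (simp_all add: lo_def hi_def field_simps)
  have step: "\<exists>m\<le>p. lo \<le> (s - v m) / q \<and> (s - v m) / q \<le> hi" if s: "lo \<le> s" "s \<le> hi" for s
  proof -
    \<comment> \<open>The last image starting at or below \<open>s\<close>; as the next one starts
      beyond \<open>s\<close>, the gap bound puts \<open>s\<close> below the end of this
      one.\<close>
    define m where "m = (GREATEST m. m \<le> p \<and> v m + q * lo \<le> s)"
    have m: "m \<le> p" "v m + q * lo \<le> s"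
      using GreatestI_nat[of "\<lambda>m. m \<le> p \<and> v m + q * lo \<le> s" 0 p] lo s by (auto simp: m_def)
    have "s \<le> v m + q * hi"
    proof (cases "m = p")
      case True
      then show ?thesis using hi s by simp
    next
      case False
      then have "m < p" using m by simp
      have "\<not> v (Suc m) + q * lo \<le> s"
        using Greatest_le_nat[of "\<lambda>m. m \<le> p \<and> v m + q * lo \<le> s" "Suc m" p] \<open>m < p\<close>
        by (auto simp: m_def)
      then show ?thesis
        using v[OF \<open>m < p\<close>] g by (simp add: lo_def hi_def algebra_simps)
    qed
    then show ?thesis
      using m q by (intro exI[of _ m]) (auto simp: field_simps)
  qed
  define f where "f = (\<lambda>s. SOME m. m \<le> p \<and> lo \<le> (s - v m) / q \<and> (s - v m) / q \<le> hi)"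
  have f: "f s \<le> p" "lo \<le> (s - v (f s)) / q" "(s - v (f s)) / q \<le> hi" if "lo \<le> s" "s \<le> hi" for s
    using someI_ex[OF step[OF that]] by (auto simp: f_def)
  define s where "s = rec_nat r (\<lambda>_ s. (s - v (f s)) / q)"
  have s0: "s 0 = r" and s_Suc: "s (Suc d) = (s d - v (f (s d))) / q" for d
    by (simp_all add: s_def)
  have s: "lo \<le> s d" "s d \<le> hi" for d
  proof (induction d)
    case 0
    show "lo \<le> s 0" "s 0 \<le> hi" using r by (simp_all add: s0 lo_def hi_def)
  next
    case (Suc d)
    then show "lo \<le> s (Suc d)" "s (Suc d) \<le> hi" using f by (simp_all add: s_Suc)
  qed
  have part: "(\<Sum>d<n. q ^ d * v (f (s d))) = r - q ^ n * s n" for n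
  proof (induction n)
    case (Suc n)
    have "q ^ Suc n * s (Suc n) = q ^ n * (s n - v (f (s n)))"
      using q by (simp add: s_Suc)
    then show ?case
      by (simp only: sum.lessThan_Suc Suc) (simp add: algebra_simps)
  qed (simp add: s0)
  have "(\<lambda>n. q ^ n * s n) \<longlonglongrightarrow> 0"
  proof (rule Lim_null_comparison)
    show "eventually (\<lambda>n. norm (q ^ n * s n) \<le> q ^ n * max \<bar>lo\<bar> \<bar>hi\<bar>) sequentially"
    proof (intro always_eventually allI)
      fix n
      have "\<bar>s n\<bar> \<le> max \<bar>lo\<bar> \<bar>hi\<bar>" using s[of n] by linarith
      then show "norm (q ^ n * s n) \<le> q ^ n * max \<bar>lo\<bar> \<bar>hi\<bar>"
        using q by (simp add: abs_mult)
    qed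
    show "(\<lambda>n. q ^ n * max \<bar>lo\<bar> \<bar>hi\<bar>) \<longlonglongrightarrow> 0"
      using q by (intro tendsto_mult_left_zero LIMSEQ_power_zero) simp
  qed
  then have "(\<lambda>n. r - q ^ n * s n) \<longlonglongrightarrow> r"
    by (auto intro: tendsto_eq_intros)
  then have "(\<lambda>d. q ^ d * v (f (s d))) sums r"
    by (simp add: sums_def part)
  then show ?thesis
    using f(1)[OF s] by (intro exI[of _ "\<lambda>d. f (s d)"]) simp
qed

text \<open>Weights are subtracted in the given order until the remainder is at most
  \<open>lo + h\<close>. A weight of at most \<open>h\<close>, subtracted from something above
  \<open>lo + h\<close>, cannot lead below \<open>lo\<close>.\<close>

lemma chain_prefix:
  fixes R :: real
  assumes "\<And>w. w \<in> set ws \<Longrightarrow> w \<le> h" "lo \<le> R" "R \<le> lo + h + sum_list ws"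
  shows "\<exists>n\<le>length ws. lo \<le> R - sum_list (take n ws) \<and> R - sum_list (take n ws) \<le> lo + h"
  using assms
proof (induction ws arbitrary: R)
  case (Cons w ws)
  show ?case
  proof (cases "R \<le> lo + h")
    case True
    then show ?thesis using Cons.prems by (intro exI[of _ 0]) simp
  next
    case False
    have "\<exists>n\<le>length ws. lo \<le> (R - w) - sum_list (take n ws) \<and> (R - w) - sum_list (take n ws) \<le> lo + h"
    proof (rule Cons.IH)
      show "lo \<le> R - w" using Cons.prems(1)[of w] False by simp
      show "R - w \<le> lo + h + sum_list ws" using Cons.prems(3) by simp
    qed (use Cons.prems(1) in simp)
    then obtain n where "n \<le> length ws"
      "lo \<le> (R - w) - sum_list (take n ws) \<and> (R - w) - sum_list (take n ws) \<le> lo + h" by blast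
    then show ?thesis
      by (intro exI[of _ "Suc n"]) (simp add: algebra_simps)
  qed
qed simp

subsection \<open>Assembling a class\<close>

definition good :: "real \<Rightarrow> bool" where
  "good g \<longleftrightarrow> (\<exists>C. perm_class C \<and> growth_bounds (cnt C) g)"

text \<open>\<open>E\<close> is a finite set of further indecomposables that is closed under deletion relative to the paths and the
  one-centre words with parameters in \<open>S\<close>.\<close>

definition okE :: "(nat \<times> nat \<times> nat) set \<Rightarrow> nat list set \<Rightarrow> bool" where
  "okE S E \<longleftrightarrow> finite E \<and> (\<forall>x\<in>E. indec x \<and> x \<notin> wp ` {w. w \<noteq> []} \<and>
     (\<forall>i<length x. rm x i \<in> sumcl (wp ` words S {} \<union> E)))"

definition level :: "nat \<times> nat \<times> nat \<times> nat \<Rightarrow> nat" where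
  "level = (\<lambda>(a, k, l, b). a + k + l + b)"

text \<open>Every prefix of \<open>Q\<close> is downward closed, so the length of a prefix can serve
  as a digit; the first clause places in \<open>S\<close> what the two-centre words need
  there.\<close>

definition prefix_closed :: "(nat \<times> nat \<times> nat) set \<Rightarrow> (nat \<times> nat \<times> nat \<times> nat) list \<Rightarrow> bool" where
  "prefix_closed S Q \<longleftrightarrow> distinct Q \<and>
     (\<forall>i<length Q. \<forall>a k l b. Q ! i = (a, k, l, b) \<longrightarrow>
        (\<forall>c. (a, k, c) \<in> S \<and> (c, l, b) \<in> S) \<and>
        (\<forall>a'\<le>a. \<forall>k'\<le>k. \<forall>l'\<le>l. \<forall>b'\<le>b. (a', k', l', b') \<in> set (take (Suc i) Q)))"

definition qsum :: "real \<Rightarrow> (nat \<times> nat \<times> nat \<times> nat) list \<Rightarrow> real" where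
  "qsum z Q = sum_list (map (\<lambda>q. z ^ level q) Q)"

definition esum :: "real \<Rightarrow> nat list set \<Rightarrow> real" where
  "esum z E = (\<Sum>x\<in>E. z ^ length x)"

definition down3 :: "(nat \<times> nat \<times> nat) set \<Rightarrow> bool" where
  "down3 S \<longleftrightarrow> (\<forall>a k b a' k' b'. (a, k, b) \<in> S \<and> a' \<le> a \<and> k' \<le> k \<and> b' \<le> b \<longrightarrow> (a', k', b') \<in> S)"

lemma prefix_closed_down_closed:
  assumes S: "down3 S" and Q: "prefix_closed S Q"
    and F: "\<And>d. \<exists>n. F d = set (take n Q)"
  shows "down_closed S {(a, k, d, l, b). (a, k, l, b) \<in> F d}"
  unfolding down_closed_def
proof (intro conjI allI impI; (elim conjE)?)
  fix a k d l b a' k' l' b' c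
  assume "(a, k, d, l, b) \<in> {(a, k, d, l, b). (a, k, l, b) \<in> F d}"
  then have m: "(a, k, l, b) \<in> F d" by simp
  obtain n where n: "F d = set (take n Q)" using F by blast
  then obtain i where i: "i < length Q" "i < n" "Q ! i = (a, k, l, b)"
    using m by (auto simp: in_set_conv_nth)
  show "(a, k, c) \<in> S" "(c, l, b) \<in> S"
    using Q i unfolding prefix_closed_def by blast+
  assume "a' \<le> a" "k' \<le> k" "l' \<le> l" "b' \<le> b"
  then have "(a', k', l', b') \<in> set (take (Suc i) Q)"
    using Q i unfolding prefix_closed_def by blast
  moreover have "set (take (Suc i) Q) \<subseteq> set (take n Q)"
    using i by (intro set_take_subset_set_take) simp
  ultimately show "(a', k', d, l', b') \<in> {(a, k, d, l, b). (a, k, l, b) \<in> F d}"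
    using n by auto
qed (use S in \<open>auto simp: down3_def\<close>)

text \<open>\<open>s\<close>, \<open>esum z E\<close> and \<open>R\<close> are the shares of the
  one-centre words, the extras and the two-centre words. The latter are used only from distance
  \<open>dd\<close> on, where the first \<open>c\<close> quadruples of \<open>Q\<close> are always
  present and the digit counts the further ones. The bound on \<open>g\<close> is the gap condition
  of \<open>digit_expansion\<close> in base \<open>z^2\<close>.\<close>

lemma good_assemble:
  fixes z :: real
  assumes z: "0 < z" "z < 1" and S: "down3 S" and Q: "prefix_closed S Q" and E: "okE S E"
    and s: "((\<lambda>(a, k, b). z ^ (a + k + b + 4)) has_sum s) S"
    and c: "c \<le> length Q" and lev: "\<And>n. c \<le> n \<Longrightarrow> n < length Q \<Longrightarrow> z ^ level (Q ! n) \<le> g"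
    and g: "g * (1 - z^2) \<le> z^2 * (qsum z Q - qsum z (take c Q))"
    and R: "z ^ (2 * dd + 7) * qsum z (take c Q) / (1 - z^2) \<le> R" "R \<le> z ^ (2 * dd + 7) * qsum z Q / (1 - z^2)"
    and tot: "z + z^2 + 2 * z^3 / (1 - z) + s + esum z E + R = 1"
  shows "good (1 / z)"
proof -
  define q where "q = z^2"
  have q: "0 < q" "q < 1" using z by (auto simp: q_def power_less_one_iff)
  define v where "v = (\<lambda>m. qsum z (take (c + m) Q))"
  define p where "p = length Q - c"
  have "\<exists>m. (\<forall>d. m d \<le> p) \<and> (\<lambda>d. q ^ d * v (m d)) sums (R / z ^ (2 * dd + 7))"
  proof (rule digit_expansion[OF q])
    show "v (Suc m) - v m \<le> g" if "m < p" for m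
      using that lev[of "c + m"] by (simp add: v_def p_def qsum_def take_Suc_conv_app_nth)
    show "g \<le> q * (v p / (1 - q) - v 0 / (1 - q))"
      using g q c by (simp add: v_def p_def q_def[symmetric] diff_divide_distrib[symmetric] pos_le_divide_eq)
    show "v 0 / (1 - q) \<le> R / z ^ (2 * dd + 7)" "R / z ^ (2 * dd + 7) \<le> v p / (1 - q)"
      using R z c by (simp_all add: v_def p_def q_def field_simps)
  qed
  then obtain m where m: "\<And>d. m d \<le> p" "(\<lambda>d. q ^ d * v (m d)) sums (R / z ^ (2 * dd + 7))"
    by blast
  define F where "F = (\<lambda>d. if d < dd then {} else set (take (c + m (d - dd)) Q))"
  have fin: "finite (F d)" for d by (simp add: F_def)
  have Fsum: "(\<Sum>(a, k, l, b)\<in>F d. z ^ (a + k + l + b)) = (if d < dd then 0 else v (m (d - dd)))" for d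
  proof -
    have "(\<Sum>(a, k, l, b)\<in>set (take n Q). z ^ (a + k + l + b)) = qsum z (take n Q)" for n
      using Q unfolding prefix_closed_def
      by (simp add: qsum_def level_def sum_list_distinct_conv_sum_set case_prod_unfold)
    then show ?thesis by (simp add: F_def v_def)
  qed
  have v0: "v n \<ge> 0" for n
    using z by (auto simp: v_def qsum_def intro!: sum_list_nonneg)
  have "(\<lambda>d. z ^ (2 * dd + 7) * (q ^ d * v (m d))) sums R"
    using sums_mult[OF m(2), of "z ^ (2 * dd + 7)"] z by simp
  moreover have "z ^ (2 * dd + 7) * (q ^ d * v (m d)) = z ^ (2 * (d + dd) + 7) * (if d + dd < dd then 0 else v (m (d + dd - dd)))" for d
    by (simp add: q_def power_add power_mult[symmetric] mult_ac)
  ultimately have "(\<lambda>d. z ^ (2 * (d + dd) + 7) * (if d + dd < dd then 0 else v (m (d + dd - dd)))) sums R"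
    by simp
  then have "(\<lambda>d. z ^ (2 * d + 7) * (if d < dd then 0 else v (m (d - dd)))) sums
      (R + (\<Sum>d<dd. z ^ (2 * d + 7) * (if d < dd then 0 else v (m (d - dd)))))"
    by (rule sums_iff_shift[of "\<lambda>d. z ^ (2 * d + 7) * (if d < dd then 0 else v (m (d - dd)))" dd R, THEN iffD1])
  then have "(\<lambda>d. z ^ (2 * d + 7) * (if d < dd then 0 else v (m (d - dd)))) sums R"
    by simp
  then have Fs: "((\<lambda>d. z ^ (2 * d + 7) * (\<Sum>(a, k, l, b)\<in>F d. z ^ (a + k + l + b))) has_sum R) UNIV"
    unfolding Fsum using z v0 by (intro sums_nonneg_imp_has_sum) auto
  let ?T = "{(a, k, d, l, b). (a, k, l, b) \<in> F d}"
  have dc: "down_closed S ?T"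
  proof (rule prefix_closed_down_closed[OF S Q])
    show "\<exists>n. F d = set (take n Q)" for d
      by (cases "d < dd") (auto simp: F_def intro: exI[of _ 0])
  qed
  define D where "D = wp ` words S ?T \<union> E"
  have ne: "words S ?T \<subseteq> {w. w \<noteq> []}"
    by (auto simp: words_def paths_def sgl_def dbl_def)
  have indec: "indec x" if "x \<in> D" for x
    using that E ne indec_wp by (auto simp: D_def okE_def)
  have "((\<lambda>x. z ^ length x) has_sum (z + z^2 + 2 * z^3 / (1 - z) + s + R)) (wp ` words S ?T)"
    by (rule has_sum_words[OF z fin s Fs])
  moreover have "((\<lambda>x. z ^ length x) has_sum esum z E) E"
    using E by (simp add: okE_def esum_def has_sum_finite)
  moreover have "wp ` words S ?T \<inter> E = {}"
    using E ne unfolding okE_def by blast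
  ultimately have "((\<lambda>x. z ^ length x) has_sum (z + z^2 + 2 * z^3 / (1 - z) + s + R + esum z E)) D"
    unfolding D_def by (intro has_sum_Un_disjoint)
  then have hs: "((\<lambda>x. z ^ length x) has_sum 1) D"
    using tot by (simp add: algebra_simps)
  have "[0] \<in> words S ?T" by (simp add: words_def paths_def)
  then have one: "[1] \<in> D"
    by (force simp: D_def stem_def intro!: image_eqI[of _ _ "[0]"])
  have "perm_class (sumcl D)"
  proof (rule perm_class_sumcl)
    show "is_perm x" if "x \<in> D" for x using indec[OF that] by (simp add: indec_def)
    show "rm x i \<in> sumcl D" if x: "x \<in> D" and i: "i < length x" for x i
    proof (cases "x \<in> E")
      case True
      then have "rm x i \<in> sumcl (wp ` words S {} \<union> E)"
        using E i by (auto simp: okE_def)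
      moreover have "words S {} \<subseteq> words S ?T"
        unfolding words_def by blast
      then have "wp ` words S {} \<union> E \<subseteq> D"
        unfolding D_def by blast
      ultimately show ?thesis using sumcl_mono by blast
    next
      case False
      then obtain w where w: "w \<in> words S ?T" "x = wp w" using x unfolding D_def by blast
      then have "rm x i \<in> sumcl (wp ` words S ?T)"
        using rm_wp_in_sumcl[OF word_closed_words[OF dc]] i by simp
      moreover have "wp ` words S ?T \<subseteq> D" by (simp add: D_def)
      ultimately show ?thesis using sumcl_mono by blast
    qed
  qed
  moreover have "growth_bounds (cnt (sumcl D)) (1 / z)"
    by (rule growth_bounds_sumcl[OF indec one z(1) hs])
  ultimately show ?thesis unfolding good_def by blast
qed

subsection \<open>Explicit data\<close>

text \<open>For a permutation this is the length of the first indecomposable component, in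
  executable form.\<close>

definition cut :: "nat list \<Rightarrow> nat" where
  "cut s = hd (filter (\<lambda>k. list_all (\<lambda>x. x \<le> k) (take k s)) [1..<Suc (length s)])"

text \<open>The first argument is fuel; the length of the list suffices, since every component takes
  at least one entry.\<close>

fun comps :: "nat \<Rightarrow> nat list \<Rightarrow> nat list list" where
  "comps 0 s = []"
| "comps (Suc n) s = (if s = [] then [] else
     take (cut s) s # comps n (map (\<lambda>x. x - cut s) (drop (cut s) s)))"

lemma sumcl_comps:
  assumes "is_perm s" "length s \<le> n" "set (comps n s) \<subseteq> D"
  shows "s \<in> sumcl D"
  using assms
proof (induction n arbitrary: s)
  case 0
  then show ?case by (simp add: sumcl.Nil)
next
  case (Suc n)
  show ?case
  proof (cases "s = []")
    case True
    then show ?thesis by (simp add: sumcl.Nil)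
  next
    case False
    let ?P = "\<lambda>k. list_all (\<lambda>x. x \<le> k) (take k s)"
    define k where "k = cut s"
    have "length s \<in> set (filter ?P [1..<Suc (length s)])"
      using False Suc.prems(1) by (auto simp: is_perm_def list_all_iff Suc_le_eq)
    then have "k \<in> set (filter ?P [1..<Suc (length s)])"
      unfolding k_def cut_def by (intro hd_in_set) force
    then have k: "1 \<le> k" "k \<le> length s" "?P k" by auto
    have "is_perm (take k s)"
    proof (rule is_permI_subset)
      show "distinct (take k s)" using Suc.prems(1) by (simp add: is_perm_def)
      have "set (take k s) \<subseteq> {1..length s}"
        using Suc.prems(1) set_take_subset[of k s] by (simp add: is_perm_def)
      then show "set (take k s) \<subseteq> {1..length (take k s)}"
        using k by (auto simp: list_all_iff)
    qed
    then obtain t where t: "is_perm t" "s = dsum (take k s) t"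
      using is_perm_take_dsum[OF Suc.prems(1) k(2)] by blast
    have "drop k s = map (\<lambda>v. v + k) t"
      using arg_cong[OF t(2), of "drop k"] k(2) by (simp add: dsum_def)
    then have t': "map (\<lambda>x. x - k) (drop k s) = t"
      by (simp add: o_def)
    have "length t \<le> n"
      using arg_cong[OF t', of length] k Suc.prems(2) by simp
    then have "t \<in> sumcl D"
      using Suc.IH[OF t(1)] Suc.prems(3) False t' by (simp add: k_def)
    moreover have "take k s \<in> D"
      using Suc.prems(3) False by (simp add: k_def)
    ultimately show ?thesis
      using sumcl.Cons t(2) by metis
  qed
qed

definition chk_indec :: "nat list \<Rightarrow> bool" where
  "chk_indec x \<longleftrightarrow> distinct x \<and> x \<noteq> [] \<and> list_all (\<lambda>y. 1 \<le> y \<and> y \<le> length x) x \<and>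
     list_all (\<lambda>k. list_ex (\<lambda>y. k < y) (take k x)) [1..<length x]"

lemma chk_indec: "chk_indec x \<Longrightarrow> indec x"
  unfolding chk_indec_def indec_def
proof (intro conjI allI impI)
  assume *: "distinct x \<and> x \<noteq> [] \<and> list_all (\<lambda>y. 1 \<le> y \<and> y \<le> length x) x \<and>
     list_all (\<lambda>k. list_ex (\<lambda>y. k < y) (take k x)) [1..<length x]"
  show "is_perm x" by (rule is_permI_subset) (use * in \<open>auto simp: list_all_iff\<close>)
  show "x \<noteq> []" using * by simp
  fix k assume k: "0 < k \<and> k < length x"
  then have "k \<in> set [1..<length x]" by simp
  then have "list_ex (\<lambda>y. k < y) (take k x)"
    using * unfolding list_all_iff by blast
  then obtain y where "y \<in> set (take k x)" "k < y"
    unfolding list_ex_iff by blast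
  then show "\<not> is_perm (take k x)"
    using k by (auto simp: is_perm_def)
qed

text \<open>An executable certificate that any prefix of \<open>X\<close> may be adjoined to a sum
  closure containing \<open>K\<close>: components of deletions lie in \<open>K\<close> or come
  earlier in \<open>X\<close>.\<close>

definition chk_chain :: "nat list list \<Rightarrow> nat list list \<Rightarrow> bool" where
  "chk_chain K X \<longleftrightarrow> distinct X \<and> list_all (\<lambda>x. chk_indec x \<and> wp (decode x) \<noteq> x) X \<and>
     list_all (\<lambda>i. list_all (\<lambda>j. list_all (\<lambda>y. y \<in> set (K @ take i X)) (comps (length (X ! i)) (rm (X ! i) j)))
       [0..<length (X ! i)]) [0..<length X]"

lemma not_word: "wp (decode x) \<noteq> x \<Longrightarrow> x \<notin> wp ` {w. w \<noteq> []}"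
  using decode_wp by auto

lemma chk_chain:
  assumes "chk_chain K X" "i < length X"
  shows "indec (X ! i)" "X ! i \<notin> wp ` {w. w \<noteq> []}"
    "j < length (X ! i) \<Longrightarrow> rm (X ! i) j \<in> sumcl (set K \<union> set (take i X))"
proof -
  have c: "chk_indec (X ! i)" "wp (decode (X ! i)) \<noteq> X ! i"
    using assms by (auto simp: chk_chain_def list_all_length)
  show i: "indec (X ! i)" by (rule chk_indec[OF c(1)])
  show "X ! i \<notin> wp ` {w. w \<noteq> []}" by (rule not_word[OF c(2)])
  assume j: "j < length (X ! i)"
  have "i \<in> set [0..<length X]" "j \<in> set [0..<length (X ! i)]"
    using assms(2) j by simp_all
  then have "\<forall>y\<in>set (comps (length (X ! i)) (rm (X ! i) j)). y \<in> set (K @ take i X)"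
    using assms(1) unfolding chk_chain_def list_all_iff by blast
  then have "set (comps (length (X ! i)) (rm (X ! i) j)) \<subseteq> set K \<union> set (take i X)"
    by auto
  moreover have "is_perm (rm (X ! i) j)" using i j by (intro is_perm_rm) (auto simp: indec_def)
  ultimately show "rm (X ! i) j \<in> sumcl (set K \<union> set (take i X))"
    using j by (intro sumcl_comps[where n = "length (X ! i)"]) auto
qed

section \<open>Words of a given size\<close>

definition of_size :: "nat \<Rightarrow> nat list set" where
  "of_size n = {w. w \<noteq> [] \<and> wsize w = n}"

lemma of_size_rec: "of_size (Suc n) = insert [n] (\<Union>k<n - 1. (#) k ` of_size (n - 1 - k))"
proof (intro equalityI subsetI)
  fix w assume "w \<in> of_size (Suc n)"
  then obtain k u where w: "w = k # u" "wsize w = Suc n"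
    by (cases w) (auto simp: of_size_def)
  show "w \<in> insert [n] (\<Union>k<n - 1. (#) k ` of_size (n - 1 - k))"
  proof (cases "u = []")
    case True
    then show ?thesis using w by (simp add: wsize_def)
  next
    case False
    then have "length u > 0" by simp
    moreover have "k + sum_list u + 2 * length u = n"
      using w False by (simp add: wsize_def)
    ultimately have "k < n - 1" "u \<in> of_size (n - 1 - k)"
      using False unfolding of_size_def wsize_def mem_Collect_eq by linarith+
    then show ?thesis using w by blast
  qed
next
  fix w assume "w \<in> insert [n] (\<Union>k<n - 1. (#) k ` of_size (n - 1 - k))"
  then show "w \<in> of_size (Suc n)"
  proof
    assume "w \<in> (\<Union>k<n - 1. (#) k ` of_size (n - 1 - k))"
    then obtain k u where "k < n - 1" "u \<in> of_size (n - 1 - k)" "w = k # u" by blast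
    then show ?thesis
      by (cases u) (auto simp: of_size_def wsize_def)
  qed (simp add: of_size_def wsize_def)
qed

lemma of_size_small:
  "of_size 1 = {[0]}" "of_size 2 = {[1]}" "of_size 3 = {[2], [0,0]}"
  "of_size 4 = {[3], [0,1], [1,0]}"
  "of_size 5 = {[4], [0,2], [0,0,0], [1,1], [2,0]}"
  "of_size 6 = {[5], [0,3], [0,0,1], [0,1,0], [1,2], [1,0,0], [2,1], [3,0]}"
proof -
  show 1: "of_size 1 = {[0]}"
    using of_size_rec[of 0] by simp
  show 2: "of_size 2 = {[1]}"
    using of_size_rec[of 1] by (simp add: numeral_2_eq_2)
  show 3: "of_size 3 = {[2], [0,0]}"
    using of_size_rec[of 2] 1 by (auto simp: numeral_eq_Suc lessThan_Suc)
  show 4: "of_size 4 = {[3], [0,1], [1,0]}"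
    using of_size_rec[of 3] 1 2 by (auto simp: numeral_eq_Suc lessThan_Suc)
  show 5: "of_size 5 = {[4], [0,2], [0,0,0], [1,1], [2,0]}"
    using of_size_rec[of 4] 1 2 3 by (auto simp: numeral_eq_Suc lessThan_Suc)
  show "of_size 6 = {[5], [0,3], [0,0,1], [0,1,0], [1,2], [1,0,0], [2,1], [3,0]}"
    using of_size_rec[of 5] 1 2 3 4 by (auto simp: numeral_eq_Suc lessThan_Suc)
qed

text \<open>All quadruples with \<open>a + k \<le> 1\<close> and \<open>l + b \<le> 1\<close>,
  ordered by level: those that need no one-centre words beyond \<open>S0\<close>.\<close>

definition Q1 :: "(nat \<times> nat \<times> nat \<times> nat) list" where
  "Q1 = [(0,0,0,0), (1,0,0,0), (0,1,0,0), (0,0,1,0), (0,0,0,1),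
     (1,0,1,0), (1,0,0,1), (0,1,1,0), (0,1,0,1)]"

definition compositions :: "nat \<Rightarrow> (nat \<times> nat \<times> nat \<times> nat) list" where
  "compositions n = concat (map (\<lambda>a. concat (map (\<lambda>k. map (\<lambda>l. (a, k, l, n - a - k - l))
     [0..<Suc (n - a - k)]) [0..<Suc (n - a)])) [0..<Suc n])"

text \<open>All 330 quadruples of level at most seven, level by level. The list stays finite but is
  long enough for the gap conditions in \<open>good_regime2a\<close> and
  \<open>good_regime2b\<close>.\<close>

definition Q2 :: "(nat \<times> nat \<times> nat \<times> nat) list" where
  "Q2 = concat (map compositions [0..<8])"

lemma set_compositions: "q \<in> set (compositions n) \<longleftrightarrow> level q = n"
proof
  assume "level q = n"
  moreover obtain a k l b where q: "q = (a, k, l, b)" by (metis surj_pair)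
  ultimately have *: "a \<le> n" "k \<le> n - a" "l \<le> n - a - k" "b = n - a - k - l" by (auto simp: level_def)
  have "q \<in> (\<Union>a\<in>set [0..<Suc n]. \<Union>k\<in>set [0..<Suc (n - a)].
      (\<lambda>l. (a, k, l, n - a - k - l)) ` set [0..<Suc (n - a - k)])"
    by (intro UN_I[of a] UN_I[of k] image_eqI[of _ _ l]) (use * in \<open>simp_all add: q del: upt_Suc\<close>)
  then show "q \<in> set (compositions n)"
    by (simp add: compositions_def del: upt_Suc)
qed (auto simp: compositions_def level_def)

lemma set_Q2: "q \<in> set Q2 \<longleftrightarrow> level q < 8"
  by (auto simp: Q2_def set_compositions)

lemma distinct_compositions: "distinct (compositions n)"
proof -
  have "distinct (concat (map (\<lambda>k. map (\<lambda>l. (a, k, l, n - a - k - l)) [0..<Suc (n - a - k)]) ks))"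
    if "distinct ks" for a ks
    using that by (induction ks) (auto simp: distinct_map inj_on_def)
  note inner = this
  have "distinct (concat (map (\<lambda>a. concat (map (\<lambda>k. map (\<lambda>l. (a, k, l, n - a - k - l))
     [0..<Suc (n - a - k)]) [0..<Suc (n - a)])) as))" if "distinct as" for as
    using that
  proof (induction as)
    case (Cons a as)
    then show ?case using inner[of "[0..<Suc (n - a)]" a] by (auto simp del: upt_Suc)
  qed simp
  from this[of "[0..<Suc n]"] show ?thesis by (simp only: compositions_def distinct_upt)
qed

lemma sorted_concat_compositions:
  "distinct (concat (map compositions [0..<m])) \<and> sorted (map level (concat (map compositions [0..<m])))"
proof (induction m)
  case (Suc m)
  have "map level (compositions m) = replicate (length (compositions m)) m"
    by (intro replicate_eqI) (auto simp: set_compositions)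
  then show ?case
    using Suc distinct_compositions by (auto simp: sorted_append set_compositions)
qed simp

text \<open>Lowering coordinates lowers the level unless nothing changes, and the list is sorted by
  level.\<close>

lemma prefix_closed_Q2: "prefix_closed UNIV Q2"
  unfolding prefix_closed_def
proof (intro conjI allI impI)
  show d: "distinct Q2" using sorted_concat_compositions[of 8] by (simp add: Q2_def)
  fix i a k l b a' k' l' b'
  assume i: "i < length Q2" and q: "Q2 ! i = (a, k, l, b)" and le: "a' \<le> a" "k' \<le> k" "l' \<le> l" "b' \<le> b"
  have "level (a, k, l, b) < 8" using set_Q2[of "Q2 ! i"] nth_mem[OF i] q by simp
  then have "(a', k', l', b') \<in> set Q2" using le by (simp add: set_Q2 level_def)
  then obtain j where j: "j < length Q2" "Q2 ! j = (a', k', l', b')" by (auto simp: in_set_conv_nth)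
  have "j \<le> i"
  proof (rule ccontr)
    assume "\<not> j \<le> i"
    have "sorted (map level Q2)" using sorted_concat_compositions[of 8] by (simp only: Q2_def)
    then have "level (Q2 ! i) \<le> level (Q2 ! j)"
      using sorted_nth_mono[of "map level Q2" i j] \<open>\<not> j \<le> i\<close> j i by simp
    then have "(a', k', l', b') = (a, k, l, b)"
      using le j q by (simp add: level_def)
    then have "Q2 ! j = Q2 ! i" using j q by simp
    then have "j = i" using nth_eq_iff_index_eq[OF d j(1) i] by simp
    then show False using \<open>\<not> j \<le> i\<close> by simp
  qed
  then show "(a', k', l', b') \<in> set (take (Suc i) Q2)"
    using i j by (auto simp: in_set_conv_nth intro!: exI[of _ j])
qed auto

definition chk_prefix :: "(nat \<times> nat \<times> nat \<times> nat) list \<Rightarrow> bool" where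
  "chk_prefix Q \<longleftrightarrow> distinct Q \<and> list_all (\<lambda>i. case Q ! i of (a, k, l, b) \<Rightarrow>
     list_all (\<lambda>a'. list_all (\<lambda>k'. list_all (\<lambda>l'. list_all (\<lambda>b'. (a', k', l', b') \<in> set (take (Suc i) Q))
       [0..<Suc b]) [0..<Suc l]) [0..<Suc k]) [0..<Suc a]) [0..<length Q]"

lemma chk_prefix:
  assumes "chk_prefix Q" "\<And>a k l b c. (a, k, l, b) \<in> set Q \<Longrightarrow> (a, k, c) \<in> S \<and> (c, l, b) \<in> S"
  shows "prefix_closed S Q"
  unfolding prefix_closed_def
proof (intro conjI allI impI)
  show "distinct Q" using assms by (simp add: chk_prefix_def)
  fix i a k l b assume i: "i < length Q" and q: "Q ! i = (a, k, l, b)"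
  then have "(a, k, l, b) \<in> set Q" by (metis nth_mem)
  then show "(a, k, c) \<in> S" "(c, l, b) \<in> S" for c using assms(2) by blast+
  show "(a', k', l', b') \<in> set (take (Suc i) Q)" if "a' \<le> a" "k' \<le> k" "l' \<le> l" "b' \<le> b" for a' k' l' b'
  proof -
    have i': "i \<in> set [0..<length Q]" using i by simp
    have "a' \<in> set [0..<Suc a]" "k' \<in> set [0..<Suc k]" "l' \<in> set [0..<Suc l]" "b' \<in> set [0..<Suc b]"
      using that by (simp_all only: set_upt atLeastLessThan_iff le0 less_Suc_eq_le simp_thms)
    with bspec[OF assms(1)[unfolded chk_prefix_def list_all_iff, THEN conjunct2] i', unfolded q prod.case]
    show ?thesis by blast
  qed
qed

lemma chk_prefix_Q1: "chk_prefix Q1"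
  by code_simp

text \<open>Small change of weights \<open>z^8\<close> and \<open>z^9\<close> for
  \<open>good_regime1_low\<close>, where the interval of the digits is too short for heavier
  triples.\<close>

definition L0 :: "(nat \<times> nat \<times> nat) list" where
  "L0 = [(2, 0, 2), (2, 0, 3), (3, 0, 2)]"

text \<open>All triples outside \<open>S0\<close> of sum at most five, by increasing sum, so that
  every prefix together with \<open>S0\<close> is downward closed.\<close>

definition L1 :: "(nat \<times> nat \<times> nat) list" where
  "L1 = filter (\<lambda>(a, k, b). \<not> (a + k \<le> 1 \<or> k + b \<le> 1)) (concat (map (\<lambda>n.
     concat (map (\<lambda>a. map (\<lambda>k. (a, k, n - a - k)) [0..<Suc (n - a)]) [0..<Suc n])) [2..<6]))"

definition chk_triples :: "(nat \<times> nat \<times> nat) list \<Rightarrow> bool" where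
  "chk_triples L \<longleftrightarrow> distinct L \<and> list_all (\<lambda>(a, k, b). \<not> (a + k \<le> 1 \<or> k + b \<le> 1)) L \<and>
     list_all (\<lambda>i. case L ! i of (a, k, b) \<Rightarrow>
     list_all (\<lambda>a'. list_all (\<lambda>k'. list_all (\<lambda>b'. (a' + k' \<le> 1 \<or> k' + b' \<le> 1) \<or> (a', k', b') \<in> set (take (Suc i) L))
       [0..<Suc b]) [0..<Suc k]) [0..<Suc a]) [0..<length L]"

lemma chk_triples_L0: "chk_triples L0"
  by code_simp

lemma chk_triples_L1: "chk_triples L1"
  by code_simp

lemma level_Q1: "map level Q1 = [0,1,1,1,1,2,2,2,2]"
  by code_simp

lemma level_Q2: "map level Q2 = [0] @ replicate 4 1 @ replicate 10 2 @ replicate 20 3 @ replicate 35 4 @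
    replicate 56 5 @ replicate 84 6 @ replicate 120 7"
  by code_simp

lemma level_L1: "map (\<lambda>(a, k, b). a + k + b + 4) L1 = [6] @ replicate 4 7 @ replicate 9 8 @ replicate 15 9"
  by code_simp

definition K3 :: "nat list list" where
  "K3 = map wp [[0], [1], [2], [0, 0]]"

text \<open>Deleting an entry from a member of one of the lists \<open>Y4\<close>, \<open>Y5\<close>, \<open>Y6\<close> leaves a sum of earlier members of the list
  and of permutations in \<open>K3\<close> or \<open>KY\<close>.\<close>

definition Y4 :: "nat list list" where
  "Y4 = [[4,1,2,3], [3,4,1,2]]"

definition Y5 :: "nat list list" where
  "Y5 = [[4,1,2,5,3], [2,5,1,3,4], [5,1,2,3,4]]"

definition Y6 :: "nat list list" where
  "Y6 = [[4,1,2,5,3], [4,1,2,5,6,3], [4,1,2,6,3,5]]"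

text \<open>The paths in \<open>KW\<close> and the one-centre words from \<open>KT\<close> are
  together all 20 words of size at most six; two-centre words begin at size seven.\<close>

definition KW :: "nat list list" where
  "KW = [[0], [1], [2], [0,0], [1,0], [0,1], [0,0,0], [1,1], [1,0,0], [0,0,1]]"

definition KT :: "(nat \<times> nat \<times> nat) list" where
  "KT = [(0,0,0), (1,0,0), (0,1,0), (0,0,1), (2,0,0), (1,1,0), (1,0,1), (0,2,0), (0,1,1), (0,0,2)]"

lemma chk_Y4: "chk_chain K3 Y4"
  by code_simp

definition KY :: "nat list list" where
  "KY = map wp KW @ map (\<lambda>(a, k, b). wp (sgl a k b)) KT @ [[4,1,2,3]]"

lemma chk_Y5: "chk_chain KY Y5"
  by code_simp

lemma chk_Y6: "chk_chain KY Y6"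
  by code_simp

subsection \<open>Counting indecomposable permutations\<close>

lemma sumcl_indec: "sumcl {x. indec x} = {s. is_perm s}"
proof (intro equalityI subsetI)
  fix s assume "s \<in> {s. is_perm s}"
  then show "s \<in> sumcl {x. indec x}"
    using perm_in_sumcl_indec[of s] sumcl_mono[of "{x. indec x \<and> length x \<le> length s}" "{x. indec x}"] by auto
next
  fix s assume "s \<in> sumcl {x. indec x}"
  then have "is_perm s"
    by (rule sumcl_is_perm[rotated]) (simp add: indec_def)
  then show "s \<in> {s. is_perm s}" by simp
qed

lemma cnt_perms: "cnt {s. is_perm s} n = fact n"
proof -
  have "{s \<in> {s. is_perm s}. length s = n} = permutations_of_set {1..n}"
  proof (intro equalityI subsetI)
    fix s assume "s \<in> permutations_of_set {1..n}"
    then have s: "set s = {1..n}" "distinct s" by (auto simp: permutations_of_set_def)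
    then have "length s = n" using distinct_card[OF s(2)] by simp
    then show "s \<in> {s \<in> {s. is_perm s}. length s = n}" using s by (simp add: is_perm_def)
  qed (auto simp: is_perm_def permutations_of_set_def)
  then show ?thesis by (simp add: cnt_def)
qed

text \<open>All permutations form the sum closure of the indecomposables, so the factorials
  determine the numbers of indecomposables recursively.\<close>

lemma cnt_indec_rec: "n > 0 \<Longrightarrow> fact n = (\<Sum>k\<le>n. cnt {x. indec x} k * fact (n - k))"
  using cnt_sumcl_rec[of "{x. indec x}" n] by (simp add: sumcl_indec cnt_perms)

lemma cnt_indec_small:
  "cnt {x. indec x} 0 = 0" "cnt {x. indec x} 1 = 1" "cnt {x. indec x} 2 = 1" "cnt {x. indec x} 3 = 3"
  "cnt {x. indec x} 4 = 13" "cnt {x. indec x} 5 = 71" "cnt {x. indec x} 6 = 461"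
proof -
  have "{s \<in> {x. indec x}. length s = 0} = {}" by (auto simp: indec_def)
  then show 0: "cnt {x. indec x} 0 = 0" by (simp add: cnt_def)
  show 1: "cnt {x. indec x} 1 = 1"
    using cnt_indec_rec[of 1] 0 by (simp add: numeral_eq_Suc)
  show 2: "cnt {x. indec x} 2 = 1"
    using cnt_indec_rec[of 2] 0 1 by (simp add: numeral_eq_Suc)
  show 3: "cnt {x. indec x} 3 = 3"
    using cnt_indec_rec[of 3] 0 1 2 by (simp add: numeral_eq_Suc)
  show 4: "cnt {x. indec x} 4 = 13"
    using cnt_indec_rec[of 4] 0 1 2 3 by (simp add: numeral_eq_Suc)
  show 5: "cnt {x. indec x} 5 = 71"
    using cnt_indec_rec[of 5] 0 1 2 3 4 by (simp add: numeral_eq_Suc)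
  show "cnt {x. indec x} 6 = 461"
    using cnt_indec_rec[of 6] 0 1 2 3 4 5 by (simp add: numeral_eq_Suc)
qed

text \<open>The supply of extras. Words with any number of centres are excluded, which keeps extras
  disjoint from the word families. The single member of length three is 321.\<close>

definition nw :: "nat \<Rightarrow> nat list set" where
  "nw n = {x. indec x \<and> length x = n \<and> x \<notin> wp ` {w. w \<noteq> []}}"

lemma finite_nw: "finite (nw n)"
proof -
  have "finite {s \<in> {x. indec x}. length s = n}"
    by (rule finite_perms_length) (simp add: indec_def)
  then show ?thesis by (rule rev_finite_subset) (auto simp: nw_def)
qed

lemma card_nw:
  assumes "finite (of_size n)"
  shows "real (card (nw n)) = cnt {x. indec x} n - card (of_size n)"
proof -
  let ?I = "{s \<in> {x. indec x}. length s = n}"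
  have fin: "finite ?I"
    by (rule finite_perms_length) (simp add: indec_def)
  have sub: "wp ` of_size n \<subseteq> ?I"
    using indec_wp by (auto simp: of_size_def length_wp)
  have "nw n = ?I - wp ` of_size n"
    by (auto simp: nw_def of_size_def length_wp)
  moreover have "card (wp ` of_size n) = card (of_size n)"
    by (intro card_image inj_on_subset[OF inj_on_wp]) (auto simp: of_size_def)
  ultimately show ?thesis
    using card_Diff_subset[OF finite_subset[OF sub fin] sub] card_mono[OF fin sub] by (simp add: cnt_def)
qed

lemma card_nw_small:
  "card (nw 1) = 0" "card (nw 2) = 0" "card (nw 3) = 1" "card (nw 4) = 10" "card (nw 5) = 66" "card (nw 6) = 453"
  using card_nw[of 1] card_nw[of 2] card_nw[of 3] card_nw[of 4] card_nw[of 5] card_nw[of 6]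
  unfolding of_size_small cnt_indec_small by simp_all

lemma nw_empty: "nw 0 = {}" "nw 1 = {}" "nw 2 = {}"
  using card_nw_small finite_nw card_0_eq by (auto simp: nw_def indec_def)

lemma path_check:
  assumes "length w \<ge> 2" "hd w \<le> 1" "last w \<le> 1" "list_all (\<lambda>x. x = 0) (butlast (tl w))"
  shows "w \<in> paths"
proof -
  obtain x u where w: "w = x # u" "u \<noteq> []"
    using assms(1) by (cases w) (fastforce simp: Suc_le_eq)+
  have "butlast u = replicate (length (butlast u)) 0"
    using assms(4) w by (intro replicate_length_same[symmetric]) (auto simp: list_all_iff)
  then have "w = x # replicate (length (butlast u)) 0 @ [last u]"
    using w by (metis append_butlast_last_id)
  then show ?thesis
    using assms(2,3) w unfolding paths_def by auto
qed

lemma KW_paths: "set KW \<subseteq> paths"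
proof -
  have "list_all (\<lambda>w. w \<in> {[0], [1], [2]} \<or>
      length w \<ge> 2 \<and> hd w \<le> 1 \<and> last w \<le> 1 \<and> list_all (\<lambda>x. x = 0) (butlast (tl w))) KW"
    by code_simp
  then show ?thesis
    unfolding list_all_iff[of _ KW] using path_check unfolding paths_def by blast
qed

lemma small_words:
  assumes "w \<in> of_size n" "1 \<le> n" "n \<le> 6"
  shows "w \<in> words UNIV {}"
proof -
  have e: "map (\<lambda>(a, k, b). sgl a k b) KT =
      [[3], [0,2], [4], [2,0], [1,2], [0,3], [0,1,0], [5], [3,0], [2,1]]"
    by code_simp
  have "n = 1 \<or> n = 2 \<or> n = 3 \<or> n = 4 \<or> n = 5 \<or> n = 6" using assms(2,3) by linarith
  then have "w \<in> set KW \<union> set (map (\<lambda>(a, k, b). sgl a k b) KT)"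
    using assms(1) unfolding e KW_def by (elim disjE; simp only: of_size_small) auto
  then show ?thesis
    using KW_paths by (auto intro: words_pathI words_sglI)
qed

lemma small_indec:
  assumes "k \<le> 6" "\<And>n. 3 \<le> n \<Longrightarrow> n \<le> k \<Longrightarrow> nw n \<subseteq> E" "indec x" "length x \<le> k"
  shows "x \<in> wp ` words UNIV {} \<union> E"
proof (cases "x \<in> wp ` {w. w \<noteq> []}")
  case True
  then obtain w where w: "x = wp w" "w \<noteq> []" by blast
  then have "w \<in> of_size (length x)" by (simp add: of_size_def length_wp)
  moreover have "1 \<le> length x" using assms(3) by (cases x) (auto simp: indec_def)
  ultimately show ?thesis using small_words assms(1,4) w by auto
next
  case False
  then have x: "x \<in> nw (length x)" using assms by (simp add: nw_def)
  then have "length x \<noteq> 0" "length x \<noteq> 1" "length x \<noteq> 2"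
    using nw_empty by (metis empty_iff)+
  then have "3 \<le> length x" by linarith
  then show ?thesis using assms x by blast
qed

text \<open>Once all non-words up to length \<open>k\<close> are present, deletions from
  permutations of length \<open>k + 1\<close> cause no obligations, so those of the next length can
  be added in any order.\<close>

lemma rm_small:
  assumes "k \<le> 6" "\<And>n. 3 \<le> n \<Longrightarrow> n \<le> k \<Longrightarrow> nw n \<subseteq> E" "is_perm x" "length x \<le> Suc k" "i < length x"
  shows "rm x i \<in> sumcl (wp ` words UNIV {} \<union> E)"
proof -
  have "rm x i \<in> sumcl {y. indec y \<and> length y \<le> length (rm x i)}"
    by (rule perm_in_sumcl_indec[OF is_perm_rm[OF assms(3,5)]])
  moreover have "{y. indec y \<and> length y \<le> length (rm x i)} \<subseteq> wp ` words UNIV {} \<union> E"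
  proof
    fix y assume "y \<in> {y. indec y \<and> length y \<le> length (rm x i)}"
    then show "y \<in> wp ` words UNIV {} \<union> E"
      using assms(4,5) by (intro small_indec[OF assms(1,2)]) auto
  qed
  ultimately show ?thesis using sumcl_mono by blast
qed

abbreviation c4 :: "nat list" where "c4 \<equiv> [4,1,2,3]"

lemma K3_words: "set K3 \<subseteq> wp ` words S {}"
proof -
  have "set [[0], [1], [2], [0, 0]] \<subseteq> set KW" by (auto simp: KW_def)
  then have "set [[0], [1], [2], [0, 0]] \<subseteq> words S {}"
    using KW_paths words_pathI by blast
  then show ?thesis unfolding K3_def set_map by (rule image_mono)
qed

lemma KY_words: "c4 \<in> E \<Longrightarrow> set KY \<subseteq> wp ` words UNIV {} \<union> E"
proof -
  have "set KW \<subseteq> words UNIV {}"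
    using KW_paths words_pathI by blast
  then have "set (map wp KW) \<subseteq> wp ` words UNIV {}" by auto
  moreover have "set (map (\<lambda>(a, k, b). wp (sgl a k b)) KT) \<subseteq> wp ` words UNIV {}"
    by (auto intro!: imageI words_sglI)
  ultimately show "c4 \<in> E \<Longrightarrow> set KY \<subseteq> wp ` words UNIV {} \<union> E"
    by (auto simp: KY_def)
qed

lemma Y_elem:
  assumes "chk_chain KY Y" "i < length Y" "c4 \<in> E" "set (take i Y) \<subseteq> E"
  shows "indec (Y ! i)" "Y ! i \<notin> wp ` {w. w \<noteq> []}"
    "j < length (Y ! i) \<Longrightarrow> rm (Y ! i) j \<in> sumcl (wp ` words UNIV {} \<union> E)"
proof -
  show "indec (Y ! i)" "Y ! i \<notin> wp ` {w. w \<noteq> []}"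
    using chk_chain[OF assms(1,2)] by auto
  have "set KY \<union> set (take i Y) \<subseteq> wp ` words UNIV {} \<union> E"
    using KY_words[OF assms(3)] assms(4) by blast
  then show "rm (Y ! i) j \<in> sumcl (wp ` words UNIV {} \<union> E)" if "j < length (Y ! i)"
    using chk_chain(3)[OF assms(1,2) that] sumcl_mono by blast
qed

lemma Y4_elem:
  assumes "i < length Y4" "set (take i Y4) \<subseteq> E"
  shows "indec (Y4 ! i)" "Y4 ! i \<notin> wp ` {w. w \<noteq> []}"
    "j < length (Y4 ! i) \<Longrightarrow> rm (Y4 ! i) j \<in> sumcl (wp ` words S {} \<union> E)"
proof -
  show "indec (Y4 ! i)" "Y4 ! i \<notin> wp ` {w. w \<noteq> []}"
    using chk_chain[OF chk_Y4 assms(1)] by auto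
  have "set K3 \<union> set (take i Y4) \<subseteq> wp ` words S {} \<union> E"
    using K3_words assms(2) by blast
  then show "rm (Y4 ! i) j \<in> sumcl (wp ` words S {} \<union> E)" if "j < length (Y4 ! i)"
    using chk_chain(3)[OF chk_Y4 assms(1) that] sumcl_mono by blast
qed

lemma okE_Y4: "okE S (set (take n Y4))"
  unfolding okE_def
proof (intro conjI ballI allI impI)
  fix x assume "x \<in> set (take n Y4)"
  then obtain i where i: "i < length Y4" "i < n" "x = Y4 ! i"
    by (auto simp: in_set_conv_nth)
  have "set (take i Y4) \<subseteq> set (take n Y4)"
    using i by (intro set_take_subset_set_take) simp
  note * = Y4_elem[OF i(1) this]
  show "indec x" "x \<notin> wp ` {w. w \<noteq> []}" using * i by auto
  fix j assume "j < length x"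
  then show "rm x j \<in> sumcl (wp ` words S {} \<union> set (take n Y4))"
    using *(3) i by blast
qed simp

lemma okE_layers:
  assumes k: "k \<le> 5" and nw: "\<And>n. 3 \<le> n \<Longrightarrow> n \<le> k \<Longrightarrow> nw n \<subseteq> E" and c4: "c4 \<in> E" and fin: "finite E"
    and cov: "\<And>x. x \<in> E \<Longrightarrow> x \<in> set Y4 \<or> (\<exists>n\<le>Suc k. x \<in> nw n) \<or> 
      (\<exists>Y i. chk_chain KY Y \<and> i < length Y \<and> x = Y ! i \<and> set (take i Y) \<subseteq> E)"
  shows "okE UNIV E"
  unfolding okE_def
proof (rule conjI[OF fin], rule ballI)
  fix x assume "x \<in> E"
  from cov[OF this] show "indec x \<and> x \<notin> wp ` {w. w \<noteq> []} \<and>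
     (\<forall>i<length x. rm x i \<in> sumcl (wp ` words UNIV {} \<union> E))"
  proof (elim disjE exE conjE)
    assume "x \<in> set Y4"
    then obtain i where i: "i < length Y4" "x = Y4 ! i" by (auto simp: in_set_conv_nth)
    then have "i = 0 \<or> i = 1" by (auto simp: Y4_def)
    then have "set (take i Y4) \<subseteq> E" using c4 by (auto simp: Y4_def)
    from Y4_elem[OF i(1) this] show ?thesis unfolding i(2) by blast
  next
    fix n assume n: "n \<le> Suc k" "x \<in> nw n"
    then have x: "indec x" "is_perm x" "length x \<le> Suc k" "x \<notin> wp ` {w. w \<noteq> []}"
      by (auto simp: nw_def indec_def)
    then show ?thesis using rm_small[of k E x] k nw by auto
  next
    fix Y i assume Y: "chk_chain KY Y" and i: "i < length Y" "x = Y ! i" "set (take i Y) \<subseteq> E"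
    from Y_elem[OF Y i(1) c4 i(3)] show ?thesis unfolding i(2) by blast
  qed
qed

subsection \<open>Weights\<close>

definition lsum :: "real \<Rightarrow> nat list list \<Rightarrow> real" where
  "lsum z xs = sum_list (map (\<lambda>x. z ^ length x) xs)"

lemma esum_set: "distinct xs \<Longrightarrow> esum z (set xs) = lsum z xs"
  by (simp add: esum_def lsum_def sum_list_distinct_conv_sum_set)

lemma esum_Un: "finite A \<Longrightarrow> finite B \<Longrightarrow> A \<inter> B = {} \<Longrightarrow> esum z (A \<union> B) = esum z A + esum z B"
  by (simp add: esum_def sum.union_disjoint)

lemma esum_nw: "esum z (nw n) = real (card (nw n)) * z ^ n"
  by (simp add: esum_def nw_def)

text \<open>The heavy weights \<open>us\<close> are spent first, against the interval enlarged by
  the total of the light weights \<open>ws\<close>; then the \<open>ws\<close> close in. As both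
  prefixes can be any, members of one chain must not rely on those of the other.\<close>

lemma two_chains:
  fixes R :: real
  assumes "\<And>w. w \<in> set us \<Longrightarrow> w \<le> h + sum_list ws" "\<And>w. w \<in> set ws \<Longrightarrow> w \<le> h"
    "lo \<le> R" "R \<le> lo + h + sum_list us + sum_list ws"
  shows "\<exists>m n. lo \<le> R - sum_list (take m us) - sum_list (take n ws) \<and>
    R - sum_list (take m us) - sum_list (take n ws) \<le> lo + h"
proof -
  obtain m where m: "lo \<le> R - sum_list (take m us)" "R - sum_list (take m us) \<le> lo + (h + sum_list ws)"
    using chain_prefix[of us "h + sum_list ws" lo R] assms by (auto simp: algebra_simps)
  then obtain n where "lo \<le> R - sum_list (take m us) - sum_list (take n ws)"
    "R - sum_list (take m us) - sum_list (take n ws) \<le> lo + h"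
    using chain_prefix[of ws h lo "R - sum_list (take m us)"] assms(2) by (auto simp: algebra_simps)
  then show ?thesis by blast
qed

subsection \<open>The two regimes\<close>

lemma qsum_levels: "qsum z Q = sum_list (map (\<lambda>n. z ^ n) (map level Q))"
  by (simp add: qsum_def comp_def)

lemma qsum_Q1: "qsum z Q1 = 1 + 4 * z + 4 * z^2"
  unfolding qsum_levels level_Q1 by simp

lemma qsum_take1_Q1: "qsum z (take 1 Q1) = 1"
  by (simp add: Q1_def qsum_def level_def)

lemma qsum_Q2: "qsum z Q2 = 1 + 4 * z + 10 * z^2 + 20 * z^3 + 35 * z^4 + 56 * z^5 + 84 * z^6 + 120 * z^7"
  unfolding qsum_levels level_Q2 by (simp add: sum_list_replicate)

lemma qsum_take1_Q2: "qsum z (take 1 Q2) = 1"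
proof -
  have "map level (take 1 Q2) = [0]" by (simp only: take_map[symmetric] level_Q2) simp
  then show ?thesis by (simp only: qsum_levels) simp
qed

lemma level_pos:
  assumes "list_all (\<lambda>n. 1 \<le> n) (tl (map level Q))" "1 \<le> n" "n < length Q"
  shows "1 \<le> level (Q ! n)"
proof -
  obtain m where m: "n = Suc m" using assms(2) by (cases n) auto
  then have "tl (map level Q) ! m = level (Q ! n)" "m < length (tl (map level Q))"
    using assms(3) by (simp_all add: nth_tl)
  then show ?thesis using assms(1) unfolding list_all_length by metis
qed

lemma level_Q2_pos: "list_all (\<lambda>n. 1 \<le> n) (tl (map level Q2))"
  unfolding level_Q2 by code_simp

text \<open>For \<open>z \<le> 0.41\<close> all one-centre words are used; for larger \<open>z\<close> they would overshoot, and only \<open>S0\<close> together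
  with an initial part of \<open>L0\<close> or \<open>L1\<close> is used.\<close>

lemma good_regime2:
  fixes z :: real
  assumes z: "0 < z" "z < 1" and E: "okE UNIV E"
    and c: "c = 0 \<and> 1 - z^2 \<le> z^2 * qsum z Q2 \<or> c = 1 \<and> 1 - z^2 \<le> z * (qsum z Q2 - 1)"
    and R: "z^7 * qsum z (take c Q2) / (1 - z^2) \<le> R" "R \<le> z^7 * qsum z Q2 / (1 - z^2)"
    and tot: "z + z^2 + 2 * z^3 / (1 - z) + z^4 / (1 - z)^3 + esum z E + R = 1"
  shows "good (1 / z)"
proof (rule good_assemble[OF z _ prefix_closed_Q2 E has_sum_all_triples[OF z], where c = c and dd = 0
      and g = "if c = 0 then 1 else z"])
  have l: "length Q2 = 330"
    using arg_cong[OF level_Q2, of length] by simp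
  show "c \<le> length Q2" using c l by auto
  show "down3 UNIV" by (simp add: down3_def)
  \<comment> \<open>If the empty digit is allowed, the largest gap is 1, caused by the quadruple of
    level zero. Making that quadruple mandatory leaves gaps of at most \<open>z\<close>.\<close>
  show "z ^ level (Q2 ! n) \<le> (if c = 0 then 1 else z)" if "c \<le> n" "n < length Q2" for n
  proof (cases "c = 0")
    case True
    then show ?thesis using z by (simp add: power_le_one)
  next
    case False
    then have "1 \<le> n" using c that by auto
    have "1 \<le> level (Q2 ! n)"
      using level_pos[OF level_Q2_pos \<open>1 \<le> n\<close> that(2)] .
    then show ?thesis using power_decreasing[of 1 "level (Q2 ! n)" z] z False by simp
  qed
  show "(if c = 0 then 1 else z) * (1 - z^2) \<le> z^2 * (qsum z Q2 - qsum z (take c Q2))"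
    using c
  proof
    assume c: "c = 1 \<and> 1 - z^2 \<le> z * (qsum z Q2 - 1)"
    then have "z * (1 - z^2) \<le> z * (z * (qsum z Q2 - 1))"
      using z by (intro mult_left_mono) auto
    then show ?thesis using c qsum_take1_Q2[of z] by (simp add: power2_eq_square mult.assoc)
  qed (simp add: qsum_def)
qed (use R tot in simp_all)

text \<open>The weight of the paths, of all one-centre words and of \<open>c4\<close>. Since
  \<open>c4\<close> is also counted in \<open>esum z G\<close> where this is used,
  \<open>good_layers\<close> has \<open>1 + z^4\<close> in place of 1.\<close>

definition base2 :: "real \<Rightarrow> real" where
  "base2 z = z + z^2 + 2 * z^3 / (1 - z) + z^4 / (1 - z)^3 + z^4"

lemma base2_mono: "0 < x \<Longrightarrow> x \<le> y \<Longrightarrow> y < 1 \<Longrightarrow> base2 x \<le> base2 y"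
  unfolding base2_def by (intro add_mono frac_le power_mono mult_left_mono mult_nonneg_nonneg) auto

text \<open>The sum of \<open>z ^ (2 * d + 7)\<close> over all \<open>d\<close>, by which the weight
  of a quadruple list used at every \<open>d\<close> is multiplied.\<close>

definition core :: "real \<Rightarrow> real" where
  "core z = z^7 / (1 - z^2)"

lemma core_mono: "0 < x \<Longrightarrow> x \<le> y \<Longrightarrow> y < 1 \<Longrightarrow> core x \<le> core y"
  unfolding core_def by (intro frac_le power_mono diff_left_mono) (auto simp: power_less_one_iff)

lemma qsum_Q2_mono: "0 < x \<Longrightarrow> x \<le> y \<Longrightarrow> qsum x Q2 \<le> qsum y Q2"
  unfolding qsum_Q2 by (intro add_mono mult_left_mono power_mono) auto

lemma lsum_Y5: "lsum z Y5 = 3 * z^5" and lsum_Y6: "lsum z (tl Y6) = 2 * z^6"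
  by (simp_all add: lsum_def Y5_def Y6_def numeral_eq_Suc)

lemma Y_nw: "set Y4 \<subseteq> nw 4" "set Y5 \<subseteq> nw 5" "set (tl Y6) \<subseteq> nw 6" "hd Y6 \<in> nw 5"
proof -
  have "x \<in> nw (length x)" if "chk_chain K Y" "x \<in> set Y" for K Y x
    using chk_chain(1,2)[OF that(1)] that(2) by (auto simp: nw_def in_set_conv_nth)
  note * = this[OF chk_Y4] this[OF chk_Y5] this[OF chk_Y6]
  show "set Y4 \<subseteq> nw 4"
  proof
    fix x assume "x \<in> set Y4"
    moreover from this have "length x = 4" by (auto simp: Y4_def)
    ultimately show "x \<in> nw 4" using *(1)[of x] by simp
  qed
  show "set Y5 \<subseteq> nw 5"
  proof
    fix x assume "x \<in> set Y5"
    moreover from this have "length x = 5" by (auto simp: Y5_def)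
    ultimately show "x \<in> nw 5" using *(2)[of x] by simp
  qed
  show "set (tl Y6) \<subseteq> nw 6"
  proof
    fix x assume "x \<in> set (tl Y6)"
    moreover from this have "length x = 6" "x \<in> set Y6" by (auto simp: Y6_def)
    ultimately show "x \<in> nw 6" using *(3)[of x] by simp
  qed
  show "hd Y6 \<in> nw 5" using *(3)[of "hd Y6"] by (simp add: Y6_def numeral_eq_Suc)
qed

lemma nw_disjoint: "m \<noteq> n \<Longrightarrow> nw m \<inter> nw n = {}"
  by (auto simp: nw_def)

lemma disjoint_length:
  assumes "\<And>x. x \<in> A \<Longrightarrow> length x = n" "\<And>x. x \<in> B \<Longrightarrow> length x \<noteq> n"
  shows "A \<inter> B = {}"
  using assms by blast

lemma take_elem: "x \<in> set (take n xs) \<Longrightarrow> \<exists>i<length xs. x = xs ! i \<and> i < n"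
  by (auto simp: in_set_conv_nth)

text \<open>\<open>G\<close> is the mandatory part of the extras, \<open>Os\<close> the chain of
  heavier and \<open>Is\<close> that of lighter optional ones; \<open>h\<close> is the length of the
  interval that the two-centre words cover.\<close>

lemma good_layers:
  fixes z :: real
  assumes z: "0 < z" "z < 1"
    and c: "c = 0 \<and> 1 - z^2 \<le> z^2 * qsum z Q2 \<or> c = 1 \<and> 1 - z^2 \<le> z * (qsum z Q2 - 1)"
    and G: "finite G" "distinct Os" "distinct Is" "set Os \<inter> set Is = {}" "set Os \<inter> G = {}" "set Is \<inter> G = {}"
    and ok: "\<And>m n. okE UNIV (G \<union> set (take m Os) \<union> set (take n Is))"
    and h: "h = core z * (qsum z Q2 - qsum z (take c Q2))"
    and w: "\<And>x. x \<in> set Os \<Longrightarrow> z ^ length x \<le> h + lsum z Is" "\<And>x. x \<in> set Is \<Longrightarrow> z ^ length x \<le> h"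
    and R: "core z * qsum z (take c Q2) + esum z G + base2 z \<le> 1 + z^4"
      "1 + z^4 \<le> core z * qsum z Q2 + esum z G + lsum z Os + lsum z Is + base2 z"
  shows "good (1 / z)"
proof -
  define f where "f = (\<lambda>x::nat list. z ^ length x)"
  define lo where "lo = core z * qsum z (take c Q2)"
  define R' where "R' = 1 + z^4 - base2 z - esum z G"
  have s: "sum_list (map f xs) = lsum z xs" for xs by (simp add: f_def lsum_def)
  have "\<exists>m n. lo \<le> R' - sum_list (take m (map f Os)) - sum_list (take n (map f Is)) \<and>
      R' - sum_list (take m (map f Os)) - sum_list (take n (map f Is)) \<le> lo + h"
  proof (rule two_chains)
    show "v \<le> h + sum_list (map f Is)" if "v \<in> set (map f Os)" for v
      using that w(1) unfolding s by (auto simp: f_def)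
    show "v \<le> h" if "v \<in> set (map f Is)" for v
      using that w(2) by (auto simp: f_def)
  qed (use R in \<open>simp_all add: s R'_def lo_def h algebra_simps\<close>)
  then obtain m n where mn: "lo \<le> R' - lsum z (take m Os) - lsum z (take n Is)"
    "R' - lsum z (take m Os) - lsum z (take n Is) \<le> lo + h"
    by (auto simp: take_map s)
  define E where "E = G \<union> set (take m Os) \<union> set (take n Is)"
  have "esum z E = esum z G + lsum z (take m Os) + lsum z (take n Is)"
  proof -
    have "set (take m Os) \<inter> G = {}" "set (take n Is) \<inter> G = {}" "set (take m Os) \<inter> set (take n Is) = {}"
      using G set_take_subset[of m Os] set_take_subset[of n Is] by blast+
    moreover from this have "(G \<union> set (take m Os)) \<inter> set (take n Is) = {}" by blast
    ultimately have "esum z E = esum z G + esum z (set (take m Os)) + esum z (set (take n Is))"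
      unfolding E_def using G(1) by (simp add: esum_Un Int_commute)
    then show ?thesis using G(2,3) by (simp add: esum_set)
  qed
  then have tot: "z + z^2 + 2 * z^3 / (1 - z) + z^4 / (1 - z)^3 + esum z E + (R' - lsum z (take m Os) - lsum z (take n Is)) = 1"
    by (simp add: R'_def base2_def)
  have ok: "okE UNIV E" unfolding E_def by (rule ok)
  have r1: "z^7 * qsum z (take c Q2) / (1 - z^2) \<le> R' - lsum z (take m Os) - lsum z (take n Is)"
    using mn(1) by (simp add: lo_def core_def)
  have r2: "R' - lsum z (take m Os) - lsum z (take n Is) \<le> z^7 * qsum z Q2 / (1 - z^2)"
    using mn(2) unfolding lo_def h core_def by (simp add: diff_divide_distrib right_diff_distrib)
  show ?thesis by (rule good_regime2[OF z ok c r1 r2 tot])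
qed

text \<open>The list \<open>Ys\<close> allows \<open>Is\<close> to be the tail of a certified chain
  whose beginning is mandatory.\<close>

lemma okE_layers_chain:
  assumes k: "k \<le> 5" and nw: "\<And>n. 3 \<le> n \<Longrightarrow> n \<le> k \<Longrightarrow> nw n \<subseteq> G" and c4: "c4 \<in> G" and fin: "finite G"
    and cov: "\<And>x. x \<in> G \<union> set Os \<Longrightarrow> x \<in> set Y4 \<or> (\<exists>n\<le>Suc k. x \<in> nw n)"
    and Is: "chk_chain KY (Ys @ Is)" "set Ys \<subseteq> G"
  shows "okE UNIV (G \<union> set (take m Os) \<union> set (take n Is))"
proof (rule okE_layers[OF k])
  let ?E = "G \<union> set (take m Os) \<union> set (take n Is)"
  show "nw i \<subseteq> ?E" if "3 \<le> i" "i \<le> k" for i using nw[OF that] by blast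
  show "c4 \<in> ?E" "finite ?E" using c4 fin by auto
  fix x assume "x \<in> ?E"
  then consider "x \<in> G \<union> set Os" | "x \<in> set (take n Is)"
    using set_take_subset[of m Os] by blast
  then show "x \<in> set Y4 \<or> (\<exists>i\<le>Suc k. x \<in> nw i) \<or>
      (\<exists>Y i. chk_chain KY Y \<and> i < length Y \<and> x = Y ! i \<and> set (take i Y) \<subseteq> ?E)"
  proof cases
    case 1
    from cov[OF this] show ?thesis by blast
  next
    case 2
    from take_elem[OF this] obtain i where i: "i < length Is" "x = Is ! i" "i < n" by blast
    let ?Y = "Ys @ Is" and ?j = "length Ys + i"
    have "set (take i Is) \<subseteq> set (take n Is)"
      using i by (intro set_take_subset_set_take) simp
    then have "set (take ?j ?Y) \<subseteq> ?E"
      using Is(2) by auto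
    moreover have "?j < length ?Y" "x = ?Y ! ?j" using i by simp_all
    ultimately have "chk_chain KY ?Y \<and> ?j < length ?Y \<and> x = ?Y ! ?j \<and> set (take ?j ?Y) \<subseteq> ?E"
      using Is(1) by (intro conjI)
    then show ?thesis by (intro disjI2) (rule exI[of _ ?Y], rule exI[of _ ?j])
  qed
qed

text \<open>The further indecomposables are spent in the order of their lengths, and the next four lemmas differ in the
  length at which this stops.  The permutation \<open>c4\<close> is always included since the chains \<open>Y5\<close> and \<open>Y6\<close> rely on it.\<close>

lemma good_using_3412:
  fixes z :: real
  assumes z: "0 < z" "z < 1" and k: "1 - z^2 \<le> z^2 * qsum z Q2" and h: "z^5 \<le> core z * qsum z Q2"
    and w: "z^4 \<le> core z * qsum z Q2 + 3 * z^5"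
    and b: "base2 z \<le> 1" "1 \<le> base2 z + z^4 + 3 * z^5 + core z * qsum z Q2"
  shows "good (1 / z)"
proof (rule good_layers[OF z, where c = 0 and G = "{c4}" and Os = "[[3,4,1,2]]" and Is = Y5
      and h = "core z * qsum z Q2"])
  show "okE UNIV ({c4} \<union> set (take m [[3,4,1,2]]) \<union> set (take n Y5))" for m n
    by (rule okE_layers_chain[of 2 _ _ "[]"]) (use chk_Y5 in \<open>auto simp: Y4_def\<close>)
  show "distinct Y5" "set [[3,4,1,2]] \<inter> set Y5 = {}" "set Y5 \<inter> {c4} = {}"
    by (auto simp: Y5_def)
  show "z ^ length x \<le> core z * qsum z Q2 + lsum z Y5" if "x \<in> set [[3,4,1,2]]" for x
    using that w by (simp add: lsum_Y5 numeral_eq_Suc)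
  show "z ^ length x \<le> core z * qsum z Q2" if "x \<in> set Y5" for x
  proof -
    have "length x = 5" using that by (auto simp: Y5_def)
    then show ?thesis using h by simp
  qed
  have e: "esum z {c4} = z^4" "lsum z [[3,4,1,2]] = z^4"
    by (simp_all add: esum_def lsum_def numeral_eq_Suc)
  show "1 + z^4 \<le> core z * qsum z Q2 + esum z {c4} + lsum z [[3,4,1,2]] + lsum z Y5 + base2 z"
    using b(2) unfolding e lsum_Y5 by simp
  show "core z * qsum z (take 0 Q2) + esum z {c4} + base2 z \<le> 1 + z^4"
    using b(1) unfolding e by (simp add: qsum_def)
qed (use k in \<open>simp_all add: qsum_def\<close>)

lemma c4_nw: "c4 \<in> nw 4"
  using Y_nw(1) by (auto simp: Y4_def)

lemma esum_nw_small: "esum z (nw 3) = z^3" "esum z (nw 4) = 10 * z^4" "esum z (nw 5) = 66 * z^5" "esum z (nw 6) = 453 * z^6"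
  unfolding esum_nw card_nw_small by simp_all

lemma lsum_list:
  assumes "set xs = nw n - {y}" "y \<in> nw n" "distinct xs"
  shows "lsum z xs = esum z (nw n) - z ^ n"
proof -
  have "length y = n" using assms(2) by (simp add: nw_def)
  then have "esum z (nw n) = z ^ n + esum z (nw n - {y})"
    unfolding esum_def using sum.remove[OF finite_nw assms(2)] by metis
  moreover have "esum z (nw n - {y}) = lsum z xs"
    using esum_set[OF assms(3), of z] assms(1) by simp
  ultimately show ?thesis by simp
qed

lemma good_using_length4:
  fixes z :: real
  assumes z: "0 < z" "z < 1" and k: "1 - z^2 \<le> z^2 * qsum z Q2" and h: "z^5 \<le> core z * qsum z Q2"
    and w: "z^4 \<le> core z * qsum z Q2 + 3 * z^5"
    and b: "base2 z + z^3 \<le> 1" "1 \<le> base2 z + z^3 + 9 * z^4 + 3 * z^5 + core z * qsum z Q2"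
  shows "good (1 / z)"
proof -
  \<comment> \<open>The order is arbitrary: deletions from these have components among the words and
    \<open>nw 3\<close>, which is mandatory here.\<close>
  obtain Os where Os: "distinct Os" "set Os = nw 4 - {c4}"
    using finite_distinct_list[of "nw 4 - {c4}"] finite_nw by auto
  have len: "length x = 4" if "x \<in> set Os" for x using that Os by (auto simp: nw_def)
  have len5: "length x = 5" if "x \<in> set Y5" for x using that by (auto simp: Y5_def)
  have len3: "length x = 3" if "x \<in> nw 3" for x using that by (auto simp: nw_def)
  show ?thesis
  proof (rule good_layers[OF z, where c = 0 and G = "nw 3 \<union> {c4}" and Os = Os and Is = Y5
      and h = "core z * qsum z Q2"])
    show "okE UNIV (nw 3 \<union> {c4} \<union> set (take m Os) \<union> set (take n Y5))" for m n
    proof (rule okE_layers_chain[of 3 _ _ "[]"])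
      show "x \<in> set Y4 \<or> (\<exists>n\<le>Suc 3. x \<in> nw n)" if "x \<in> nw 3 \<union> {c4} \<union> set Os" for x
        using that Os(2) c4_nw by (auto intro: exI[of _ 3] exI[of _ 4])
      show "nw n \<subseteq> nw 3 \<union> {c4}" if "3 \<le> n" "n \<le> 3" for n
      proof -
        have "n = 3" using that by linarith
        then show ?thesis by blast
      qed
    qed (use chk_Y5 in \<open>auto simp: finite_nw\<close>)
    show "set Os \<inter> set Y5 = {}" by (rule disjoint_length[OF len]) (simp_all add: len5)
    show "set Os \<inter> (nw 3 \<union> {c4}) = {}" using Os(2) nw_disjoint[of 3 4] by auto
    show "set Y5 \<inter> (nw 3 \<union> {c4}) = {}" by (rule disjoint_length[OF len5]) (auto dest: len3)
    show "z ^ length x \<le> core z * qsum z Q2 + lsum z Y5" if "x \<in> set Os" for x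
      using len[OF that] w by (simp add: lsum_Y5)
    show "z ^ length x \<le> core z * qsum z Q2" if "x \<in> set Y5" for x
      using len5[OF that] h by simp
    have e: "esum z (nw 3 \<union> {c4}) = z^3 + z^4"
    proof -
      have "esum z (nw 3 \<union> {c4}) = esum z (nw 3) + esum z {c4}"
        by (rule esum_Un) (auto simp: finite_nw dest: len3)
      then show ?thesis by (simp add: esum_nw_small) (simp add: esum_def numeral_eq_Suc)
    qed
    have l: "lsum z Os = 9 * z^4"
      using lsum_list[OF Os(2) c4_nw Os(1)] by (simp add: esum_nw_small)
    show "1 + z^4 \<le> core z * qsum z Q2 + esum z (nw 3 \<union> {c4}) + lsum z Os + lsum z Y5 + base2 z"
      using b(2) unfolding e l lsum_Y5 by simp
    show "core z * qsum z (take 0 Q2) + esum z (nw 3 \<union> {c4}) + base2 z \<le> 1 + z^4"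
      using b(1) unfolding e by (simp add: qsum_def)
  qed (use k Os in \<open>simp_all add: finite_nw qsum_def Y5_def\<close>)
qed

lemma good_using_length5:
  fixes z :: real
  assumes z: "0 < z" "z < 1" and k: "1 - z^2 \<le> z * (qsum z Q2 - 1)" and h: "z^6 \<le> core z * (qsum z Q2 - 1)"
    and w: "z^5 \<le> core z * (qsum z Q2 - 1) + 2 * z^6"
    and b: "base2 z + core z + z^3 + 9 * z^4 + z^5 \<le> 1"
      "1 \<le> base2 z + z^3 + 9 * z^4 + 66 * z^5 + 2 * z^6 + core z * qsum z Q2"
  shows "good (1 / z)"
proof -
  \<comment> \<open>This permutation, 41253, is made mandatory because the two light ones of length
    six contain it.\<close>
  define y where "y = hd Y6"
  have y: "y \<in> nw 5" "length y = 5" using Y_nw(4) by (auto simp: y_def nw_def)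
  obtain Os where Os: "distinct Os" "set Os = nw 5 - {y}"
    using finite_distinct_list[of "nw 5 - {y}"] finite_nw by auto
  have len: "length x = 5" if "x \<in> set Os" for x using that Os by (auto simp: nw_def)
  have len6: "length x = 6" if "x \<in> set (tl Y6)" for x using that by (auto simp: Y6_def)
  have lenn: "length x = n" if "x \<in> nw n" for x n using that by (auto simp: nw_def)
  let ?G = "nw 3 \<union> nw 4 \<union> {y}"
  show ?thesis
  proof (rule good_layers[OF z, where c = 1 and G = ?G and Os = Os and Is = "tl Y6"
      and h = "core z * (qsum z Q2 - 1)"])
    show "okE UNIV (?G \<union> set (take m Os) \<union> set (take n (tl Y6)))" for m n
    proof (rule okE_layers_chain[of 4 _ _ "[y]"])
      show "x \<in> set Y4 \<or> (\<exists>n\<le>Suc 4. x \<in> nw n)" if "x \<in> ?G \<union> set Os" for x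
        using that Os(2) y by (auto intro: exI[of _ 3] exI[of _ 4] exI[of _ 5])
      show "nw n \<subseteq> ?G" if "3 \<le> n" "n \<le> 4" for n
      proof -
        have "n = 3 \<or> n = 4" using that by linarith
        then show ?thesis by auto
      qed
      show "chk_chain KY ([y] @ tl Y6)" using chk_Y6 by (simp add: y_def Y6_def)
    qed (use c4_nw in \<open>auto simp: finite_nw\<close>)
    show "set Os \<inter> set (tl Y6) = {}" by (rule disjoint_length[OF len]) (simp_all add: len6)
    show "set Os \<inter> ?G = {}" using Os(2) nw_disjoint[of 3 5] nw_disjoint[of 4 5] by auto
    show "set (tl Y6) \<inter> ?G = {}" by (rule disjoint_length[OF len6]) (auto simp: y dest: lenn)
    show "z ^ length x \<le> core z * (qsum z Q2 - 1) + lsum z (tl Y6)" if "x \<in> set Os" for x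
      using len[OF that] w by (simp add: lsum_Y6)
    show "z ^ length x \<le> core z * (qsum z Q2 - 1)" if "x \<in> set (tl Y6)" for x
      using len6[OF that] h by simp
    have e: "esum z ?G = z^3 + 10 * z^4 + z^5"
    proof -
      have "esum z ?G = esum z (nw 3 \<union> nw 4) + esum z {y}"
        by (rule esum_Un) (auto simp: finite_nw y dest: lenn)
      also have "esum z (nw 3 \<union> nw 4) = esum z (nw 3) + esum z (nw 4)"
        by (rule esum_Un) (simp_all add: finite_nw nw_disjoint)
      finally show ?thesis by (simp add: esum_nw_small) (simp add: esum_def y)
    qed
    have l: "lsum z Os = 65 * z^5"
      using lsum_list[OF Os(2) y(1) Os(1)] by (simp add: esum_nw_small)
    show "1 + z^4 \<le> core z * qsum z Q2 + esum z ?G + lsum z Os + lsum z (tl Y6) + base2 z"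
      using b(2) unfolding e l lsum_Y6 by simp
    show "core z * qsum z (take 1 Q2) + esum z ?G + base2 z \<le> 1 + z^4"
      using b(1) unfolding e qsum_take1_Q2 by simp
    show "distinct (tl Y6)" by (simp add: Y6_def)
  qed (use k Os in \<open>simp_all add: finite_nw qsum_take1_Q2[simplified]\<close>)
qed

lemma good_using_length6:
  fixes z :: real
  assumes z: "0 < z" "z < 1" and k: "1 - z^2 \<le> z * (qsum z Q2 - 1)" and h: "z^6 \<le> core z * (qsum z Q2 - 1)"
    and b: "base2 z + core z + z^3 + 9 * z^4 + 66 * z^5 \<le> 1"
      "1 \<le> base2 z + z^3 + 9 * z^4 + 66 * z^5 + 453 * z^6 + core z * qsum z Q2"
  shows "good (1 / z)"
proof -
  obtain Os where Os: "distinct Os" "set Os = nw 6"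
    using finite_distinct_list[of "nw 6"] finite_nw by auto
  have lenn: "length x = n" if "x \<in> nw n" for x n using that by (auto simp: nw_def)
  let ?G = "nw 3 \<union> nw 4 \<union> nw 5"
  show ?thesis
  proof (rule good_layers[OF z, where c = 1 and G = ?G and Os = Os and Is = "[]"
      and h = "core z * (qsum z Q2 - 1)"])
    show "okE UNIV (?G \<union> set (take m Os) \<union> set (take n []))" for m n
    proof (rule okE_layers_chain[of 5 _ _ "[]"])
      show "x \<in> set Y4 \<or> (\<exists>n\<le>Suc 5. x \<in> nw n)" if "x \<in> ?G \<union> set Os" for x
        using that Os(2) by (auto intro: exI[of _ 3] exI[of _ 4] exI[of _ 5] exI[of _ 6])
      show "nw n \<subseteq> ?G" if "3 \<le> n" "n \<le> 5" for n
      proof -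
        have "n = 3 \<or> n = 4 \<or> n = 5" using that by linarith
        then show ?thesis by auto
      qed
    qed (use c4_nw in \<open>auto simp: finite_nw chk_chain_def\<close>)
    show "set Os \<inter> ?G = {}" using Os(2) nw_disjoint[of 3 6] nw_disjoint[of 4 6] nw_disjoint[of 5 6] by auto
    show "z ^ length x \<le> core z * (qsum z Q2 - 1) + lsum z []" if "x \<in> set Os" for x
      using that h lenn[of x 6] Os by (simp add: lsum_def)
    have e: "esum z ?G = z^3 + 10 * z^4 + 66 * z^5"
    proof -
      have "esum z ?G = esum z (nw 3 \<union> nw 4) + esum z (nw 5)"
        by (rule esum_Un) (use nw_disjoint[of 3 5] nw_disjoint[of 4 5] in \<open>auto simp: finite_nw\<close>)
      also have "esum z (nw 3 \<union> nw 4) = esum z (nw 3) + esum z (nw 4)"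
        by (rule esum_Un) (simp_all add: finite_nw nw_disjoint)
      finally show ?thesis by (simp add: esum_nw_small)
    qed
    have l: "lsum z Os = 453 * z^6"
      using esum_set[OF Os(1), of z] Os(2) by (simp add: esum_nw_small)
    show "1 + z^4 \<le> core z * qsum z Q2 + esum z ?G + lsum z Os + lsum z [] + base2 z"
      using b(2) unfolding e l by (simp add: lsum_def)
    show "core z * qsum z (take 1 Q2) + esum z ?G + base2 z \<le> 1 + z^4"
      using b(1) unfolding e qsum_take1_Q2 by simp
  qed (use k Os in \<open>simp_all add: finite_nw qsum_take1_Q2[simplified]\<close>)
qed

subsection \<open>Numerical estimates\<close>

text \<open>Powers of \<open>z\<close> factor out of it and it increases with \<open>z\<close>, so
  most estimates below need checking only at the left end of an interval.\<close>

definition geo :: "nat \<Rightarrow> real \<Rightarrow> real" where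
  "geo k z = z ^ k / (1 - z^2)"

lemma geo_mono: "0 < x \<Longrightarrow> x \<le> y \<Longrightarrow> y < 1 \<Longrightarrow> geo k x \<le> geo k y"
  unfolding geo_def by (intro frac_le power_mono diff_left_mono) (auto simp: power_less_one_iff)

lemma geo_pos: "0 < z \<Longrightarrow> z < 1 \<Longrightarrow> 0 < geo k z"
  unfolding geo_def by (simp add: power_less_one_iff)

lemma geo_add: "geo (j + k) z = z ^ j * geo k z"
  by (simp add: geo_def power_add)

lemma core_geo: "core z = geo 7 z"
  by (simp add: core_def geo_def)

lemma qsum_Q2_ge: "0 < z \<Longrightarrow> 1 \<le> qsum z Q2"
  unfolding qsum_Q2 by simp

lemma geo_qsum_mono:
  assumes "0 < x" "x \<le> y" "y < 1"
  shows "geo k x * qsum x Q2 \<le> geo k y * qsum y Q2"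
    "geo k x * (qsum x Q2 - 1) \<le> geo k y * (qsum y Q2 - 1)"
  using assms geo_mono[of x y k] geo_pos[of x k] geo_pos[of y k] qsum_Q2_mono[of x y] qsum_Q2_ge[of x]
  by (auto intro!: mult_mono)

text \<open>At 0.41 the paths, all one-centre words and \<open>c4\<close> still weigh less than 1.
  The other boundary has little freedom: at 0.37 the gap condition with empty digits fails, and at
  0.372 the mandatory part of \<open>good_using_length5\<close> already exceeds 1.\<close>

lemma good_regime2a:
  fixes z :: real
  assumes z: "3714/10000 \<le> z" "z \<le> 41/100"
  shows "good (1 / z)"
proof -
  have z01: "0 < z" "z < 1" using z by auto
  have pow: "(3714/10000) ^ n \<le> z ^ n" "z ^ n \<le> (41/100) ^ n" for n
    using z by (auto intro!: power_mono)
  have "1 \<le> geo 2 z * qsum z Q2"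
    by (rule order.trans[OF _ geo_qsum_mono(1)[OF _ z(1) z01(2)]]) (simp_all add: geo_def qsum_Q2 power_divide)
  moreover have "0 < 1 - z^2" using z01 by (simp add: power_less_one_iff)
  ultimately have k: "1 - z^2 \<le> z^2 * qsum z Q2"
    by (simp add: geo_def field_simps)
  have c: "core z * qsum z Q2 = z^5 * (geo 2 z * qsum z Q2)" "core z * qsum z Q2 = z^4 * (geo 3 z * qsum z Q2)"
    "core z * qsum z Q2 = z^3 * (geo 4 z * qsum z Q2)"
    using geo_add[of 5 2 z] geo_add[of 4 3 z] geo_add[of 3 4 z] by (simp_all add: core_geo)
  have h: "z^5 \<le> core z * qsum z Q2"
    using mult_left_mono[OF \<open>1 \<le> geo 2 z * qsum z Q2\<close>, of "z^5"] z01 unfolding c(1) by simp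
  have "1 \<le> geo 3 (3714/10000) * qsum (3714/10000) Q2 + 3 * (3714/10000)"
    by (simp add: geo_def qsum_Q2 power_divide)
  then have "1 \<le> geo 3 z * qsum z Q2 + 3 * z"
    using geo_qsum_mono(1)[OF _ z(1) z01(2), of 3] z(1) by simp
  from mult_left_mono[OF this, of "z^4"] have w: "z^4 \<le> core z * qsum z Q2 + 3 * z^5"
    using z01 unfolding c(2) by (simp add: distrib_left numeral_eq_Suc mult_ac)
  show ?thesis
  proof (cases "base2 z + z^3 \<le> 1")
    case True
    let ?x = "3714/10000 :: real"
    have "1 \<le> base2 ?x + ?x^3 + 9 * ?x^4 + 3 * ?x^5 + geo 7 ?x * qsum ?x Q2"
      by (simp add: base2_def geo_def qsum_Q2 power_divide)
    also have "\<dots> \<le> base2 z + z^3 + 9 * z^4 + 3 * z^5 + geo 7 z * qsum z Q2"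
      using pow base2_mono[OF _ z(1) z01(2)] geo_qsum_mono(1)[OF _ z(1) z01(2), of 7]
      by (intro add_mono mult_left_mono) auto
    finally show ?thesis
      using good_using_length4[OF z01 k h w True] by (simp add: core_geo)
  next
    case False
    \<comment> \<open>With 321 the weight is too large only beyond 0.39. There 3412, the chain
      \<open>Y5\<close> and the digits together make up for the missing \<open>z^3\<close>.\<close>
    have z39: "39/100 \<le> z"
    proof (rule ccontr)
      assume "\<not> ?thesis"
      then have "z \<le> 39/100" by simp
      then have "base2 z + z^3 \<le> base2 (39/100) + (39/100)^3"
        using z01 by (intro add_mono base2_mono power_mono) auto
      also have "\<dots> \<le> 1" by (simp add: base2_def power_divide)
      finally show False using False by simp
    qed
    let ?x = "39/100 :: real"
    have "1 \<le> ?x + 3 * ?x^2 + geo 4 ?x * qsum ?x Q2"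
      by (simp add: geo_def qsum_Q2 power_divide)
    also have "\<dots> \<le> z + 3 * z^2 + geo 4 z * qsum z Q2"
      using z39 geo_qsum_mono(1)[OF _ z39 z01(2), of 4] by (intro add_mono mult_left_mono power_mono) auto
    finally have "z^3 * 1 \<le> z^3 * (z + 3 * z^2 + geo 4 z * qsum z Q2)"
      using z01 by (intro mult_left_mono) auto
    then have "z^3 \<le> z^4 + 3 * z^5 + core z * qsum z Q2"
      unfolding c(3) by (simp add: distrib_left numeral_eq_Suc mult_ac)
    moreover have "base2 z \<le> 1"
      by (rule order.trans[OF base2_mono[OF z01(1) z(2)]]) (simp_all add: base2_def power_divide)
    ultimately show ?thesis
      using False by (intro good_using_3412[OF z01 k h w]) auto
  qed
qed

text \<open>Nonempty digits are needed here, as they reduce the largest gap from 1 to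
  \<open>z\<close>. The left end lies just below \<open>1 / (lamB + 1)\<close>.\<close>

lemma good_regime2b:
  fixes z :: real
  assumes z: "2978/10000 \<le> z" "z \<le> 3714/10000"
  shows "good (1 / z)"
proof -
  have z01: "0 < z" "z < 1" using z by auto
  have "1 \<le> geo 1 z * (qsum z Q2 - 1)"
    by (rule order.trans[OF _ geo_qsum_mono(2)[OF _ z(1) z01(2)]]) (simp_all add: geo_def qsum_Q2 power_divide)
  moreover have "0 < 1 - z^2" using z01 by (simp add: power_less_one_iff)
  ultimately have k: "1 - z^2 \<le> z * (qsum z Q2 - 1)"
    by (simp add: geo_def field_simps)
  have c: "core z * (qsum z Q2 - 1) = z^6 * (geo 1 z * (qsum z Q2 - 1))"
    "core z * (qsum z Q2 - 1) = z^5 * (geo 2 z * (qsum z Q2 - 1))"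
    using geo_add[of 6 1 z] geo_add[of 5 2 z] by (simp_all add: core_geo)
  have h: "z^6 \<le> core z * (qsum z Q2 - 1)"
    using mult_left_mono[OF \<open>1 \<le> geo 1 z * (qsum z Q2 - 1)\<close>, of "z^6"] z01 unfolding c(1) by simp
  show ?thesis
  proof (cases "base2 z + core z + z^3 + 9 * z^4 + 66 * z^5 \<le> 1")
    case True
    let ?x = "2978/10000 :: real"
    have "1 \<le> base2 ?x + ?x^3 + 9 * ?x^4 + 66 * ?x^5 + 453 * ?x^6 + geo 7 ?x * qsum ?x Q2"
      by (simp add: base2_def geo_def qsum_Q2 power_divide)
    also have "\<dots> \<le> base2 z + z^3 + 9 * z^4 + 66 * z^5 + 453 * z^6 + geo 7 z * qsum z Q2"
      using z base2_mono[OF _ z(1) z01(2)] geo_qsum_mono(1)[OF _ z(1) z01(2), of 7]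
      by (intro add_mono mult_left_mono power_mono) auto
    finally show ?thesis
      using good_using_length6[OF z01 k h True] by (simp add: core_geo)
  next
    case False
    \<comment> \<open>Up to 0.325 the mandatory part with all extras of length five fits. From there
      on, two permutations of length six as small change suffice to spend weights
      \<open>z^5\<close>.\<close>
    have z325: "325/1000 \<le> z"
    proof (rule ccontr)
      assume "\<not> ?thesis"
      then have le: "z \<le> 325/1000" by simp
      let ?x = "325/1000 :: real"
      have "base2 z + core z + z^3 + 9 * z^4 + 66 * z^5 \<le> base2 ?x + core ?x + ?x^3 + 9 * ?x^4 + 66 * ?x^5"
        using z01 le base2_mono[OF z01(1) le] core_mono[OF z01(1) le]
        by (intro add_mono mult_left_mono power_mono) auto
      also have "\<dots> \<le> 1" by (simp add: base2_def core_def power_divide)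
      finally show False using False by simp
    qed
    have "1 \<le> geo 2 (325/1000) * (qsum (325/1000) Q2 - 1) + 2 * (325/1000)"
      by (simp add: geo_def qsum_Q2 power_divide)
    then have "1 \<le> geo 2 z * (qsum z Q2 - 1) + 2 * z"
      using geo_qsum_mono(2)[OF _ z325 z01(2), of 2] z325 by simp
    from mult_left_mono[OF this, of "z^5"] have w: "z^5 \<le> core z * (qsum z Q2 - 1) + 2 * z^6"
      using z01 unfolding c(2) by (simp add: distrib_left numeral_eq_Suc mult_ac)
    let ?x = "3714/10000 :: real"
    have "base2 z + core z + z^3 + 9 * z^4 + z^5 \<le> base2 ?x + core ?x + ?x^3 + 9 * ?x^4 + ?x^5"
      using z01 z(2) base2_mono[OF z01(1) z(2)] core_mono[OF z01(1) z(2)]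
      by (intro add_mono mult_left_mono power_mono) auto
    also have "\<dots> \<le> 1" by (simp add: base2_def core_def power_divide)
    finally have b: "base2 z + core z + z^3 + 9 * z^4 + z^5 \<le> 1" .
    \<comment> \<open>The failed case condition is the upper bound wanted for
      \<open>good_using_length5\<close>, once the smallest digits are replaced by the
      largest.\<close>
    have "core z * 1 \<le> core z * qsum z Q2"
      using z01 geo_pos[of z 7] qsum_Q2_ge[of z] by (intro mult_left_mono) (auto simp: core_geo)
    moreover have "0 \<le> z^6" using z01 by simp
    ultimately have "1 \<le> base2 z + z^3 + 9 * z^4 + 66 * z^5 + 2 * z^6 + core z * qsum z Q2"
      using False by linarith
    then show ?thesis using good_using_length5[OF z01 k h w b] by simp
  qed
qed

section \<open>Large \<open>z\<close>: restricted one-centre words\<close>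

definition tsum :: "real \<Rightarrow> (nat \<times> nat \<times> nat) list \<Rightarrow> real" where
  "tsum z L = sum_list (map (\<lambda>(a, k, b). z ^ (a + k + b + 4)) L)"

lemma down3_S0_take:
  assumes L: "chk_triples L"
  shows "down3 (S0 \<union> set (take n L))"
  unfolding down3_def
proof (intro allI impI, elim conjE)
  fix a k b a' k' b'
  assume m: "(a, k, b) \<in> S0 \<union> set (take n L)" and le: "a' \<le> a" "k' \<le> k" "b' \<le> b"
  show "(a', k', b') \<in> S0 \<union> set (take n L)"
  proof (cases "(a, k, b) \<in> S0")
    case True
    then show ?thesis using le by (auto simp: S0_def)
  next
    case False
    then obtain i where i: "i < length L" "i < n" "L ! i = (a, k, b)"
      using m by (auto simp: in_set_conv_nth)
    have i': "i \<in> set [0..<length L]" using i by simp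
    have "a' \<in> set [0..<Suc a]" "k' \<in> set [0..<Suc k]" "b' \<in> set [0..<Suc b]"
      using le by (simp_all only: set_upt atLeastLessThan_iff le0 less_Suc_eq_le simp_thms)
    with bspec[OF L[unfolded chk_triples_def list_all_iff, THEN conjunct2, THEN conjunct2] i', unfolded i(3) prod.case]
    have "(a' + k' \<le> 1 \<or> k' + b' \<le> 1) \<or> (a', k', b') \<in> set (take (Suc i) L)" by blast
    moreover have "set (take (Suc i) L) \<subseteq> set (take n L)"
      using i by (intro set_take_subset_set_take) simp
    ultimately show ?thesis by (auto simp: S0_def)
  qed
qed

lemma has_sum_S0_take:
  fixes z :: real
  assumes z: "0 < z" "z < 1" and L: "chk_triples L"
  shows "((\<lambda>(a, k, b). z ^ (a + k + b + 4)) has_sum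
    (z^4 + 2 * z^5 + 2 * z^6 + z^7) / (1 - z) + tsum z (take n L)) (S0 \<union> set (take n L))"
proof (rule has_sum_Un_disjoint[OF has_sum_S0[OF z]])
  have d: "distinct (take n L)" and L': "\<forall>(a, k, b) \<in> set L. \<not> (a + k \<le> 1 \<or> k + b \<le> 1)"
    using L by (simp_all add: chk_triples_def list_all_iff)
  show "((\<lambda>(a, k, b). z ^ (a + k + b + 4)) has_sum tsum z (take n L)) (set (take n L))"
    unfolding tsum_def sum_list_distinct_conv_sum_set[OF d] by (rule has_sum_finite) simp
  show "S0 \<inter> set (take n L) = {}"
    using L' set_take_subset[of n L] by (auto simp: S0_def)
qed

lemma prefix_closed_Q1: "S0 \<subseteq> S \<Longrightarrow> prefix_closed S Q1"
  by (rule chk_prefix[OF chk_prefix_Q1]) (auto simp: Q1_def S0_def)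

text \<open>The third bound on \<open>z\<close> is the gap condition for \<open>Q1\<close> with its
  first quadruple mandatory: \<open>1 - z^2 \<le> 4 * z^2 + 4 * z^3\<close>.\<close>

lemma good_regime1:
  fixes z :: real
  assumes z: "0 < z" "z < 1" "1 \<le> 5 * z^2 + 4 * z^3" and L: "chk_triples L" and E: "okE (S0 \<union> set (take n L)) E"
    and R: "z ^ (2 * dd + 7) / (1 - z^2) \<le> R" "R \<le> z ^ (2 * dd + 7) * qsum z Q1 / (1 - z^2)"
    and tot: "z + z^2 + 2 * z^3 / (1 - z) + (z^4 + 2 * z^5 + 2 * z^6 + z^7) / (1 - z) + tsum z (take n L) +
      esum z E + R = 1"
  shows "good (1 / z)"
proof (rule good_assemble[OF z(1,2) down3_S0_take[OF L] prefix_closed_Q1 E has_sum_S0_take[OF z(1,2) L],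
      where c = 1 and dd = dd and g = z and R = R])
  have pos: "list_all (\<lambda>n. 1 \<le> n) (tl (map level Q1))"
    unfolding level_Q1 by code_simp
  show "z ^ level (Q1 ! n) \<le> z" if "1 \<le> n" "n < length Q1" for n
    using power_decreasing[of 1 "level (Q1 ! n)" z] level_pos[OF pos that] z by simp
  have "z * (1 - z^2) \<le> z * (4 * z^2 + 4 * z^3)"
    using z by (intro mult_left_mono) auto
  then show "z * (1 - z^2) \<le> z^2 * (qsum z Q1 - qsum z (take 1 Q1))"
    unfolding qsum_Q1 qsum_take1_Q1 by (simp add: algebra_simps power2_eq_square power3_eq_cube)
  show "1 \<le> length Q1" by (simp add: Q1_def)
qed (use R tot in \<open>simp_all add: qsum_take1_Q1[simplified]\<close>)

text \<open>What the paths and \<open>S0\<close> leave to two-centre words, further one-centre words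
  and extras.\<close>

definition rest :: "real \<Rightarrow> real" where
  "rest z = 1 - (z + z^2 + 2 * z^3 / (1 - z) + (z^4 + 2 * z^5 + 2 * z^6 + z^7) / (1 - z))"

lemma rest_antimono: "0 < x \<Longrightarrow> x \<le> y \<Longrightarrow> y < 1 \<Longrightarrow> rest y \<le> rest x"
  unfolding rest_def by (intro diff_left_mono add_mono frac_le power_mono mult_left_mono add_nonneg_nonneg) auto

text \<open>Multiplying the difference of the two sides by \<open>1 - z\<close> clears the
  denominators and leaves the reversed polynomial of \<open>lamB\<close>.\<close>

lemma rest_ge:
  assumes z: "0 < z" "z < 1" and q: "0 \<le> 1 - 2 * z - z^3 - z^4 - 2 * z^5 - 2 * z^6 - z^7 - z^8"
  shows "z^8 / (1 - z) \<le> rest z"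
proof -
  have "rest z - z^8 / (1 - z) = (1 - z - z^2) - (2 * z^3 + z^4 + 2 * z^5 + 2 * z^6 + z^7 + z^8) / (1 - z)"
    unfolding rest_def by (simp add: add_divide_distrib)
  then have "(rest z - z^8 / (1 - z)) * (1 - z) = (1 - z - z^2) * (1 - z) - (2 * z^3 + z^4 + 2 * z^5 + 2 * z^6 + z^7 + z^8)"
    using z by (simp add: left_diff_distrib)
  also have "\<dots> = 1 - 2 * z - z^3 - z^4 - 2 * z^5 - 2 * z^6 - z^7 - z^8"
    by (simp add: algebra_simps numeral_eq_Suc)
  finally have "(rest z - z^8 / (1 - z)) * (1 - z) = 1 - 2 * z - z^3 - z^4 - 2 * z^5 - 2 * z^6 - z^7 - z^8" .
  then have "0 \<le> (rest z - z^8 / (1 - z)) * (1 - z)" using q by simp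
  then show ?thesis using z by (simp add: zero_le_mult_iff)
qed

lemma tsum_levels: "tsum z L = sum_list (map (\<lambda>n. z ^ n) (map (\<lambda>(a, k, b). a + k + b + 4) L))"
  unfolding tsum_def map_map by (intro arg_cong[of _ _ sum_list] map_cong) auto

lemma tsum_take: "tsum z (take n L) = sum_list (take n (map (\<lambda>(a, k, b). z ^ (a + k + b + 4)) L))"
  by (simp add: tsum_def take_map)

lemma tsum_L1: "tsum z L1 = z^6 + 4 * z^7 + 9 * z^8 + 15 * z^9"
  unfolding tsum_levels level_L1 by (simp add: sum_list_replicate)

lemma tsum_L0: "tsum z L0 = z^8 + 2 * z^9"
  by (simp add: tsum_def L0_def)

lemma L1_level_ge: "(a, k, b) \<in> set L1 \<Longrightarrow> 6 \<le> a + k + b + 4"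
proof -
  have "\<forall>n \<in> set (map (\<lambda>(a, k, b). a + k + b + 4) L1). 6 \<le> n"
    unfolding level_L1 by (auto split: if_splits)
  then show "(a, k, b) \<in> set L1 \<Longrightarrow> 6 \<le> a + k + b + 4" by fastforce
qed

text \<open>Too little is left for two-centre words at every \<open>d\<close>, so
  \<open>d = 0\<close> is dropped. This lowers the minimum to \<open>z^9 / (1 - z^2)\<close>, which
  is below \<open>z^8 / (1 - z) = (z^8 + z^9) / (1 - z^2)\<close>. The triples in \<open>L0\<close>
  bridge the way up to \<open>z^7 / (1 - z^2)\<close>.\<close>

lemma good_regime1_low:
  fixes z :: real
  assumes z: "41/100 \<le> z" "z < 1" and lo: "z^8 / (1 - z) \<le> rest z" and hi: "rest z \<le> z^7 / (1 - z^2)"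
  shows "good (1 / z)"
proof -
  have z0: "0 < z" using z by simp
  have "(41/100) ^ n \<le> z ^ n" for n using z by (intro power_mono) auto
  note pow = this
  have kak: "1 \<le> 5 * z^2 + 4 * z^3"
    using pow[of 2] pow[of 3] by (simp add: power_divide)
  have q: "0 < 1 - z^2" using z z0 by (simp add: power_less_one_iff)
  define h where "h = (4 * z + 4 * z^2) * geo 9 z"
  have h8: "z^8 \<le> h"
  proof -
    have "z^8 * (1 - z^2) \<le> z^8 * (4 * z^2 + 4 * z^3)"
      using z0 kak by (intro mult_left_mono) auto
    also have "\<dots> = h * (1 - z^2)"
      using q unfolding h_def geo_def by (simp add: field_simps numeral_eq_Suc)
    finally show ?thesis using q by simp
  qed
  have "geo 9 z \<le> rest z"
  proof -
    have "geo 9 z * (1 - z^2) \<le> z^8 / (1 - z) * (1 - z^2)"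
    proof -
      have "geo 9 z * (1 - z^2) = z^8 * z" using q by (simp add: geo_def numeral_eq_Suc)
      also have "\<dots> \<le> z^8 * (1 + z)" using z0 by (intro mult_left_mono) auto
      also have "\<dots> = z^8 / (1 - z) * (1 - z^2)" using z by (simp add: field_simps power2_eq_square)
      finally show ?thesis .
    qed
    then have "geo 9 z \<le> z^8 / (1 - z)" using q by (rule mult_right_le_imp_le)
    then show ?thesis using lo by simp
  qed
  moreover have "rest z \<le> geo 9 z + h + tsum z L0"
  proof -
    \<comment> \<open>This is \<open>geo 7 z \<le> geo 9 z + h + tsum z L0\<close>, multiplied by
      \<open>1 - z^2\<close> and divided by \<open>z^7\<close>.\<close>
    have "1 \<le> z + 3 * z^2 + 3 * z^3 + 2 * z^4"
      using z(1) pow[of 2] pow[of 3] pow[of 4] by (simp add: power_divide)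
    then have "z^7 * 1 \<le> z^7 * (z + 3 * z^2 + 3 * z^3 + 2 * z^4)"
      using z0 by (intro mult_left_mono) auto
    also have "\<dots> = (1 + 4 * z + 4 * z^2) * (geo 9 z * (1 - z^2)) + (z^8 + 2 * z^9) * (1 - z^2) - geo 7 z * (1 - z^2) + z^7"
    proof -
      have f: "geo k z * (1 - z^2) = z^k" for k using q by (simp add: geo_def)
      show ?thesis unfolding f by (simp add: algebra_simps numeral_eq_Suc)
    qed
    also have "\<dots> = (geo 9 z + h + tsum z L0 - geo 7 z) * (1 - z^2) + z^7"
      unfolding h_def tsum_L0 by (simp add: algebra_simps)
    finally have "0 \<le> (geo 9 z + h + tsum z L0 - geo 7 z) * (1 - z^2)" by simp
    then have "geo 7 z \<le> geo 9 z + h + tsum z L0" using q by (simp add: zero_le_mult_iff)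
    then show ?thesis using hi by (simp add: geo_def)
  qed
  moreover have "w \<le> h" if "w \<in> set (map (\<lambda>(a, k, b). z ^ (a + k + b + 4)) L0)" for w
  proof -
    have "w = z^8 \<or> w = z^9" using that by (auto simp: L0_def)
    moreover have "z^9 \<le> z^8" using z z0 by (intro power_decreasing) auto
    ultimately show ?thesis using h8 by auto
  qed
  ultimately obtain n where n: "geo 9 z \<le> rest z - tsum z (take n L0)" "rest z - tsum z (take n L0) \<le> geo 9 z + h"
    using chain_prefix[of "map (\<lambda>(a, k, b). z ^ (a + k + b + 4)) L0" h "geo 9 z" "rest z"]
    unfolding tsum_take tsum_def[of z L0] by auto
  show ?thesis
  proof (rule good_regime1[OF z0 z(2) kak chk_triples_L0, where n = n and E = "{}" and dd = 1])
    show "okE (S0 \<union> set (take n L0)) {}" by (simp add: okE_def)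
    show "z ^ (2 * 1 + 7) / (1 - z^2) \<le> rest z - tsum z (take n L0)"
      using n(1) by (simp add: geo_def)
    show "rest z - tsum z (take n L0) \<le> z ^ (2 * 1 + 7) * qsum z Q1 / (1 - z^2)"
      using n(2) unfolding h_def geo_def qsum_Q1 by (simp add: algebra_simps add_divide_distrib)
  qed (simp add: rest_def esum_def)
qed

text \<open>The heavy chain consists of the two extras of length four, whose deletions need only
  paths, so any \<open>S\<close> will do; the triples of \<open>L1\<close> are the light
  chain.\<close>

lemma good_regime1_main:
  fixes z :: real
  assumes z: "41/100 \<le> z" "z < 1" and lo: "z^7 / (1 - z^2) \<le> rest z"
  shows "good (1 / z)"
proof -
  have z0: "0 < z" using z by simp
  have "(41/100) ^ n \<le> z ^ n" for n using z by (intro power_mono) auto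
  note pow = this
  have kak: "1 \<le> 5 * z^2 + 4 * z^3"
    using pow[of 2] pow[of 3] by (simp add: power_divide)
  have q: "0 < 1 - z^2" using z z0 by (simp add: power_less_one_iff)
  define h where "h = (4 * z + 4 * z^2) * geo 7 z"
  have h6: "z^6 \<le> h"
  proof -
    have "z^6 * (1 - z^2) \<le> z^6 * (4 * z^2 + 4 * z^3)"
      using z0 kak by (intro mult_left_mono) auto
    also have "\<dots> = h * (1 - z^2)"
      using q unfolding h_def geo_def by (simp add: field_simps numeral_eq_Suc)
    finally show ?thesis using q by simp
  qed
  let ?x = "41/100 :: real"
  have x: "0 < ?x" by simp
  note f = geo_mono[OF x z]
  have "1 \<le> (4 * ?x + 4 * ?x^2) * geo 3 ?x + ?x^2 + 4 * ?x^3 + 9 * ?x^4 + 15 * ?x^5"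
    by (simp add: geo_def power_divide)
  also have "\<dots> \<le> (4 * z + 4 * z^2) * geo 3 z + z^2 + 4 * z^3 + 9 * z^4 + 15 * z^5"
    using z pow f geo_pos[of ?x 3] by (intro add_mono mult_mono mult_left_mono) auto
  finally have "z^4 * 1 \<le> z^4 * ((4 * z + 4 * z^2) * geo 3 z + z^2 + 4 * z^3 + 9 * z^4 + 15 * z^5)"
    using z0 by (intro mult_left_mono) auto
  also have "\<dots> = h + tsum z L1"
    using geo_add[of 4 3 z] unfolding h_def tsum_L1 by (simp add: algebra_simps numeral_eq_Suc)
  finally have h4: "z^4 \<le> h + tsum z L1" by simp
  \<comment> \<open>\<open>rest\<close> decreases while the weights on the other side increase, so
    the comparison at 0.41 settles all larger \<open>z\<close>.\<close>
  have "rest z \<le> rest ?x" by (rule rest_antimono[OF x z])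
  also have "\<dots> \<le> (1 + 4 * ?x + 4 * ?x^2) * geo 7 ?x + 2 * ?x^4 + (?x^6 + 4 * ?x^7 + 9 * ?x^8 + 15 * ?x^9)"
    by (simp add: geo_def rest_def power_divide)
  also have "\<dots> \<le> (1 + 4 * z + 4 * z^2) * geo 7 z + 2 * z^4 + (z^6 + 4 * z^7 + 9 * z^8 + 15 * z^9)"
    using z pow f geo_pos[of ?x 7] by (intro add_mono mult_mono mult_left_mono) auto
  finally have hi: "rest z \<le> geo 7 z + h + 2 * z^4 + tsum z L1"
    unfolding h_def tsum_L1 by (simp add: algebra_simps)
  have l: "lsum z Y4 = 2 * z^4" by (simp add: lsum_def Y4_def numeral_eq_Suc)
  let ?us = "map (\<lambda>x. z ^ length x) Y4" and ?ws = "map (\<lambda>(a, k, b). z ^ (a + k + b + 4)) L1"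
  have us: "w \<le> h + sum_list ?ws" if "w \<in> set ?us" for w
    using that h4 by (auto simp: Y4_def tsum_def numeral_eq_Suc)
  have ws: "w \<le> h" if w: "w \<in> set ?ws" for w
  proof -
    from w obtain a k b where "(a, k, b) \<in> set L1" "w = z ^ (a + k + b + 4)" by auto
    then have "w \<le> z^6" using z z0 L1_level_ge by (auto intro!: power_decreasing)
    then show ?thesis using h6 by simp
  qed
  have "rest z \<le> geo 7 z + h + sum_list ?us + sum_list ?ws"
    using hi l by (simp add: lsum_def tsum_def)
  from two_chains[OF us ws _ this] lo obtain m n where
    mn: "geo 7 z \<le> rest z - sum_list (take m ?us) - sum_list (take n ?ws)"
      "rest z - sum_list (take m ?us) - sum_list (take n ?ws) \<le> geo 7 z + h"
    by (auto simp: geo_def)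
  have e: "esum z (set (take m Y4)) = sum_list (take m ?us)"
  proof -
    have "distinct (take m Y4)" by (rule distinct_take) (simp add: Y4_def)
    then show ?thesis by (simp add: esum_set lsum_def take_map)
  qed
  define R where "R = rest z - esum z (set (take m Y4)) - tsum z (take n L1)"
  show ?thesis
  proof (rule good_regime1[OF z0 z(2) kak chk_triples_L1 okE_Y4, where n = n and dd = 0 and R = R])
    show "z ^ (2 * 0 + 7) / (1 - z^2) \<le> R"
      using mn(1) unfolding R_def e tsum_take by (simp add: geo_def)
    show "R \<le> z ^ (2 * 0 + 7) * qsum z Q1 / (1 - z^2)"
      using mn(2) unfolding R_def e tsum_take h_def geo_def qsum_Q1 by (simp add: algebra_simps add_divide_distrib)
  qed (simp add: R_def rest_def)
qed

text \<open>The polynomial of the theorem with its coefficients reversed is decreasing, hence nonnegative at \<open>1 / \<gamma>\<close> for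
  all \<open>\<gamma>\<close> beyond the root.\<close>

definition qB :: "real \<Rightarrow> real" where
  "qB z = 1 - 2 * z - z^3 - z^4 - 2 * z^5 - 2 * z^6 - z^7 - z^8"

lemma qB_antimono: "0 < x \<Longrightarrow> x \<le> y \<Longrightarrow> qB y \<le> qB x"
  unfolding qB_def by (intro diff_mono mult_left_mono power_mono) auto

lemma qB_inverse:
  assumes "x > 0"
  shows "x^8 - 2*x^7 - x^5 - x^4 - 2*x^3 - 2*x^2 - x - 1 = x^8 * qB (1 / x)"
  using assms unfolding qB_def by (simp add: power_one_over field_simps numeral_eq_Suc)

lemma good_interval:
  assumes z: "2978/10000 \<le> z" "0 \<le> qB z"
  shows "good (1 / z)"
proof -
  have z1: "z < 1"
  proof (rule ccontr)
    assume "\<not> ?thesis"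
    then have "qB z \<le> qB 1" by (intro qB_antimono) auto
    then show False using z by (simp add: qB_def)
  qed
  consider "z \<le> 3714/10000" | "3714/10000 \<le> z" "z \<le> 41/100" | "41/100 \<le> z" by linarith
  then show ?thesis
  proof cases
    case 3
    have "z^8 / (1 - z) \<le> rest z" using z z1 by (intro rest_ge) (auto simp: qB_def)
    then show ?thesis using good_regime1_low[OF 3 z1] good_regime1_main[OF 3 z1] by linarith
  qed (use good_regime2a good_regime2b z in blast)+
qed

lemma good_add1: "0 < g \<Longrightarrow> good g \<Longrightarrow> good (g + 1)"
  unfolding good_def using perm_class_juxt growth_bounds_juxt by metis

lemma good_ge:
  assumes l: "0 < l" "qB (1 / l) = 0" and g: "l \<le> g"
  shows "good g"
proof -
  \<comment> \<open>This makes \<open>1 / (l + 1)\<close> at least \<open>1000 / 3357\<close>, which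
    exceeds the left end 0.2978 of \<open>good_interval\<close>.\<close>
  have lu: "l \<le> 2357/1000"
  proof (rule ccontr)
    assume "\<not> ?thesis"
    then have "1 / l \<le> 1000/2357" using l by (simp add: field_simps)
    then have "qB (1000/2357) \<le> qB (1 / l)" using l by (intro qB_antimono) auto
    moreover have "0 < qB (1000/2357)" by (simp add: qB_def power_divide)
    ultimately show False using l by simp
  qed
  have base: "good x" if "l \<le> x" "x \<le> l + 1" for x
  proof -
    have "2978/10000 \<le> 1 / x" using that lu l by (simp add: field_simps)
    moreover have "0 \<le> qB (1 / x)"
      using qB_antimono[of "1 / x" "1 / l"] that l by (simp add: frac_le)
    ultimately show ?thesis using good_interval[of "1 / x"] by simp
  qed
  \<comment> \<open>The unit interval above \<open>l\<close> is moved up by juxtaposition with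
    increasing sequences, one step for each \<open>n\<close>.\<close>
  have "\<forall>x. l \<le> x \<and> x \<le> l + real (Suc n) \<longrightarrow> good x" for n
  proof (induction n)
    case 0
    then show ?case using base by simp
  next
    case (Suc n)
    show ?case
    proof (intro allI impI)
      fix x assume x: "l \<le> x \<and> x \<le> l + real (Suc (Suc n))"
      show "good x"
      proof (cases "x \<le> l + 1")
        case True
        then show ?thesis using base x by simp
      next
        case False
        then have "good (x - 1)" using Suc x by simp
        then show ?thesis using good_add1[of "x - 1"] False l by simp
      qed
    qed
  qed
  moreover obtain n :: nat where "g - l \<le> n" using real_arch_simple by blast
  ultimately show ?thesis using g by (metis add.commute diff_le_eq le_SucI of_nat_le_iff le_refl order_trans add_left_mono)
qed

theorem theorem2:
  fixes lamB gamma :: real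
  assumes "lamB > 0"
    and "lamB^8 - 2*lamB^7 - lamB^5 - lamB^4 - 2*lamB^3 - 2*lamB^2 - lamB - 1 = 0"
    and "\<forall>x::real. x > 0 \<and> x^8 - 2*x^7 - x^5 - x^4 - 2*x^3 - 2*x^2 - x - 1 = 0 \<longrightarrow> x = lamB"
    and "gamma \<ge> lamB"
  shows "\<exists>C. perm_class C \<and> has_growth_rate C gamma"
proof -
  have "qB (1 / lamB) = 0"
    using assms(1,2) qB_inverse[of lamB] by simp
  from good_ge[OF assms(1) this assms(4)] obtain C where C: "perm_class C" "growth_bounds (cnt C) gamma"
    unfolding good_def by blast
  have "has_growth_rate C gamma"
    using growth_bounds_root[OF _ C(2)] assms(1,4) by (simp add: has_growth_rate_def cnt_def)
  then show ?thesis using C(1) by blast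
qed

end
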